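(* Let $W$ be a graphon such that $W$ and $x\mapsto W(x,x)$ are Riemann integrable and $\int_{[0,1]^2}W(x,y)\,dx\,dy>0$. Let $\theta_N\in(0,1)$ satisfy $N^{2/3}\theta_N\gtrsim1$ and $\theta_N\to0$. Let $\beta_0\in(0,1/\|W\|_{\mathrm{op}})$ and $\alpha\in(0,1)$ be fixed. Define $$\hat c_\alpha:=-z_{\alpha/2}\sqrt{\frac{1}{2N^2\theta_N^2}\sum_{1\le i,j\le N}A_{G_N}(i,j)}-\frac{\beta_0}{2N^2\theta_N^2}\sum_{1\le i,j\le N}A_{G_N}(i,j),$$ $$\hat d_\alpha:=z_{\alpha/2}\sqrt{\frac{1}{2N^2\theta_N^2}\sum_{1\le i,j\le N}A_{G_N}(i,j)}-\frac{\beta_0}{2N^2\theta_N^2}\sum_{1\le i,j\le N}A_{G_N}(i,j),$$ and, for $\beta\in(0,1/\|W\|_{\mathrm{op}})$, $\rho_N(\beta):=\mathbb P_\beta(H_N(\vec\sigma)<\hat c_\alpha)+\mathbb P_\beta(H_N(\vec\sigma)>\hat d_\alpha)$. Then: (a) $\lim_{N\to\infty}\rho_N(\beta_0)=\alpha$. (b) For any $\beta\in(0,1/\|W\|_{\mathrm{op}})$ with $\beta\ne\beta_0$, $\lim_{N\to\infty}\rho_N(\beta)=1$.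
   Context: A graphon is a symmetric measurable function $W:[0,1]^2\to[0,1]$; $\|W\|_{\mathrm{op}}$ is the operator norm of $T_W:L^2[0,1]\to L^2[0,1]$, $(T_Wf)(x)=\int_0^1W(x,y)f(y)\,dy$. $G_N\sim G(N,\theta_N,W)$ is the random graph (self-loops allowed) on $\{1,\dots,N\}$ with symmetric adjacency matrix $A_{G_N}$ whose entries $A_{G_N}(i,j)$, $1\le i\le j\le N$, are independent Bernoulli with parameters $\theta_NW(\frac iN,\frac jN)$. For $\vec\sigma\in\{-1,1\}^N$, $H_N(\vec\sigma)=-\frac{1}{2N\theta_N}\sum_{1\le i,j\le N}A_{G_N}(i,j)\sigma_i\sigma_j$. Given $G_N$, the Ising model has $\vec\sigma$ with mass function $\frac{1}{2^NZ_N(\beta)}e^{-\beta H_N(\vec\sigma)}$, $Z_N(\beta)=2^{-N}\sum_{\vec\sigma\in\{-1,1\}^N}e^{-\beta H_N(\vec\sigma)}$. The probabilities $\mathbb P_\beta(\cdot)$ in the definition of $\rho_N$ are over the joint randomness of $G_N$ and $\vec\sigma$. $z_a$ is the $(1-a)$-th quantile of $\mathcal N(0,1)$. $a_N\gtrsim b_N$ means $a_N\ge Cb_N$ for some constant $C>0$ and all large $N$. ($\rho_N$ is the power function of the test of $H_0:\beta=\beta_0$ rejecting when $H_N(\vec\sigma)<\hat c_\alpha$ or $H_N(\vec\sigma)>\hat d_\alpha$.) *)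

theory Defs
  imports "HOL-Probability.Probability"
begin

section \<open>Riemann integrability\<close>

text \<open>
  The library only has the gauge (Henstock--Kurzweil) integral. Riemann sums are compared with their
  limit for all tagged divisions of the box \<open>S\<close> into closed subboxes \<open>K\<close>, where the gauge is the
  constant one \<open>ball x d\<close>, i.e. a bound on the mesh that does not depend on the tag.
\<close>

definition riemann_integrable_on :: "('a::euclidean_space \<Rightarrow> real) \<Rightarrow> 'a set \<Rightarrow> bool"
    (infix \<open>riemann'_integrable'_on\<close> 46) where
  "f riemann_integrable_on S \<longleftrightarrow>
     (\<exists>I. \<forall>e>0. \<exists>d>0. \<forall>p. p tagged_division_of S \<and> (\<lambda>x. ball x d) fine p \<longrightarrow>
        \<bar>(\<Sum>(x, K)\<in>p. measure lborel K * f x) - I\<bar> < e)"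


section \<open>Graphons and their operator norm\<close>

text \<open>
  A graphon is a total function on the plane of which only the values on the unit square matter.
  Measurability is Lebesgue measurability.
\<close>

definition graphon :: "(real \<Rightarrow> real \<Rightarrow> real) \<Rightarrow> bool" where
  "graphon W \<longleftrightarrow>
     (\<lambda>(x, y). W x y) \<in> borel_measurable (lebesgue_on ({0..1} \<times> {0..1})) \<and>
     (\<forall>x\<in>{0..1}. \<forall>y\<in>{0..1}. W x y = W y x \<and> W x y \<in> {0..1})"

definition square_integrable01 :: "(real \<Rightarrow> real) set" where
  "square_integrable01 =
     {f \<in> borel_measurable (lebesgue_on {0..1}). integrable (lebesgue_on {0..1}) (\<lambda>x. (f x)\<^sup>2)}"

definition L2_norm01 :: "(real \<Rightarrow> real) \<Rightarrow> real" where
  "L2_norm01 f = sqrt (\<integral>x. (f x)\<^sup>2 \<partial>lebesgue_on {0..1})"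

definition graphon_operator :: "(real \<Rightarrow> real \<Rightarrow> real) \<Rightarrow> (real \<Rightarrow> real) \<Rightarrow> real \<Rightarrow> real" where
  "graphon_operator W f x = (\<integral>y. W x y * f y \<partial>lebesgue_on {0..1})"

definition graphon_op_norm :: "(real \<Rightarrow> real \<Rightarrow> real) \<Rightarrow> real" where
  "graphon_op_norm W =
     (SUP f \<in> {f \<in> square_integrable01. L2_norm01 f \<le> 1}. L2_norm01 (graphon_operator W f))"

text \<open>The supremum is over a bounded set, so it is a genuine one.\<close>

lemma bdd_above_graphon_op_norm:
  assumes "graphon W"
  shows "bdd_above ((\<lambda>f. L2_norm01 (graphon_operator W f)) ` {f \<in> square_integrable01. L2_norm01 f \<le> 1})"
proof (rule bdd_aboveI2)
  fix f assume "f \<in> {f \<in> square_integrable01. L2_norm01 f \<le> 1}"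
  then have sq: "integrable (lebesgue_on {0..1}) (\<lambda>x. (f x)\<^sup>2)"
    and le1: "(\<integral>x. (f x)\<^sup>2 \<partial>lebesgue_on {0..1}) \<le> 1"
    by (auto simp: square_integrable01_def L2_norm01_def)
  interpret U: prob_space "lebesgue_on {0..1::real}"
    by (rule prob_spaceI) (simp add: emeasure_restrict_space)
  have T: "\<bar>graphon_operator W f x\<bar> \<le> 1" if x: "x \<in> {0..1}" for x
  proof -
    have "norm (graphon_operator W f x) \<le> (\<integral>y. (1 + (f y)\<^sup>2) / 2 \<partial>lebesgue_on {0..1})"
      unfolding graphon_operator_def
    proof (rule order_trans[OF integral_norm_bound], rule Bochner_Integration.integral_mono')
      show "integrable (lebesgue_on {0..1}) (\<lambda>y. (1 + (f y)\<^sup>2) / 2)" using sq by simp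
      fix y :: real assume "y \<in> space (lebesgue_on {0..1})"
      then have "\<bar>W x y\<bar> \<le> 1" using assms x by (simp add: graphon_def)
      then have "\<bar>W x y\<bar> * \<bar>f y\<bar> \<le> 1 * \<bar>f y\<bar>" by (intro mult_right_mono) auto
      moreover have "0 \<le> (\<bar>f y\<bar> - 1)\<^sup>2" by simp
      then have "\<bar>f y\<bar> \<le> (1 + (f y)\<^sup>2) / 2" by (simp add: power2_eq_square algebra_simps)
      ultimately show "norm (W x y * f y) \<le> (1 + (f y)\<^sup>2) / 2" by (simp add: abs_mult)
      show "0 \<le> (1 + (f y)\<^sup>2) / 2" by simp
    qed
    also have "\<dots> \<le> 1" using sq le1 U.prob_space by simp
    finally show ?thesis by simp
  qed
  have "(\<integral>x. (graphon_operator W f x)\<^sup>2 \<partial>lebesgue_on {0..1}) \<le> (\<integral>x. 1 \<partial>lebesgue_on {0..1::real})"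
    using T by (intro Bochner_Integration.integral_mono') (auto simp: abs_square_le_1)
  then show "L2_norm01 (graphon_operator W f) \<le> 1"
    using U.prob_space by (simp add: L2_norm01_def)
qed


section \<open>The random graph and the Ising model\<close>

text \<open>
  Adjacency matrices are functions \<open>A :: nat \<Rightarrow> nat \<Rightarrow> real\<close> and \<open>t\<close> stands for \<open>\<theta>\<^sub>N\<close>. The coin for
  the unordered pair \<open>{i, j}\<close> is indexed by \<open>(min i j, max i j)\<close>; indices outside \<open>{1..N}\<close> carry the
  default value \<open>False\<close>, i.e. the matrix entry 0.
\<close>

definition random_graph :: "nat \<Rightarrow> real \<Rightarrow> (real \<Rightarrow> real \<Rightarrow> real) \<Rightarrow> (nat \<Rightarrow> nat \<Rightarrow> real) pmf" where
  "random_graph N t W =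
     map_pmf (\<lambda>g i j. of_bool (g (min i j, max i j)))
       (Pi_pmf {(i, j). 1 \<le> i \<and> i \<le> j \<and> j \<le> N} False
          (\<lambda>(i, j). bernoulli_pmf (t * W (real i / real N) (real j / real N))))"

definition spins :: "nat \<Rightarrow> (nat \<Rightarrow> real) set" where
  "spins N = {1..N} \<rightarrow>\<^sub>E {-1, 1}"

definition hamiltonian :: "nat \<Rightarrow> real \<Rightarrow> (nat \<Rightarrow> nat \<Rightarrow> real) \<Rightarrow> (nat \<Rightarrow> real) \<Rightarrow> real" where
  "hamiltonian N t A \<sigma> = - (1 / (2 * real N * t)) * (\<Sum>i=1..N. \<Sum>j=1..N. A i j * \<sigma> i * \<sigma> j)"

definition partition_function :: "nat \<Rightarrow> real \<Rightarrow> (nat \<Rightarrow> nat \<Rightarrow> real) \<Rightarrow> real \<Rightarrow> real" where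
  "partition_function N t A \<beta> = (1 / 2 ^ N) * (\<Sum>\<sigma>\<in>spins N. exp (- \<beta> * hamiltonian N t A \<sigma>))"

definition ising_mass ::
    "nat \<Rightarrow> real \<Rightarrow> (nat \<Rightarrow> nat \<Rightarrow> real) \<Rightarrow> real \<Rightarrow> (nat \<Rightarrow> real) \<Rightarrow> real" where
  "ising_mass N t A \<beta> \<sigma> =
     (if \<sigma> \<in> spins N
      then 1 / (2 ^ N * partition_function N t A \<beta>) * exp (- \<beta> * hamiltonian N t A \<sigma>)
      else 0)"

definition ising :: "nat \<Rightarrow> real \<Rightarrow> (nat \<Rightarrow> nat \<Rightarrow> real) \<Rightarrow> real \<Rightarrow> (nat \<Rightarrow> real) pmf" where
  "ising N t A \<beta> = embed_pmf (ising_mass N t A \<beta>)"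

lemma finite_spins: "finite (spins N)"
  unfolding spins_def by (intro finite_PiE) auto

lemma pmf_ising: "pmf (ising N t A \<beta>) \<sigma> = ising_mass N t A \<beta> \<sigma>"
proof -
  define S where "S = (\<Sum>\<sigma>\<in>spins N. exp (- \<beta> * hamiltonian N t A \<sigma>))"
  have "(\<lambda>i\<in>{1..N}. 1) \<in> spins N" by (auto simp: spins_def)
  then have S: "S > 0"
    unfolding S_def by (intro sum_pos finite_spins) auto
  have mass: "ising_mass N t A \<beta> = (\<lambda>\<sigma>. if \<sigma> \<in> spins N then exp (- \<beta> * hamiltonian N t A \<sigma>) / S else 0)"
    unfolding ising_mass_def partition_function_def S_def by auto
  have nonneg: "ising_mass N t A \<beta> \<sigma> \<ge> 0" for \<sigma>
    using S by (simp add: mass)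
  have "(\<integral>\<^sup>+\<sigma>. ennreal (ising_mass N t A \<beta> \<sigma>) \<partial>count_space UNIV)
      = (\<Sum>\<sigma>\<in>spins N. ennreal (ising_mass N t A \<beta> \<sigma>))"
    by (intro nn_integral_count_space' finite_spins) (auto simp: mass)
  also have "\<dots> = ennreal (\<Sum>\<sigma>\<in>spins N. ising_mass N t A \<beta> \<sigma>)"
    by (intro sum_ennreal nonneg)
  also have "(\<Sum>\<sigma>\<in>spins N. ising_mass N t A \<beta> \<sigma>) = S / S"
    by (simp add: mass S_def flip: sum_divide_distrib)
  finally have "(\<integral>\<^sup>+\<sigma>. ennreal (ising_mass N t A \<beta> \<sigma>) \<partial>count_space UNIV) = 1"
    using S by simp
  then show ?thesis
    unfolding ising_def by (intro pmf_embed_pmf nonneg)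
qed

definition ising_model ::
    "nat \<Rightarrow> real \<Rightarrow> (real \<Rightarrow> real \<Rightarrow> real) \<Rightarrow> real \<Rightarrow> ((nat \<Rightarrow> nat \<Rightarrow> real) \<times> (nat \<Rightarrow> real)) pmf" where
  "ising_model N t W \<beta> =
     bind_pmf (random_graph N t W) (\<lambda>A. map_pmf (\<lambda>\<sigma>. (A, \<sigma>)) (ising N t A \<beta>))"


section \<open>The test\<close>

definition normal_z :: "real \<Rightarrow> real" where
  "normal_z a = Inf {x. 1 - a \<le> cdf std_normal_distribution x}"

definition edge_sum :: "nat \<Rightarrow> (nat \<Rightarrow> nat \<Rightarrow> real) \<Rightarrow> real" where
  "edge_sum N A = (\<Sum>i=1..N. \<Sum>j=1..N. A i j)"

definition c_hat :: "nat \<Rightarrow> real \<Rightarrow> real \<Rightarrow> real \<Rightarrow> (nat \<Rightarrow> nat \<Rightarrow> real) \<Rightarrow> real" where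
  "c_hat N t \<beta>\<^sub>0 \<alpha> A =
     - normal_z (\<alpha> / 2) * sqrt (1 / (2 * (real N)\<^sup>2 * t\<^sup>2) * edge_sum N A)
     - \<beta>\<^sub>0 / (2 * (real N)\<^sup>2 * t\<^sup>2) * edge_sum N A"

definition d_hat :: "nat \<Rightarrow> real \<Rightarrow> real \<Rightarrow> real \<Rightarrow> (nat \<Rightarrow> nat \<Rightarrow> real) \<Rightarrow> real" where
  "d_hat N t \<beta>\<^sub>0 \<alpha> A =
     normal_z (\<alpha> / 2) * sqrt (1 / (2 * (real N)\<^sup>2 * t\<^sup>2) * edge_sum N A)
     - \<beta>\<^sub>0 / (2 * (real N)\<^sup>2 * t\<^sup>2) * edge_sum N A"

definition power_function ::
    "nat \<Rightarrow> real \<Rightarrow> (real \<Rightarrow> real \<Rightarrow> real) \<Rightarrow> real \<Rightarrow> real \<Rightarrow> real \<Rightarrow> real" where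
  "power_function N t W \<beta>\<^sub>0 \<alpha> \<beta> =
     measure_pmf.prob (ising_model N t W \<beta>) {(A, \<sigma>). hamiltonian N t A \<sigma> < c_hat N t \<beta>\<^sub>0 \<alpha> A} +
     measure_pmf.prob (ising_model N t W \<beta>) {(A, \<sigma>). hamiltonian N t A \<sigma> > d_hat N t \<beta>\<^sub>0 \<alpha> A}"

end

theory Submission
  imports Defs
begin

text \<open>
  Write \<open>b = \<beta> / (N \<theta>)\<close>, let \<open>Q\<close> be the sum of \<open>\<sigma>\<^sub>i \<sigma>\<^sub>j\<close> over the edges \<open>i < j\<close>, let \<open>E\<close> be the number
  of these edges, \<open>S\<close> the edge sum and \<open>w = \<integral>W\<close>. Up to self-loops, whose contribution is of
  lower order, \<open>H = - Q / (N \<theta>)\<close> and \<open>S = 2 E\<close>. The heart of the matter is that under inverse temperature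
  \<open>\<beta>\<close> the variable \<open>\<surd>\<theta> (H + \<beta> S / (2 N\<^sup>2 \<theta>\<^sup>2))\<close> is asymptotically centred normal with variance \<open>w / 2\<close>.

  Given the graph, the characteristic function of \<open>Q\<close> at \<open>u\<close> is \<open>Z(b + \<i> u) / Z(b)\<close>, where \<open>Z(z)\<close> is the
  average of \<open>exp (z Q)\<close> over independent fair signs. Since \<open>\<sigma>\<^sub>i \<sigma>\<^sub>j\<close> is a sign,
  \<open>exp (z \<sigma>\<^sub>i \<sigma>\<^sub>j) = cosh z (1 + \<sigma>\<^sub>i \<sigma>\<^sub>j tanh z)\<close>, and hence \<open>Z(z) = (cosh z)\<^sup>E p(tanh z)\<close> with the
  high-temperature polynomial \<open>p\<close> of the graph, the generating function of its even subgraphs. The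
  relevant frequency is \<open>u = s \<surd>\<theta> / (N \<theta>)\<close>, which is small compared to \<open>b\<close>, and the two factors behave
  as follows.

  The factor \<open>(cosh (b + \<i> u) / cosh b)\<^sup>E\<close> carries the normal law. After centring \<open>Q\<close> at \<open>b E\<close> it differs
  from \<open>exp (- E u\<^sup>2 / 2)\<close> by at most a multiple of \<open>E b\<^sup>4 \<bar>u / b\<bar>\<close>
  (\<open>norm_edge_factor_minus_gauss_le\<close>). As \<open>E\<close> is of order \<open>N\<^sup>2 \<theta>\<close>, the quantity \<open>E b\<^sup>4\<close> is of order
  \<open>1 / (N\<^sup>2 \<theta>\<^sup>3)\<close>, and it is bounded exactly because \<open>N\<close> to the power \<open>2 / 3\<close> times \<open>\<theta>\<close> is bounded below.
  By a variance estimate \<open>S / (N\<^sup>2 \<theta>)\<close> tends to \<open>w\<close>, so that \<open>exp (- E u\<^sup>2 / 2)\<close> tends to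
  \<open>exp (- s\<^sup>2 w / 4)\<close>.

  The factor \<open>p(tanh (b + \<i> u)) / p(tanh b)\<close> tends to 1. The polynomial \<open>p\<close> has nonnegative coefficients
  and constant term 1. Therefore the denominator is at least 1, and on the disc of radius \<open>r\<close> the
  polynomial has Lipschitz constant at most \<open>p(r') / (r' - r)\<close> for each \<open>r' > r\<close>
  (\<open>edge_poly_diff_le\<close>). Here the two arguments are at distance of order \<open>\<surd>\<theta> / (N \<theta>)\<close>, whereas \<open>r' - r\<close>
  can be taken of order \<open>1 / (N \<theta>)\<close>; so it suffices that the expectation of \<open>p(\<beta>' / (N \<theta>))\<close> over the
  graph stays bounded for some \<open>\<beta>' > \<beta>\<close>. No second moment of \<open>p\<close> enters.

  That expectation is at most the average of \<open>exp (\<sigma>\<^sup>T M \<sigma> / 2)\<close> over signs, where \<open>M\<close> has the entries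
  \<open>\<beta>' W(i/N, j/N) / N\<close> off the diagonal. If \<open>M \<le> 1 - \<epsilon>\<close> as quadratic forms, removing the spins one by
  one bounds this average in terms of \<open>\<epsilon>\<close> and the Frobenius norm of \<open>M\<close>, as for a Gaussian vector
  (\<open>spin_avg_exp_quadratic_le\<close>). For \<open>\<beta>' < 1 / \<parallel>W\<parallel>\<close> the hypothesis holds for large \<open>N\<close>, because the
  quadratic form of \<open>W\<close> on the grid is close to the one of the operator
  (\<open>graphon_grid_quadratic_form_le\<close>); this and the convergence of the mean of \<open>W\<close> over the grid follow
  from Riemann integrability, which makes the mean oscillation of \<open>W\<close> over the cells of the grid
  vanish.

  Levy's continuity theorem then gives the normal limit, and the random normalisation \<open>\<surd>S\<close> of the test
  is harmless since \<open>S\<close> concentrates. At \<open>\<beta> = \<beta>\<^sub>0\<close> the level is read off from the quantile. At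
  \<open>\<beta> \<noteq> \<beta>\<^sub>0\<close> the test centres \<open>H\<close> at the wrong value, and the normalised statistic drifts away at the rate
  \<open>\<bar>\<beta> - \<beta>\<^sub>0\<bar> / \<surd>\<theta>\<close>.
\<close>


section \<open>Averages over independent signs\<close>

abbreviation \<E> where "\<E> p \<equiv> measure_pmf.expectation p"

abbreviation \<P> where "\<P> p \<equiv> measure_pmf.prob p"

abbreviation quad_form :: "'i set \<Rightarrow> ('i \<Rightarrow> 'i \<Rightarrow> real) \<Rightarrow> ('i \<Rightarrow> real) \<Rightarrow> real" where
  "quad_form I M x \<equiv> (\<Sum>i\<in>I. \<Sum>j\<in>I. M i j * x i * x j)"

definition spin_avg :: "'i set \<Rightarrow> (('i \<Rightarrow> real) \<Rightarrow> 'a) \<Rightarrow> 'a::real_normed_field" where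
  "spin_avg I f = (\<Sum>\<sigma>\<in>I \<rightarrow>\<^sub>E {-1, 1}. f \<sigma>) / 2 ^ card I"

lemma spin_avg_empty [simp]: "spin_avg {} f = f (\<lambda>_. undefined)"
  by (simp add: spin_avg_def)

lemma spin_avg_insert:
  assumes "finite I" "n \<notin> I"
  shows "spin_avg (insert n I) f = spin_avg I (\<lambda>\<sigma>. (f (\<sigma>(n := 1)) + f (\<sigma>(n := -1))) / 2)"
proof -
  have "(\<Sum>\<sigma>\<in>insert n I \<rightarrow>\<^sub>E {-1, 1}. f \<sigma>)
      = (\<Sum>(s, \<sigma>)\<in>{-1, 1::real} \<times> (I \<rightarrow>\<^sub>E {-1, 1}). f (\<sigma>(n := s)))"
    unfolding PiE_insert_eq
    by (subst sum.reindex[OF inj_combinator[OF assms(2)]]) (simp add: case_prod_unfold)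
  also have "\<dots> = (\<Sum>\<sigma>\<in>I \<rightarrow>\<^sub>E {-1, 1}. f (\<sigma>(n := 1)) + f (\<sigma>(n := -1)))"
    by (simp add: sum.distrib flip: sum.cartesian_product)
  finally show ?thesis
    using assms by (simp add: spin_avg_def flip: sum_divide_distrib)
qed

lemma spin_avg_const [simp]: "finite I \<Longrightarrow> spin_avg I (\<lambda>_. c) = c"
  by (induction I rule: finite_induct) (auto simp: spin_avg_insert)

lemma spin_avg_cong:
  "(\<And>\<sigma>. \<sigma> \<in> I \<rightarrow>\<^sub>E {-1, 1} \<Longrightarrow> f \<sigma> = g \<sigma>) \<Longrightarrow> spin_avg I f = spin_avg I g"
  by (simp add: spin_avg_def)

lemma spin_avg_mono:
  fixes f g :: "('i \<Rightarrow> real) \<Rightarrow> real"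
  shows "(\<And>\<sigma>. \<sigma> \<in> I \<rightarrow>\<^sub>E {-1, 1} \<Longrightarrow> f \<sigma> \<le> g \<sigma>) \<Longrightarrow> spin_avg I f \<le> spin_avg I g"
  unfolding spin_avg_def by (intro divide_right_mono sum_mono) auto

lemma spin_avg_mult_left: "spin_avg I (\<lambda>\<sigma>. c * f \<sigma>) = c * spin_avg I f"
  by (simp add: spin_avg_def flip: sum_distrib_left)

lemma spin_avg_of_real: "spin_avg I (\<lambda>\<sigma>. of_real (f \<sigma>)) = of_real (spin_avg I f)"
  by (simp add: spin_avg_def)

text \<open>
  Termwise comparison of the power series, because \<open>2 ^ n * fact n \<le> fact (2 * n)\<close>.
\<close>

lemma cosh_le_exp_half_square: "cosh x \<le> exp (x\<^sup>2 / 2)" for x :: real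
proof -
  have "(\<lambda>n. x ^ (2 * n) / fact (2 * n)) sums cosh x"
  proof -
    have "(\<lambda>n. if even n then x ^ n /\<^sub>R fact n else 0) sums cosh x" by (rule cosh_converges)
    then have "(\<lambda>n. x ^ (2 * n) /\<^sub>R fact (2 * n)) sums cosh x"
      by (subst (asm) sums_mono_reindex[of "\<lambda>n. 2 * n", symmetric])
        (auto simp: strict_mono_def elim!: evenE)
    then show ?thesis by (simp add: field_simps)
  qed
  moreover have "(\<lambda>n. (x\<^sup>2 / 2) ^ n / fact n) sums exp (x\<^sup>2 / 2)"
    using exp_converges[of "x\<^sup>2 / 2"] by (simp add: field_simps)
  moreover have "x ^ (2 * n) / fact (2 * n) \<le> (x\<^sup>2 / 2) ^ n / fact n" for n
  proof -
    have "(2 ^ n * fact n :: real) \<le> fact (2 * n)"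
    proof (induction n)
      case (Suc n)
      have "(2 ^ Suc n * fact (Suc n) :: real) = (2 * (real n + 1)) * (2 ^ n * fact n)"
        by (simp add: algebra_simps)
      also have "\<dots> \<le> (2 * (real n + 1)) * fact (2 * n)"
        using Suc by (intro mult_left_mono) auto
      also have "\<dots> \<le> (2 * (real n + 1)) * ((2 * real n + 1) * fact (2 * n))"
        by (intro mult_left_mono) (auto simp: algebra_simps)
      also have "\<dots> = fact (2 * Suc n)" by (simp add: algebra_simps)
      finally show ?case .
    qed simp
    then show ?thesis
      by (simp add: power_mult power_divide divide_simps mult_left_mono)
  qed
  ultimately show ?thesis by (rule sums_le[rotated])
qed

lemma sum_sum_insert:
  fixes f :: "'i \<Rightarrow> 'i \<Rightarrow> real"
  assumes "finite I" "n \<notin> I"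
  shows "(\<Sum>i\<in>insert n I. \<Sum>j\<in>insert n I. f i j)
    = f n n + (\<Sum>i\<in>I. f n i) + (\<Sum>i\<in>I. f i n) + (\<Sum>i\<in>I. \<Sum>j\<in>I. f i j)"
  using assms by (simp add: sum.distrib algebra_simps)

text \<open>
  For a Gaussian vector in place of the signs, the average is the determinant of \<open>1 - M\<close> to the power
  \<open>- 1 / 2\<close>, and the right-hand side is a bound for it. For signs, one spin \<open>n\<close> is averaged out
  by \<open>cosh h \<le> exp (h\<^sup>2 / 2)\<close>. This replaces \<open>M\<close> by \<open>M + m m\<^sup>T\<close> on the other spins, where \<open>m\<close> is the row
  of \<open>n\<close>; up to a positive semidefinite matrix it is the Schur complement step of Gaussian elimination,
  so the gap \<open>\<epsilon>\<close> survives as long as the diagonal is nonnegative. The trace grows by \<open>\<bar>m\<bar>\<^sup>2\<close>, and the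
  constant \<open>1 / (4 \<epsilon>)\<close> is the one for which the loss in the Frobenius norm pays for that.
\<close>

lemma spin_avg_exp_quadratic_le:
  fixes M :: "'i \<Rightarrow> 'i \<Rightarrow> real"
  assumes "finite I" and "\<And>i j. i \<in> I \<Longrightarrow> j \<in> I \<Longrightarrow> M i j = M j i"
    and "\<And>i. i \<in> I \<Longrightarrow> 0 \<le> M i i" and "0 < \<epsilon>"
    and "\<And>x. quad_form I M x \<le> (1 - \<epsilon>) * (\<Sum>i\<in>I. (x i)\<^sup>2)"
  shows "spin_avg I (\<lambda>\<sigma>. exp (quad_form I M \<sigma> / 2))
    \<le> exp ((\<Sum>i\<in>I. M i i) / 2 + (\<Sum>i\<in>I. \<Sum>j\<in>I. (M i j)\<^sup>2) / (4 * \<epsilon>))"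
  using assms
proof (induction I arbitrary: M rule: finite_induct)
  case empty
  then show ?case by simp
next
  case (insert n I)
  define m where "m = M n"
  define M' where "M' = (\<lambda>i j. M i j + m i * m j)"
  have sym: "M i n = m i" if "i \<in> I" for i
    using insert.prems(1)[of i n] that by (simp add: m_def)
  define q where "q = (\<Sum>i\<in>I. (m i)\<^sup>2)"
  have sq: "(\<Sum>i\<in>I. \<Sum>j\<in>I. m i * m j * x i * x j) = (\<Sum>i\<in>I. m i * x i)\<^sup>2" for x
    by (simp add: power2_eq_square sum_product algebra_simps)
  have M'_quad: "quad_form I M' x
      = quad_form I M x + (\<Sum>i\<in>I. m i * x i)\<^sup>2" for x
    unfolding sq[symmetric] by (simp add: M'_def sum.distrib algebra_simps)
  have quad: "quad_form (insert n I) M x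
      = M n n * (x n)\<^sup>2 + 2 * x n * (\<Sum>i\<in>I. m i * x i) + quad_form I M x" for x
    using insert.hyps sym
    by (subst sum_sum_insert) (auto simp: m_def power2_eq_square sum_distrib_left algebra_simps)
  have M'_le: "quad_form I M' x \<le> (1 - \<epsilon>) * (\<Sum>i\<in>I. (x i)\<^sup>2)" for x
  proof -
    define h where "h = (\<Sum>i\<in>I. m i * x i)"
    \<comment> \<open>elimination would use the coordinate \<open>h / (1 - M n n)\<close> at \<open>n\<close>; \<open>h\<close> suffices as \<open>0 \<le> M n n\<close>\<close>
    define y where "y = x(n := h)"
    have y: "y i = x i" if "i \<in> I" for i using that insert.hyps by (auto simp: y_def)
    have "quad_form (insert n I) M y \<le> (1 - \<epsilon>) * (\<Sum>i\<in>insert n I. (y i)\<^sup>2)"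
      by (rule insert.prems(4))
    then have "M n n * h\<^sup>2 + 2 * h * h + quad_form I M x
        \<le> (1 - \<epsilon>) * (h\<^sup>2 + (\<Sum>i\<in>I. (x i)\<^sup>2))"
      unfolding quad using insert.hyps y by (simp add: y_def h_def[symmetric])
    moreover have "0 \<le> M n n * h\<^sup>2" "0 \<le> \<epsilon> * h\<^sup>2"
      using insert.prems by auto
    ultimately show ?thesis
      unfolding M'_quad h_def[symmetric] by (simp add: algebra_simps power2_eq_square)
  qed
  have "spin_avg (insert n I) (\<lambda>\<sigma>. exp (quad_form (insert n I) M \<sigma> / 2))
    \<le> spin_avg I (\<lambda>\<sigma>. exp (M n n / 2) * exp (quad_form I M' \<sigma> / 2))"
    unfolding spin_avg_insert[OF insert.hyps]
  proof (rule spin_avg_mono)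
    fix \<sigma> :: "'i \<Rightarrow> real"
    define h where "h = (\<Sum>i\<in>I. m i * \<sigma> i)"
    define Q where "Q = quad_form I M \<sigma>"
    have up: "quad_form (insert n I) M (\<sigma>(n := s))
      = M n n * s\<^sup>2 + 2 * s * h + Q" for s
    proof -
      have "(\<Sum>i\<in>I. m i * (\<sigma>(n := s)) i) = h"
        unfolding h_def using insert.hyps by (intro sum.cong) auto
      moreover have "quad_form I M (\<sigma>(n := s)) = Q"
        unfolding Q_def using insert.hyps by (intro sum.cong) auto
      ultimately show ?thesis unfolding quad by simp
    qed
    have "(exp ((M n n + 2 * h + Q) / 2) + exp ((M n n - 2 * h + Q) / 2)) / 2
        = exp (M n n / 2) * exp (Q / 2) * cosh h"
      by (simp add: cosh_def field_simps exp_add[symmetric] exp_diff[symmetric] flip: exp_minus)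
    also have "\<dots> \<le> exp (M n n / 2) * exp (Q / 2) * exp (h\<^sup>2 / 2)"
      by (intro mult_left_mono cosh_le_exp_half_square) auto
    also have "\<dots> = exp (M n n / 2) * exp (quad_form I M' \<sigma> / 2)"
      unfolding M'_quad by (simp add: h_def Q_def add_divide_distrib exp_add)
    finally show "(exp (quad_form (insert n I) M (\<sigma>(n := 1)) / 2)
        + exp (quad_form (insert n I) M (\<sigma>(n := -1)) / 2)) / 2
      \<le> exp (M n n / 2) * exp (quad_form I M' \<sigma> / 2)"
      unfolding up by simp
  qed
  also have "\<dots> \<le> exp (M n n / 2)
      * exp ((\<Sum>i\<in>I. M' i i) / 2 + (\<Sum>i\<in>I. \<Sum>j\<in>I. (M' i j)\<^sup>2) / (4 * \<epsilon>))"
    unfolding spin_avg_mult_left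
    using insert.prems M'_le
    by (intro mult_left_mono insert.IH) (auto simp: M'_def mult.commute)
  also have "\<dots> \<le> exp ((\<Sum>i\<in>insert n I. M i i) / 2
      + (\<Sum>i\<in>insert n I. \<Sum>j\<in>insert n I. (M i j)\<^sup>2) / (4 * \<epsilon>))"
  proof -
    have tr: "(\<Sum>i\<in>I. M' i i) = (\<Sum>i\<in>I. M i i) + q"
      by (simp add: M'_def q_def sum.distrib power2_eq_square)
    define F where "F = (\<Sum>i\<in>I. \<Sum>j\<in>I. (M i j)\<^sup>2)"
    have "(\<Sum>i\<in>I. \<Sum>j\<in>I. (M' i j)\<^sup>2)
        = F + 2 * (\<Sum>i\<in>I. \<Sum>j\<in>I. M i j * m i * m j) + (\<Sum>i\<in>I. \<Sum>j\<in>I. m i * m j * m i * m j)"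
      unfolding F_def M'_def
      by (simp add: power2_eq_square algebra_simps sum.distrib sum_distrib_left)
    also have "\<dots> \<le> F + 2 * (\<Sum>i\<in>I. \<Sum>j\<in>I. M' i j * m i * m j)"
      unfolding M'_quad sq by simp
    also have "\<dots> \<le> F + 2 * ((1 - \<epsilon>) * q)"
      using M'_le[of m] by (simp add: q_def)
    finally have fr: "(\<Sum>i\<in>I. \<Sum>j\<in>I. (M' i j)\<^sup>2) \<le> F + 2 * ((1 - \<epsilon>) * q)" .
    have "(\<Sum>i\<in>insert n I. \<Sum>j\<in>insert n I. (M i j)\<^sup>2) = (M n n)\<^sup>2 + 2 * q + F"
      using insert.hyps sym by (subst sum_sum_insert) (auto simp: q_def F_def m_def)
    then have "(\<Sum>i\<in>I. \<Sum>j\<in>I. (M' i j)\<^sup>2) + 2 * \<epsilon> * q \<le> (\<Sum>i\<in>insert n I. \<Sum>j\<in>insert n I. (M i j)\<^sup>2)"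
      using add_mono[OF fr zero_le_power2[of "M n n"]] by (simp add: algebra_simps)
    then have "((\<Sum>i\<in>I. \<Sum>j\<in>I. (M' i j)\<^sup>2) + 2 * \<epsilon> * q) / (4 * \<epsilon>)
        \<le> (\<Sum>i\<in>insert n I. \<Sum>j\<in>insert n I. (M i j)\<^sup>2) / (4 * \<epsilon>)"
      using \<open>0 < \<epsilon>\<close> by (intro divide_right_mono) auto
    then have "(\<Sum>i\<in>I. \<Sum>j\<in>I. (M' i j)\<^sup>2) / (4 * \<epsilon>) + q / 2
        \<le> (\<Sum>i\<in>insert n I. \<Sum>j\<in>insert n I. (M i j)\<^sup>2) / (4 * \<epsilon>)"
      using \<open>0 < \<epsilon>\<close> by (simp add: add_divide_distrib)
    then show ?thesis
      using insert.hyps by (simp add: tr add_divide_distrib flip: exp_add)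
  qed
  finally show ?case .
qed


section \<open>The high-temperature polynomial of a graph\<close>

definition edge_moment :: "'i set \<Rightarrow> ('i \<times> 'i) set \<Rightarrow> real" where
  "edge_moment I S = spin_avg I (\<lambda>\<sigma>. \<Prod>(i, j)\<in>S. \<sigma> i * \<sigma> j)"

lemma edge_moment_empty: "finite I \<Longrightarrow> edge_moment I {} = 1"
  by (simp add: edge_moment_def)

text \<open>
  The signs are independent, and a power of a fair sign has mean 0 or 1.
\<close>

lemma spin_avg_monomial_nonneg:
  assumes "finite I"
  shows "0 \<le> spin_avg I (\<lambda>\<sigma>. \<Prod>i\<in>I. \<sigma> i ^ d i :: real)"
  using assms
proof (induction I rule: finite_induct)
  case (insert n I)
  have *: "(\<Prod>i\<in>I. (if i = n then s else \<sigma> i) ^ d i) = (\<Prod>i\<in>I. \<sigma> i ^ d i)" for s and \<sigma> :: "'a \<Rightarrow> real"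
    using insert.hyps by (intro prod.cong) auto
  have "spin_avg (insert n I) (\<lambda>\<sigma>. \<Prod>i\<in>insert n I. \<sigma> i ^ d i)
      = spin_avg I (\<lambda>\<sigma>. (1 + (-1) ^ d n) / 2 * (\<Prod>i\<in>I. \<sigma> i ^ d i) :: real)"
    using insert.hyps by (simp add: spin_avg_insert * algebra_simps)
  also have "\<dots> \<ge> 0"
    unfolding spin_avg_mult_left using insert.IH by (intro mult_nonneg_nonneg) (cases "even (d n)", auto)
  finally show ?case .
qed simp

lemma edge_moment_nonneg:
  assumes I: "finite I" and "S \<subseteq> I \<times> I"
  shows "0 \<le> edge_moment I S"
proof -
  have "finite S" using assms finite_subset by blast
  then have "\<exists>d. \<forall>\<sigma> :: 'a \<Rightarrow> real. (\<Prod>(i, j)\<in>S. \<sigma> i * \<sigma> j) = (\<Prod>i\<in>I. \<sigma> i ^ d i)"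
    using \<open>S \<subseteq> I \<times> I\<close>
  proof (induction S rule: finite_induct)
    case empty
    show ?case by (intro exI[of _ "\<lambda>_. 0"]) simp
  next
    case (insert e S)
    then obtain d where d: "\<And>\<sigma> :: 'a \<Rightarrow> real. (\<Prod>(i, j)\<in>S. \<sigma> i * \<sigma> j) = (\<Prod>i\<in>I. \<sigma> i ^ d i)"
      by auto
    obtain a b where e: "e = (a, b)" "a \<in> I" "b \<in> I" using insert.prems by auto
    have one: "(\<Prod>i\<in>I. \<sigma> i ^ of_bool (i = c)) = \<sigma> c" if "c \<in> I" for c and \<sigma> :: "'a \<Rightarrow> real"
    proof -
      have "(\<Prod>i\<in>I. \<sigma> i ^ of_bool (i = c)) = (\<Prod>i\<in>I. if i = c then \<sigma> c else 1)"
        by (intro prod.cong) auto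
      then show ?thesis using I that by simp
    qed
    show ?case
    proof (intro exI[of _ "\<lambda>i. of_bool (i = a) + of_bool (i = b) + d i"] allI)
      fix \<sigma> :: "'a \<Rightarrow> real"
      show "(\<Prod>(i, j)\<in>insert e S. \<sigma> i * \<sigma> j)
          = (\<Prod>i\<in>I. \<sigma> i ^ (of_bool (i = a) + of_bool (i = b) + d i))"
        using insert.hyps e d[of \<sigma>] by (simp add: power_add prod.distrib one)
    qed
  qed
  then obtain d where "\<And>\<sigma> :: 'a \<Rightarrow> real. (\<Prod>(i, j)\<in>S. \<sigma> i * \<sigma> j) = (\<Prod>i\<in>I. \<sigma> i ^ d i)" by auto
  then show ?thesis
    unfolding edge_moment_def using spin_avg_monomial_nonneg[OF I] by simp
qed

text \<open>
  Expanding the product shows that this is the generating function of the edge sets in \<open>F\<close> with all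
  degrees even: these are the ones with moment 1, all others have moment 0. Keeping the average as the
  definition, and using only that the moments are nonnegative, avoids talking about degrees.
\<close>

definition edge_poly :: "'i set \<Rightarrow> ('i \<times> 'i) set \<Rightarrow> 'a \<Rightarrow> 'a::real_normed_field" where
  "edge_poly I F \<tau> = spin_avg I (\<lambda>\<sigma>. \<Prod>(i, j)\<in>F. 1 + \<tau> * of_real (\<sigma> i * \<sigma> j))"

lemma edge_poly_expand:
  assumes "finite I" "F \<subseteq> I \<times> I"
  shows "edge_poly I F \<tau> = (\<Sum>S\<in>Pow F. of_real (edge_moment I S) * \<tau> ^ card S)"
proof -
  have F: "finite F" using assms finite_subset by blast
  have "(\<Prod>(i, j)\<in>F. 1 + \<tau> * of_real (\<sigma> i * \<sigma> j))
      = (\<Sum>S\<in>Pow F. of_real (\<Prod>(i, j)\<in>S. \<sigma> i * \<sigma> j) * \<tau> ^ card S)" for \<sigma> :: "'a \<Rightarrow> real"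
    using F
  proof (induction F rule: finite_induct)
    case (insert e F)
    have fin: "finite S" if "S \<in> Pow F" for S using that insert.hyps finite_subset by blast
    have "(\<Sum>S\<in>Pow (insert e F). of_real (\<Prod>(i, j)\<in>S. \<sigma> i * \<sigma> j) * \<tau> ^ card S)
      = (\<Sum>S\<in>Pow F. of_real (\<Prod>(i, j)\<in>S. \<sigma> i * \<sigma> j) * \<tau> ^ card S)
      + (\<Sum>S\<in>Pow F. of_real (\<Prod>(i, j)\<in>insert e S. \<sigma> i * \<sigma> j) * \<tau> ^ card (insert e S))"
    proof -
      have inj: "inj_on (insert e) (Pow F)"
        using insert.hyps by (auto simp: inj_on_def insert_ident subset_iff)
      show ?thesis
        unfolding Pow_insert using insert.hyps
        by (subst sum.union_disjoint) (auto simp: sum.reindex[OF inj])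
    qed
    also have "(\<Sum>S\<in>Pow F. of_real (\<Prod>(i, j)\<in>insert e S. \<sigma> i * \<sigma> j) * \<tau> ^ card (insert e S))
      = \<tau> * of_real (\<sigma> (fst e) * \<sigma> (snd e)) * (\<Sum>S\<in>Pow F. of_real (\<Prod>(i, j)\<in>S. \<sigma> i * \<sigma> j) * \<tau> ^ card S)"
      unfolding sum_distrib_left
    proof (intro sum.cong refl)
      fix S assume S: "S \<in> Pow F"
      then have "e \<notin> S" using insert.hyps by auto
      then show "of_real (\<Prod>(i, j)\<in>insert e S. \<sigma> i * \<sigma> j) * \<tau> ^ card (insert e S)
        = \<tau> * of_real (\<sigma> (fst e) * \<sigma> (snd e)) * (of_real (\<Prod>(i, j)\<in>S. \<sigma> i * \<sigma> j) * \<tau> ^ card S)"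
        using fin[OF S] by (simp add: case_prod_unfold algebra_simps)
    qed
    finally show ?case
      using insert by (simp add: case_prod_unfold algebra_simps)
  qed simp
  then have "edge_poly I F \<tau>
      = (\<Sum>\<sigma>\<in>I \<rightarrow>\<^sub>E {-1, 1}. \<Sum>S\<in>Pow F. of_real (\<Prod>(i, j)\<in>S. \<sigma> i * \<sigma> j) * \<tau> ^ card S) / 2 ^ card I"
    unfolding edge_poly_def spin_avg_def by simp
  also have "\<dots> = (\<Sum>S\<in>Pow F. of_real (edge_moment I S) * \<tau> ^ card S)"
    unfolding edge_moment_def spin_avg_def
    by (subst sum.swap) (simp add: sum_divide_distrib sum_distrib_right)
  finally show ?thesis .
qed

lemma edge_poly_of_real: "edge_poly I F (of_real x) = of_real (edge_poly I F x)"
  unfolding edge_poly_def spin_avg_of_real[symmetric] by (simp add: case_prod_unfold)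

lemma edge_poly_ge_1:
  fixes x :: real
  assumes "finite I" "F \<subseteq> I \<times> I" "0 \<le> x"
  shows "1 \<le> edge_poly I F x"
proof -
  have fin: "finite F" using assms finite_subset by blast
  have "of_real (edge_moment I {}) * x ^ card ({} :: ('a \<times> 'a) set)
      \<le> (\<Sum>S\<in>Pow F. of_real (edge_moment I S) * x ^ card S)"
    using assms fin by (intro member_le_sum) (auto intro!: mult_nonneg_nonneg edge_moment_nonneg)
  then show ?thesis
    using assms by (simp add: edge_poly_expand edge_moment_empty)
qed

text \<open>
  The number \<open>k * r ^ (k - 1)\<close> separates two difference quotients: it dominates those of \<open>x ^ k\<close> in the
  disc of radius \<open>r\<close>, and by convexity it is dominated by the one between \<open>r\<close> and \<open>r'\<close>.
\<close>

lemma norm_power_diff_le: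
  fixes x y :: "'a::real_normed_field"
  assumes x: "norm x \<le> r" and y: "norm y \<le> r" and r: "0 \<le> r" "r < r'"
  shows "norm (x ^ k - y ^ k) \<le> norm (x - y) / (r' - r) * r' ^ k"
proof -
  have "norm (x ^ k - y ^ k) \<le> norm (x - y) * (real k * r ^ (k - 1))"
  proof (cases k)
    case (Suc m)
    have "norm (\<Sum>p<Suc m. x ^ p * y ^ (m - p)) \<le> (\<Sum>p<Suc m. r ^ m)"
    proof (rule order_trans[OF norm_sum], rule sum_mono)
      fix p assume "p \<in> {..<Suc m}"
      then have "r ^ m = r ^ p * r ^ (m - p)" by (simp flip: power_add)
      then show "norm (x ^ p * y ^ (m - p)) \<le> r ^ m"
        using x y r by (auto simp: norm_mult norm_power intro!: mult_mono power_mono)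
    qed
    then show ?thesis
      unfolding Suc diff_power_eq_sum by (simp add: norm_mult mult_left_mono)
  qed simp
  also have "\<dots> \<le> norm (x - y) * (r' ^ k / (r' - r))"
  proof (rule mult_left_mono)
    have "real k * r ^ (k - 1) * (r' - r) \<le> r' ^ k - r ^ k"
    proof (cases k)
      case (Suc m)
      have "(\<Sum>p<Suc m. r ^ m) \<le> (\<Sum>p<Suc m. r' ^ p * r ^ (m - p))"
      proof (rule sum_mono)
        fix p assume "p \<in> {..<Suc m}"
        then have "r ^ m = r ^ p * r ^ (m - p)" by (simp flip: power_add)
        then show "r ^ m \<le> r' ^ p * r ^ (m - p)"
          using r by (auto intro!: mult_right_mono power_mono)
      qed
      then have "(r' - r) * (real (Suc m) * r ^ m) \<le> (r' - r) * (\<Sum>p<Suc m. r' ^ p * r ^ (m - p))"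
        using r by (intro mult_left_mono) auto
      then show ?thesis
        unfolding Suc diff_power_eq_sum by (simp add: algebra_simps)
    qed simp
    also have "\<dots> \<le> r' ^ k" using r by simp
    finally show "real k * r ^ (k - 1) \<le> r' ^ k / (r' - r)"
      using r by (simp add: pos_le_divide_eq)
  qed simp
  finally show ?thesis by simp
qed

text \<open>
  The bound for monomials extends to nonnegative combinations. It controls a complex perturbation of
  the argument by a single value of the polynomial on the real axis.
\<close>

lemma edge_poly_diff_le:
  fixes x y :: "'a::real_normed_field"
  assumes "finite I" "F \<subseteq> I \<times> I"
    and "norm x \<le> r" "norm y \<le> r" "0 \<le> r" "r < r'"
  shows "norm (edge_poly I F x - edge_poly I F y) \<le> norm (x - y) / (r' - r) * edge_poly I F r'"
proof -
  have "norm (edge_poly I F x - edge_poly I F y)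
      = norm (\<Sum>S\<in>Pow F. of_real (edge_moment I S) * (x ^ card S - y ^ card S))"
    unfolding edge_poly_expand[OF assms(1,2)] by (simp add: sum_subtractf algebra_simps)
  also have "\<dots> \<le> (\<Sum>S\<in>Pow F. edge_moment I S * (norm (x - y) / (r' - r) * r' ^ card S))"
  proof (rule order_trans[OF norm_sum], rule sum_mono)
    fix S assume "S \<in> Pow F"
    then have "0 \<le> edge_moment I S" using assms by (intro edge_moment_nonneg) auto
    then show "norm (of_real (edge_moment I S) * (x ^ card S - y ^ card S))
        \<le> edge_moment I S * (norm (x - y) / (r' - r) * r' ^ card S)"
      using mult_left_mono[OF norm_power_diff_le[OF assms(3-6)]] by (simp add: norm_mult)
  qed
  also have "\<dots> = norm (x - y) / (r' - r) * edge_poly I F r'"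
    unfolding edge_poly_expand[OF assms(1,2)] by (simp add: sum_distrib_left algebra_simps)
  finally show ?thesis .
qed


section \<open>The contribution of one edge at a complex temperature\<close>

lemma tanh_le_self:
  assumes "0 \<le> b"
  shows "tanh b \<le> (b::real)"
proof -
  have "(0::real) - tanh 0 \<le> b - tanh b"
  proof (rule DERIV_nonneg_imp_nondecreasing[OF assms])
    fix x :: real
    show "\<exists>y. ((\<lambda>x. x - tanh x) has_real_derivative y) (at x) \<and> 0 \<le> y"
      by (intro exI[of _ "(tanh x)\<^sup>2"] conjI) (auto intro!: derivative_eq_intros)
  qed
  then show ?thesis by simp
qed

lemma self_minus_tanh_le_cube:
  assumes "0 \<le> b"
  shows "b - tanh b \<le> (b::real) ^ 3"
proof -
  have "(0::real) ^ 3 - (0 - tanh 0) \<le> b ^ 3 - (b - tanh b)"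
  proof (rule DERIV_nonneg_imp_nondecreasing[OF assms])
    fix x :: real assume "0 \<le> x"
    then have "(tanh x)\<^sup>2 \<le> x\<^sup>2"
      using tanh_le_self[of x] by (intro power_mono) auto
    then have "0 \<le> 3 * x\<^sup>2 - (tanh x)\<^sup>2"
      using zero_le_power2[of x] by linarith
    then show "\<exists>y. ((\<lambda>x. x ^ 3 - (x - tanh x)) has_real_derivative y) (at x) \<and> 0 \<le> y"
      by (intro exI[of _ "3 * x\<^sup>2 - (tanh x)\<^sup>2"] conjI) (auto intro!: derivative_eq_intros)
  qed
  then show ?thesis by simp
qed

lemma one_minus_cos_le: "1 - cos x \<le> x\<^sup>2 / 2" for x :: real
proof -
  have "cos x = 1 - 2 * (sin (x / 2))\<^sup>2" using cos_double_sin[of "x / 2"] by simp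
  moreover have "(sin (x / 2))\<^sup>2 \<le> (x / 2)\<^sup>2"
    using abs_sin_x_le_abs_x[of "x / 2"] unfolding abs_le_square_iff .
  ultimately show ?thesis by (simp add: power_divide)
qed

lemma abs_sin_minus_self_le: "\<bar>sin x - x\<bar> \<le> \<bar>x\<bar> ^ 3" for x :: real
proof -
  have "\<bar>sin x - (\<Sum>m<3. sin_coeff m * x ^ m)\<bar> \<le> inverse (fact 3) * \<bar>x\<bar> ^ 3"
    by (rule Maclaurin_sin_bound)
  moreover have "(\<Sum>m<3. sin_coeff m * x ^ m) = x"
  proof -
    have "(\<Sum>m<3. sin_coeff m * x ^ m) = sin_coeff 0 + sin_coeff 1 * x + sin_coeff 2 * x\<^sup>2"
      unfolding eval_nat_numeral by simp
    moreover have "sin_coeff 0 = 0" "sin_coeff 1 = 1" "sin_coeff 2 = 0"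
      by (simp_all add: sin_coeff_def)
    ultimately show ?thesis by simp
  qed
  moreover have "inverse (fact 3) * \<bar>x\<bar> ^ 3 \<le> 1 * \<bar>x\<bar> ^ 3"
    by (intro mult_right_mono) (auto simp: fact_numeral)
  ultimately show ?thesis by simp
qed

lemma abs_cos_minus_gauss_le: "\<bar>cos x - exp (- x\<^sup>2 / 2)\<bar> \<le> x ^ 4" for x :: real
proof -
  have c1: "1 - x\<^sup>2 / 2 \<le> cos x" using one_minus_cos_le[of x] by simp
  have "cos x \<le> 1 - x\<^sup>2 / 2 + x ^ 4 / 24"
  proof -
    obtain t where t: "cos x = (\<Sum>m<4. cos_coeff m * x ^ m) + (cos (t + 1 / 2 * real 4 * pi) / fact 4) * x ^ 4"
      using Maclaurin_cos_expansion[of x 4] by blast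
    have "(\<Sum>m<4. cos_coeff m * x ^ m) = 1 - x\<^sup>2 / 2"
    proof -
      have "(\<Sum>m<4. cos_coeff m * x ^ m)
          = cos_coeff 0 + cos_coeff 1 * x + cos_coeff 2 * x\<^sup>2 + cos_coeff 3 * x ^ 3"
        by (simp add: lessThan_nat_numeral lessThan_Suc)
      moreover have "cos_coeff 0 = 1" "cos_coeff 1 = 0" "cos_coeff 2 = - 1 / 2" "cos_coeff 3 = 0"
        by (simp_all add: cos_coeff_def)
      ultimately show ?thesis by simp
    qed
    moreover have "(cos (t + 1 / 2 * real 4 * pi) / fact 4) * x ^ 4 \<le> (1 / 24) * x ^ 4"
      by (intro mult_right_mono) (auto simp: fact_numeral)
    ultimately show ?thesis using t by simp
  qed
  moreover have "1 - x\<^sup>2 / 2 \<le> exp (- x\<^sup>2 / 2)" using exp_ge_add_one_self[of "- x\<^sup>2 / 2"] by simp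
  moreover have "exp (- x\<^sup>2 / 2) \<le> 1 - x\<^sup>2 / 2 + x ^ 4 / 8"
  proof -
    define y where "y = x\<^sup>2 / 2"
    have y: "0 \<le> y" "y\<^sup>2 / 2 = x ^ 4 / 8" by (auto simp: y_def power_divide simp flip: power_mult)
    have "exp (- y) \<le> 1 - y + y\<^sup>2 / 2"
    proof -
      have "1 - 0 + 0\<^sup>2 / 2 - exp (- 0) \<le> 1 - y + y\<^sup>2 / 2 - exp (- y)"
      proof (rule DERIV_nonneg_imp_nondecreasing[OF y(1)])
        fix x :: real assume "0 \<le> x"
        show "\<exists>d. ((\<lambda>x. 1 - x + x\<^sup>2 / 2 - exp (- x)) has_real_derivative d) (at x) \<and> 0 \<le> d"
          using exp_ge_add_one_self[of "- x"]
          by (intro exI[of _ "- 1 + x + exp (- x)"] conjI) (auto intro!: derivative_eq_intros)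
      qed
      then show ?thesis by simp
    qed
    then show ?thesis using y by (simp add: y_def)
  qed
  moreover have "0 \<le> x ^ 4" by simp
  ultimately show ?thesis using c1 by linarith
qed

text \<open>
  This is \<open>cosh (b + \<i> u) / cosh b\<close>, multiplied by \<open>exp (- \<i> u b)\<close>: the characteristic function at \<open>u\<close> of
  a sign with mean \<open>tanh b\<close>, centred at \<open>b\<close>.
\<close>

definition edge_factor :: "real \<Rightarrow> real \<Rightarrow> complex" where
  "edge_factor b u =
    (of_real (cos u) + \<i> * of_real (tanh b * sin u)) * exp (- (\<i> * of_real (u * b)))"

lemma norm_edge_factor_le_1: "norm (edge_factor b u) \<le> 1"
proof -
  have "(norm (complex_of_real (cos u) + \<i> * of_real (tanh b * sin u)))\<^sup>2 = (cos u)\<^sup>2 + (tanh b)\<^sup>2 * (sin u)\<^sup>2"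
    by (simp add: cmod_power2 power_mult_distrib)
  also have "\<dots> \<le> (cos u)\<^sup>2 + 1 * (sin u)\<^sup>2"
    using tanh_real_bounds[of b] by (intro add_left_mono mult_right_mono) (auto simp: abs_square_le_1)
  finally have "norm (complex_of_real (cos u) + \<i> * of_real (tanh b * sin u)) \<le> 1"
    using power2_le_imp_le[of _ "1::real"] by simp
  moreover have "norm (exp (- (\<i> * complex_of_real (u * b)))) = 1" by simp
  ultimately show ?thesis unfolding edge_factor_def norm_mult by simp
qed

text \<open>
  The terms of degree at most two in \<open>u\<close> and \<open>b\<close> cancel. Every remaining term is a product
  \<open>u ^ m * b ^ n\<close> with \<open>m \<ge> 1\<close> and \<open>m + n \<ge> 4\<close>; the term \<open>u * b ^ 3\<close>, which comes from centring at \<open>b\<close>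
  instead of \<open>tanh b\<close>, is the largest one when \<open>u = \<kappa> * b\<close> with small \<open>\<kappa>\<close>.
\<close>

lemma norm_edge_factor_minus_gauss_le:
  assumes b: "0 \<le> b" and b1: "b \<le> 1" and \<kappa>: "\<bar>\<kappa>\<bar> \<le> 1"
  shows "norm (edge_factor b (\<kappa> * b) - exp (- (\<kappa> * b)\<^sup>2 / 2)) \<le> 8 * \<bar>\<kappa>\<bar> * b ^ 4"
proof -
  define u where "u = \<kappa> * b"
  define t where "t = tanh b"
  have au: "\<bar>u\<bar> = \<bar>\<kappa>\<bar> * b" using b by (simp add: u_def abs_mult)
  have t: "0 \<le> t" "t \<le> b" "b - t \<le> b ^ 3"
    using b tanh_le_self[OF b] self_minus_tanh_le_cube[OF b] by (auto simp: t_def)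
  have k4: "\<bar>\<kappa>\<bar> ^ n \<le> \<bar>\<kappa>\<bar>" if "n \<noteq> 0" for n
    using power_decreasing[of 1 n "\<bar>\<kappa>\<bar>"] that \<kappa> by simp
  have mono: "\<bar>u\<bar> ^ m * b ^ n \<le> \<bar>\<kappa>\<bar> * b ^ 4" if "m \<noteq> 0" "m + n \<ge> 4" for m n
  proof -
    have "\<bar>u\<bar> ^ m * b ^ n = \<bar>\<kappa>\<bar> ^ m * b ^ (m + n)" by (simp add: au power_mult_distrib power_add)
    also have "\<dots> \<le> \<bar>\<kappa>\<bar> * b ^ 4"
      using that b b1 k4 by (intro mult_mono power_decreasing) auto
    finally show ?thesis .
  qed
  have gau: "\<bar>cos u - exp (- u\<^sup>2 / 2)\<bar> \<le> \<bar>u\<bar> ^ 4 * b ^ 0"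
    using abs_cos_minus_gauss_le[of u] by simp
  have cub: "\<bar>1 - cos (u * b)\<bar> \<le> \<bar>u\<bar>\<^sup>2 * b\<^sup>2"
    using one_minus_cos_le[of "u * b"] cos_le_one[of "u * b"] zero_le_power2[of "u * b"]
    unfolding power2_abs power_mult_distrib by linarith
  have cu: "\<bar>1 - cos u\<bar> \<le> \<bar>u\<bar>\<^sup>2"
    using one_minus_cos_le[of u] cos_le_one[of u] zero_le_power2[of u]
    unfolding power2_abs by linarith
  have sub: "\<bar>sin (u * b)\<bar> \<le> \<bar>u\<bar> * b"
    using abs_sin_x_le_abs_x[of "u * b"] b by (simp add: abs_mult)
  have subd: "\<bar>sin (u * b) - u * b\<bar> \<le> \<bar>u\<bar> ^ 3 * b ^ 3"
    using abs_sin_minus_self_le[of "u * b"] b by (simp add: abs_mult power_mult_distrib)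
  have Re: "Re (edge_factor b u) = cos u * cos (u * b) + t * sin u * sin (u * b)"
    and Im: "Im (edge_factor b u) = t * sin u * cos (u * b) - cos u * sin (u * b)"
    by (simp_all add: edge_factor_def t_def Re_exp Im_exp)
  have "\<bar>Re (edge_factor b u) - exp (- u\<^sup>2 / 2)\<bar>
      \<le> \<bar>cos u - exp (- u\<^sup>2 / 2)\<bar> + \<bar>cos u\<bar> * \<bar>1 - cos (u * b)\<bar> + t * \<bar>sin u\<bar> * \<bar>sin (u * b)\<bar>"
  proof -
    have "Re (edge_factor b u) - exp (- u\<^sup>2 / 2)
        = (cos u - exp (- u\<^sup>2 / 2)) - cos u * (1 - cos (u * b)) + t * sin u * sin (u * b)"
      unfolding Re by (simp add: algebra_simps)
    moreover have "\<bar>A - B + C\<bar> \<le> \<bar>A\<bar> + \<bar>B\<bar> + \<bar>C\<bar>" for A B C :: real by linarith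
    ultimately show ?thesis using t(1) by (metis abs_mult abs_of_nonneg)
  qed
  also have "\<dots> \<le> \<bar>u\<bar> ^ 4 * b ^ 0 + 1 * (\<bar>u\<bar>\<^sup>2 * b\<^sup>2) + b * \<bar>u\<bar> * (\<bar>u\<bar> * b)"
    by (intro add_mono mult_mono mult_nonneg_nonneg zero_le_power order_refl abs_ge_zero
        zero_le_one abs_cos_le_one b t gau cub sub abs_sin_x_le_abs_x)
  also have "\<dots> = \<bar>u\<bar> ^ 4 * b ^ 0 + 2 * (\<bar>u\<bar> ^ 2 * b ^ 2)"
    by (simp add: power2_eq_square)
  also have "\<dots> \<le> 3 * (\<bar>\<kappa>\<bar> * b ^ 4)"
    using mono[of 4 0] mono[of 2 2] by simp
  finally have R: "\<bar>Re (edge_factor b u) - exp (- u\<^sup>2 / 2)\<bar> \<le> 3 * (\<bar>\<kappa>\<bar> * b ^ 4)" .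
  have "\<bar>Im (edge_factor b u)\<bar>
      \<le> t * \<bar>sin u\<bar> * \<bar>1 - cos (u * b)\<bar> + t * \<bar>sin u - u\<bar> + (b - t) * \<bar>u\<bar> + \<bar>sin (u * b) - u * b\<bar>
        + \<bar>1 - cos u\<bar> * \<bar>sin (u * b)\<bar>"
  proof -
    have "Im (edge_factor b u)
        = - (t * sin u * (1 - cos (u * b))) + t * (sin u - u) - (b - t) * u - (sin (u * b) - u * b)
          + (1 - cos u) * sin (u * b)"
      unfolding Im by (simp add: algebra_simps)
    moreover have "\<bar>- A + B - C - D + E\<bar> \<le> \<bar>A\<bar> + \<bar>B\<bar> + \<bar>C\<bar> + \<bar>D\<bar> + \<bar>E\<bar>" for A B C D E :: real
      by linarith
    moreover have "\<bar>t * x\<bar> = t * \<bar>x\<bar>" "\<bar>t * x * y\<bar> = t * \<bar>x\<bar> * \<bar>y\<bar>" "\<bar>(b - t) * x\<bar> = (b - t) * \<bar>x\<bar>" for x y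
      using t by (simp_all add: abs_mult)
    ultimately show ?thesis by (metis abs_mult)
  qed
  also have "\<dots> \<le> b * \<bar>u\<bar> * (\<bar>u\<bar>\<^sup>2 * b\<^sup>2) + b * \<bar>u\<bar> ^ 3 + b ^ 3 * \<bar>u\<bar> + \<bar>u\<bar> ^ 3 * b ^ 3 + \<bar>u\<bar>\<^sup>2 * (\<bar>u\<bar> * b)"
    by (intro add_mono mult_mono mult_nonneg_nonneg zero_le_power order_refl abs_ge_zero
        b t cub cu sub subd abs_sin_x_le_abs_x abs_sin_minus_self_le)
  also have "\<dots> = 2 * (\<bar>u\<bar> ^ 3 * b ^ 3) + 2 * (\<bar>u\<bar> ^ 3 * b ^ 1) + \<bar>u\<bar> ^ 1 * b ^ 3"
    by (simp add: power2_eq_square power3_eq_cube)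
  also have "\<dots> \<le> 5 * (\<bar>\<kappa>\<bar> * b ^ 4)"
    using mono[of 3 3] mono[of 3 1] mono[of 1 3] by simp
  finally have I: "\<bar>Im (edge_factor b u)\<bar> \<le> 5 * (\<bar>\<kappa>\<bar> * b ^ 4)" .
  have "norm (edge_factor b u - exp (- u\<^sup>2 / 2))
      \<le> \<bar>Re (edge_factor b u - exp (- u\<^sup>2 / 2))\<bar> + \<bar>Im (edge_factor b u - exp (- u\<^sup>2 / 2))\<bar>"
    by (rule cmod_le)
  also have "\<dots> = \<bar>Re (edge_factor b u) - exp (- u\<^sup>2 / 2)\<bar> + \<bar>Im (edge_factor b u)\<bar>"
    by simp
  finally show ?thesis using R I by (simp add: u_def)
qed

lemma cosh_Complex: "cosh (of_real b + \<i> * of_real u)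
  = of_real (cosh b) * (complex_of_real (cos u) + \<i> * of_real (tanh b * sin u))"
proof -
  have "cosh b \<noteq> 0" by simp
  then have t: "sinh b = cosh b * tanh b" by (simp add: tanh_def)
  moreover have "cosh (of_real b + \<i> * of_real u) = complex_of_real (cosh b * cos u) + \<i> * of_real (sinh b * sin u)"
    by (simp add: complex_eq_iff cosh_def sinh_def Re_exp Im_exp field_simps)
  ultimately show ?thesis
    unfolding t by (simp only: of_real_mult ring_distribs ac_simps)
qed

text \<open>
  The difference is \<open>sinh (\<i> u)\<close> divided by the product of the two values of \<open>cosh\<close>. The restriction on
  \<open>u\<close> keeps \<open>cosh\<close> away from its zeros on the imaginary axis.
\<close>

lemma norm_tanh_diff_le:
  assumes "\<bar>u\<bar> \<le> 1"
  shows "cosh (of_real b + \<i> * of_real u) \<noteq> 0"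
    and "norm (tanh (of_real b + \<i> * of_real u) - of_real (tanh b)) \<le> 2 * \<bar>u\<bar>"
proof -
  have cu: "1 / 2 \<le> cos u"
    using one_minus_cos_le[of u] assms abs_square_le_1[of u] by simp
  have "cos u \<le> norm (complex_of_real (cos u) + \<i> * of_real (tanh b * sin u))"
    using complex_Re_le_cmod[of "complex_of_real (cos u) + \<i> * of_real (tanh b * sin u)"] by simp
  moreover have "1 \<le> cosh b" by (rule cosh_real_ge_1)
  ultimately have "1 * (1 / 2) \<le> cosh b * norm (complex_of_real (cos u) + \<i> * of_real (tanh b * sin u))"
    using cu by (intro mult_mono) auto
  then have nc: "1 / 2 \<le> norm (cosh (complex_of_real b + \<i> * of_real u))"
    unfolding cosh_Complex norm_mult by simp
  then show nz: "cosh (complex_of_real b + \<i> * of_real u) \<noteq> 0" by auto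
  have cb: "cosh b \<noteq> 0" by simp
  have "tanh (complex_of_real b + \<i> * of_real u) - of_real (tanh b)
      = sinh (\<i> * of_real u) / (cosh (complex_of_real b + \<i> * of_real u) * of_real (cosh b))"
  proof -
    have "sinh ((complex_of_real b + \<i> * of_real u) - of_real b)
      = sinh (complex_of_real b + \<i> * of_real u) * cosh (of_real b)
        - cosh (complex_of_real b + \<i> * of_real u) * sinh (of_real b)"
      by (rule sinh_diff)
    moreover have "cosh (complex_of_real b) = of_real (cosh b)" "sinh (complex_of_real b) = of_real (sinh b)"
      by (simp_all add: complex_eq_iff cosh_def sinh_def Re_exp Im_exp)
    ultimately show ?thesis
      using nz cb by (simp add: tanh_def field_simps)
  qed
  moreover have "norm (sinh (\<i> * complex_of_real u)) \<le> \<bar>u\<bar>"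
  proof -
    have "sinh (\<i> * complex_of_real u) = \<i> * of_real (sin u)"
      by (simp add: complex_eq_iff sinh_def Re_exp Im_exp)
    then show ?thesis using abs_sin_x_le_abs_x[of u] by (simp add: norm_mult)
  qed
  moreover have "1 / 2 * 1 \<le> norm (cosh (complex_of_real b + \<i> * of_real u)) * cosh b"
    using nc cosh_real_ge_1[of b] by (intro mult_mono) auto
  ultimately have "norm (tanh (complex_of_real b + \<i> * of_real u) - of_real (tanh b)) \<le> \<bar>u\<bar> / (1 / 2)"
    by (simp only: norm_divide norm_mult norm_of_real abs_of_nonneg cosh_real_nonneg, intro frac_le) auto
  then show "norm (tanh (of_real b + \<i> * of_real u) - of_real (tanh b)) \<le> 2 * \<bar>u\<bar>" by simp
qed


section \<open>Oscillation of a Riemann integrable function on a grid\<close>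

definition grid_point :: "nat \<Rightarrow> nat \<Rightarrow> real" where
  "grid_point N i = real i / real N"

abbreviation grid_interval :: "nat \<Rightarrow> nat \<Rightarrow> real set" where
  "grid_interval N i \<equiv> {grid_point N (i - 1)..grid_point N i}"

lemma grid_point_pred: "1 \<le> i \<Longrightarrow> grid_point N (i - 1) = grid_point N i - 1 / real N"
  by (simp add: grid_point_def of_nat_diff diff_divide_distrib)

lemma grid_point_le_iff: "N \<ge> 1 \<Longrightarrow> grid_point N i \<le> grid_point N j \<longleftrightarrow> i \<le> j"
  by (simp add: grid_point_def divide_le_cancel)

lemma grid_point_in_unit: "i \<le> N \<Longrightarrow> grid_point N i \<in> {0..1}"
  by (cases "N = 0") (auto simp: grid_point_def)

lemma grid_interval_subset: "i \<le> N \<Longrightarrow> grid_interval N i \<subseteq> {0..1}"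
  using grid_point_in_unit[of i N] grid_point_in_unit[of "i - 1" N] by auto

lemma grid_intervals_cover:
  assumes "N \<ge> 1" "0 < x" "x \<le> 1"
  shows "\<exists>i\<in>{1..N}. grid_point N (i - 1) < x \<and> x \<le> grid_point N i"
proof -
  define i where "i = nat \<lceil>real N * x\<rceil>"
  have pos: "0 < real N * x" using assms by simp
  have c: "of_int \<lceil>real N * x\<rceil> - 1 < real N * x" "real N * x \<le> of_int \<lceil>real N * x\<rceil>"
    by linarith+
  have i: "real i = of_int \<lceil>real N * x\<rceil>" using pos unfolding i_def by simp
  have "1 \<le> i" using pos unfolding i_def by linarith
  moreover have "i \<le> N"
  proof -
    have "real N * x \<le> real N * 1" using assms by (intro mult_left_mono) auto
    then have "\<lceil>real N * x\<rceil> \<le> int N" by linarith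
    then show ?thesis unfolding i_def by linarith
  qed
  moreover have "grid_point N (i - 1) < x" "x \<le> grid_point N i"
    using c assms \<open>1 \<le> i\<close> i by (auto simp: grid_point_def of_nat_diff field_simps)
  ultimately show ?thesis by auto
qed

abbreviation grid_square :: "nat \<Rightarrow> nat \<Rightarrow> nat \<Rightarrow> (real \<times> real) set" where
  "grid_square N i j \<equiv> grid_interval N i \<times> grid_interval N j"

definition grid_tags :: "nat \<Rightarrow> (nat \<Rightarrow> nat \<Rightarrow> real \<times> real) \<Rightarrow> ((real \<times> real) \<times> (real \<times> real) set) set" where
  "grid_tags N t = (\<lambda>(i, j). (t i j, grid_square N i j)) ` ({1..N} \<times> {1..N})"

lemma grid_tagsE:
  assumes "(x, K) \<in> grid_tags N t"
  obtains i j where "i \<in> {1..N}" "j \<in> {1..N}" "x = t i j" "K = grid_square N i j"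
proof -
  obtain p where "p \<in> {1..N} \<times> {1..N}" "(x, K) = (\<lambda>(i, j). (t i j, grid_square N i j)) p"
    using assms unfolding grid_tags_def by (rule imageE)
  then show thesis by (intro that[of "fst p" "snd p"]) (simp_all add: mem_Times_iff case_prod_unfold)
qed

lemma grid_square_cbox:
  "grid_square N i j
    = cbox (grid_point N (i - 1), grid_point N (j - 1)) (grid_point N i, grid_point N j)"
  unfolding cbox_Pair_eq by (simp only: cbox_interval)

lemma grid_square_subset:
  "i \<in> {1..N} \<Longrightarrow> j \<in> {1..N} \<Longrightarrow> grid_square N i j \<subseteq> {0..1} \<times> {0..1}"
  by (intro Sigma_mono grid_interval_subset) auto

lemma interiors_of_grid_intervals_disjoint:
  assumes "N \<ge> 1" "i \<noteq> i'" "1 \<le> i" "1 \<le> i'"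
  shows "interior (grid_interval N i) \<inter> interior (grid_interval N i') = {}"
proof -
  have "i \<le> i' - 1 \<or> i' \<le> i - 1" using assms by auto
  then have "grid_point N i \<le> grid_point N (i' - 1) \<or> grid_point N i' \<le> grid_point N (i - 1)"
    using assms(1) by (simp add: grid_point_le_iff)
  then show ?thesis unfolding interior_atLeastAtMost_real by auto
qed

lemma grid_tags_tagged_division:
  assumes N: "N \<ge> 1"
    and t: "\<And>i j. i \<in> {1..N} \<Longrightarrow> j \<in> {1..N} \<Longrightarrow> t i j \<in> grid_square N i j"
  shows "grid_tags N t tagged_division_of ({0..1} \<times> {0..1})"
proof (rule tagged_division_ofI)
  show "finite (grid_tags N t)" by (simp add: grid_tags_def)
next
  fix x K assume "(x, K) \<in> grid_tags N t"
  then obtain i j where ij: "i \<in> {1..N}" "j \<in> {1..N}" "x = t i j" "K = grid_square N i j"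
    by (rule grid_tagsE)
  show "x \<in> K" unfolding ij(3,4) by (rule t[OF ij(1,2)])
  show "K \<subseteq> {0..1} \<times> {0..1}" unfolding ij(4) by (rule grid_square_subset[OF ij(1,2)])
  show "\<exists>a b. K = cbox a b" unfolding ij(4) grid_square_cbox by blast
next
  fix x1 K1 x2 K2
  assume 1: "(x1, K1) \<in> grid_tags N t" and 2: "(x2, K2) \<in> grid_tags N t" and ne: "(x1, K1) \<noteq> (x2, K2)"
  obtain i j where ij: "i \<in> {1..N}" "j \<in> {1..N}" "x1 = t i j" "K1 = grid_square N i j"
    using 1 by (rule grid_tagsE)
  obtain i' j' where ij': "i' \<in> {1..N}" "j' \<in> {1..N}" "x2 = t i' j'" "K2 = grid_interval N i' \<times> grid_interval N j'"
    using 2 by (rule grid_tagsE)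
  have "i \<noteq> i' \<or> j \<noteq> j'" using ne ij(3,4) ij'(3,4) by blast
  then have "interior (grid_interval N i) \<inter> interior (grid_interval N i') = {}
      \<or> interior (grid_interval N j) \<inter> interior (grid_interval N j') = {}"
    using interiors_of_grid_intervals_disjoint[OF N] ij(1,2) ij'(1,2) unfolding atLeastAtMost_iff by blast
  then show "interior K1 \<inter> interior K2 = {}"
    unfolding ij(4) ij'(4) interior_Times Times_Int_Times by blast
next
  have cov: "\<exists>i\<in>{1..N}. x \<in> grid_interval N i" if "x \<in> {0..1}" for x
  proof (cases "x = 0")
    case True
    then show ?thesis using N by (intro bexI[of _ 1]) (auto simp: grid_point_def)
  next
    case False
    then show ?thesis using grid_intervals_cover[of N x] N that by force
  qed
  show "\<Union>{K. \<exists>x. (x, K) \<in> grid_tags N t} = {0..1} \<times> {0..1}"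
  proof (intro equalityI subsetI)
    fix z assume "z \<in> \<Union>{K. \<exists>x. (x, K) \<in> grid_tags N t}"
    then obtain x K where "(x, K) \<in> grid_tags N t" "z \<in> K" by blast
    then show "z \<in> {0..1} \<times> {0..1}" using grid_square_subset by (elim grid_tagsE) blast
  next
    fix z :: "real \<times> real" assume z: "z \<in> {0..1} \<times> {0..1}"
    obtain i where i: "i \<in> {1..N}" "fst z \<in> grid_interval N i" using cov[of "fst z"] z by (auto simp: mem_Times_iff)
    obtain j where j: "j \<in> {1..N}" "snd z \<in> grid_interval N j" using cov[of "snd z"] z by (auto simp: mem_Times_iff)
    have "z \<in> grid_square N i j" using i j unfolding mem_Times_iff by blast
    moreover have "(t i j, grid_square N i j) \<in> grid_tags N t"
      unfolding grid_tags_def using i(1) j(1) by (intro image_eqI[of _ _ "(i, j)"]) simp_all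
    ultimately show "z \<in> \<Union>{K. \<exists>x. (x, K) \<in> grid_tags N t}" by blast
  qed
qed

lemma grid_tags_fine:
  assumes t: "\<And>i j. i \<in> {1..N} \<Longrightarrow> j \<in> {1..N} \<Longrightarrow> t i j \<in> grid_square N i j"
    and d: "2 / real N < d"
  shows "(\<lambda>x. ball x d) fine grid_tags N t"
proof (rule fineI, rule subsetI)
  fix x K z assume "(x, K) \<in> grid_tags N t" and "z \<in> K"
  then obtain i j where ij: "i \<in> {1..N}" "j \<in> {1..N}" "x = t i j"
    and z: "z \<in> grid_square N i j"
    by (elim grid_tagsE) blast
  have x: "x \<in> grid_square N i j" unfolding ij(3) by (rule t[OF ij(1,2)])
  have pred: "grid_point N (i - 1) = grid_point N i - 1 / real N" "grid_point N (j - 1) = grid_point N j - 1 / real N"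
    using ij(1,2) grid_point_pred[of i N] grid_point_pred[of j N] by auto
  have "\<bar>fst x - fst z\<bar> \<le> 1 / real N" "\<bar>snd x - snd z\<bar> \<le> 1 / real N"
    using x z unfolding mem_Times_iff atLeastAtMost_iff pred by linarith+
  moreover have "dist x z \<le> \<bar>fst x - fst z\<bar> + \<bar>snd x - snd z\<bar>"
    unfolding dist_prod_def dist_real_def
    using sqrt_sum_squares_le_sum_abs[of "fst x - fst z" "snd x - snd z"] by simp
  ultimately show "z \<in> ball x d" using d by simp
qed

lemma sum_grid_tags:
  assumes N: "N \<ge> 1"
    and t: "\<And>i j. i \<in> {1..N} \<Longrightarrow> j \<in> {1..N} \<Longrightarrow> t i j \<in> grid_square N i j"
  shows "(\<Sum>(x, K)\<in>grid_tags N t. measure lborel K * f x) = (\<Sum>i=1..N. \<Sum>j=1..N. f (t i j)) / (real N)\<^sup>2"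
proof -
  have le: "grid_point N (i - 1) \<le> grid_point N i" for i using N by (simp add: grid_point_le_iff)
  have inj: "inj_on (\<lambda>(i, j). (t i j, grid_square N i j)) ({1..N} \<times> {1..N})"
  proof (rule inj_onI)
    fix p q assume eq: "(\<lambda>(i, j). (t i j, grid_square N i j)) p
        = (\<lambda>(i, j). (t i j, grid_square N i j)) q"
    obtain i j i' j' where pq: "p = (i, j)" "q = (i', j')" by (cases p, cases q)
    have "grid_square N i j = grid_interval N i' \<times> grid_interval N j'"
      using eq unfolding pq split prod.inject by (rule conjunct2)
    moreover have "grid_interval N i \<noteq> {}" for i unfolding atLeastatMost_empty_iff using le[of i] by simp
    ultimately have "grid_interval N i = grid_interval N i'" "grid_interval N j = grid_interval N j'"
      unfolding times_eq_iff by blast+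
    then have "grid_point N i = grid_point N i'" "grid_point N j = grid_point N j'"
      using le unfolding Icc_eq_Icc by blast+
    then show "p = q" unfolding pq using N by (simp add: grid_point_def)
  qed
  have meas: "measure lborel (grid_square N i j) = 1 / (real N)\<^sup>2"
    if "i \<in> {1..N}" "j \<in> {1..N}" for i j
  proof -
    have "measure lborel (grid_square N i j)
        = (grid_point N i - grid_point N (i - 1)) * (grid_point N j - grid_point N (j - 1))"
      unfolding grid_square_cbox content_Pair using le by simp
    also have "\<dots> = 1 / (real N)\<^sup>2"
      using that grid_point_pred[of i N] grid_point_pred[of j N] by (simp add: power2_eq_square)
    finally show ?thesis .
  qed
  have "(\<Sum>(x, K)\<in>grid_tags N t. measure lborel K * f x)
      = (\<Sum>p\<in>{1..N} \<times> {1..N}. measure lborel (grid_interval N (fst p) \<times> grid_interval N (snd p)) * f (t (fst p) (snd p)))"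
    unfolding grid_tags_def sum.reindex[OF inj] by (intro sum.cong) (simp_all only: o_def case_prod_unfold prod.sel)
  also have "\<dots> = (\<Sum>p\<in>{1..N} \<times> {1..N}. f (t (fst p) (snd p)) / (real N)\<^sup>2)"
    by (intro sum.cong refl) (simp only: meas mem_Times_iff, simp)
  also have "\<dots> = (\<Sum>i=1..N. \<Sum>j=1..N. f (t i j)) / (real N)\<^sup>2"
    by (simp add: sum.cartesian_product sum_divide_distrib case_prod_unfold)
  finally show ?thesis .
qed

definition grid_osc :: "(real \<times> real \<Rightarrow> real) \<Rightarrow> nat \<Rightarrow> nat \<Rightarrow> nat \<Rightarrow> real" where
  "grid_osc f N i j = (SUP z\<in>grid_square N i j. \<bar>f z - f (grid_point N i, grid_point N j)\<bar>)"

definition mean_osc :: "(real \<times> real \<Rightarrow> real) \<Rightarrow> nat \<Rightarrow> real" where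
  "mean_osc f N = (\<Sum>i=1..N. \<Sum>j=1..N. grid_osc f N i j) / (real N)\<^sup>2"

context
  fixes f :: "real \<times> real \<Rightarrow> real"
  assumes f01: "\<And>z. z \<in> {0..1} \<times> {0..1} \<Longrightarrow> f z \<in> {0..1}"
begin

lemma grid_osc_bounds:
  assumes "N \<ge> 1" "i \<in> {1..N}" "j \<in> {1..N}"
  shows "z \<in> grid_square N i j \<Longrightarrow>
      \<bar>f z - f (grid_point N i, grid_point N j)\<bar> \<le> grid_osc f N i j"
    and "0 \<le> grid_osc f N i j" and "grid_osc f N i j \<le> 1"
    and "0 < e \<Longrightarrow> \<exists>z\<in>grid_square N i j.
      grid_osc f N i j - e < \<bar>f z - f (grid_point N i, grid_point N j)\<bar>"
proof -
  define K where "K = grid_square N i j"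
  have c: "(grid_point N i, grid_point N j) \<in> K"
    using assms by (auto simp: K_def grid_point_le_iff)
  have sub: "K \<subseteq> {0..1} \<times> {0..1}"
    using assms grid_interval_subset[of i N] grid_interval_subset[of j N] by (auto simp: K_def)
  have le1: "\<bar>f z - f (grid_point N i, grid_point N j)\<bar> \<le> 1" if "z \<in> K" for z
  proof -
    have "f z \<in> {0..1}" "f (grid_point N i, grid_point N j) \<in> {0..1}"
      using f01 sub that c by blast+
    then show ?thesis by auto
  qed
  then have bdd: "bdd_above ((\<lambda>z. \<bar>f z - f (grid_point N i, grid_point N j)\<bar>) ` K)"
    by (intro bdd_aboveI2) auto
  show up: "\<bar>f z - f (grid_point N i, grid_point N j)\<bar> \<le> grid_osc f N i j"
    if "z \<in> grid_square N i j" for z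
    unfolding grid_osc_def using that bdd K_def by (intro cSUP_upper) auto
  show "0 \<le> grid_osc f N i j" using up[of "(grid_point N i, grid_point N j)"] c K_def by auto
  show "grid_osc f N i j \<le> 1"
    unfolding grid_osc_def using c le1 K_def by (intro cSUP_least) auto
  show "\<exists>z\<in>grid_square N i j.
      grid_osc f N i j - e < \<bar>f z - f (grid_point N i, grid_point N j)\<bar>" if "0 < e"
  proof -
    have "grid_osc f N i j - e < (SUP z\<in>K. \<bar>f z - f (grid_point N i, grid_point N j)\<bar>)"
      using that by (simp add: grid_osc_def K_def)
    then show ?thesis using less_cSUP_iff[OF _ bdd] c K_def by blast
  qed
qed

lemma mean_osc_nonneg: "0 \<le> mean_osc f N"
  unfolding mean_osc_def using grid_osc_bounds(2) by (cases "N = 0") (auto intro!: divide_nonneg_nonneg sum_nonneg)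

text \<open>
  Two Riemann sums over the same grid are compared. In each cell one of them uses a point where \<open>f\<close>
  differs from its value at the corner by almost the oscillation, the other one uses the corner, and
  the roles are chosen such that the difference is nonnegative. So the mean oscillation is at most the
  difference of two Riemann sums, up to an arbitrarily small error.
\<close>

lemma mean_osc_tendsto_0:
  assumes "f riemann_integrable_on ({0..1} \<times> {0..1})"
  shows "mean_osc f \<longlonglongrightarrow> 0"
proof (rule LIMSEQ_I)
  fix e :: real assume e: "0 < e"
  obtain I where I: "\<And>e. e > 0 \<Longrightarrow> \<exists>d>0. \<forall>p. p tagged_division_of ({0..1} \<times> {0..1}) \<and> (\<lambda>x. ball x d) fine p \<longrightarrow>
        \<bar>(\<Sum>(x, K)\<in>p. measure lborel K * f x) - I\<bar> < e"
    using assms unfolding riemann_integrable_on_def by blast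
  obtain d where d: "d > 0" and sums: "\<And>p. p tagged_division_of ({0..1} \<times> {0..1}) \<Longrightarrow> (\<lambda>x. ball x d) fine p \<Longrightarrow>
        \<bar>(\<Sum>(x, K)\<in>p. measure lborel K * f x) - I\<bar> < e / 4"
    using I[of "e / 4"] e by auto
  obtain N0 where N0: "2 / d < real N0" using reals_Archimedean2 by blast
  have "norm (mean_osc f N - 0) < e" if "N \<ge> N0" for N
  proof -
    have Npos: "0 < real N" using N0 that d by (smt (verit) divide_pos_pos of_nat_mono)
    then have N: "N \<ge> 1" by simp
    have small: "2 / real N < d"
    proof -
      have "2 / d < real N" using N0 that by (meson less_le_trans of_nat_mono)
      then show ?thesis using Npos d by (simp add: field_simps)
    qed
    define c where "c = (\<lambda>i j. (grid_point N i, grid_point N j))"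
    have "\<exists>z\<in>grid_square N i j. grid_osc f N i j - e / 4 < \<bar>f z - f (c i j)\<bar>"
      if "i \<in> {1..N}" "j \<in> {1..N}" for i j
      using grid_osc_bounds(4)[OF N that] e by (simp add: c_def)
    then obtain z where z: "\<And>i j. i \<in> {1..N} \<Longrightarrow> j \<in> {1..N} \<Longrightarrow> z i j \<in> grid_square N i j"
      "\<And>i j. i \<in> {1..N} \<Longrightarrow> j \<in> {1..N} \<Longrightarrow> grid_osc f N i j - e / 4 < \<bar>f (z i j) - f (c i j)\<bar>"
      by metis
    have c: "c i j \<in> grid_square N i j" for i j
      using N by (auto simp: c_def grid_point_le_iff)
    define hi lo where "hi = (\<lambda>i j. if f (c i j) \<le> f (z i j) then z i j else c i j)"
      and "lo = (\<lambda>i j. if f (c i j) \<le> f (z i j) then c i j else z i j)"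
    have hilo: "f (hi i j) - f (lo i j) = \<bar>f (z i j) - f (c i j)\<bar>" for i j
      by (auto simp: hi_def lo_def)
    have R: "\<bar>(\<Sum>i=1..N. \<Sum>j=1..N. f (t i j)) / (real N)\<^sup>2 - I\<bar> < e / 4"
      if t: "\<And>i j. i \<in> {1..N} \<Longrightarrow> j \<in> {1..N} \<Longrightarrow> t i j \<in> grid_square N i j" for t
    proof -
      have "\<bar>(\<Sum>(x, K)\<in>grid_tags N t. measure lborel K * f x) - I\<bar> < e / 4"
        using N small t by (intro sums grid_tags_tagged_division grid_tags_fine)
      then show ?thesis using N t by (subst (asm) sum_grid_tags)
    qed
    have hi: "\<bar>(\<Sum>i=1..N. \<Sum>j=1..N. f (hi i j)) / (real N)\<^sup>2 - I\<bar> < e / 4"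
      using z(1) c by (intro R) (auto simp: hi_def simp del: atLeastAtMost_iff)
    have lo: "\<bar>(\<Sum>i=1..N. \<Sum>j=1..N. f (lo i j)) / (real N)\<^sup>2 - I\<bar> < e / 4"
      using z(1) c by (intro R) (auto simp: lo_def simp del: atLeastAtMost_iff)
    have "mean_osc f N \<le> (\<Sum>i=1..N. \<Sum>j=1..N. (f (hi i j) - f (lo i j)) + e / 4) / (real N)\<^sup>2"
      unfolding mean_osc_def hilo using z(2)
      by (intro divide_right_mono sum_mono) (auto simp: less_imp_le algebra_simps simp del: atLeastAtMost_iff)
    also have "\<dots> = (\<Sum>i=1..N. \<Sum>j=1..N. f (hi i j)) / (real N)\<^sup>2
        - (\<Sum>i=1..N. \<Sum>j=1..N. f (lo i j)) / (real N)\<^sup>2 + e / 4"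
      using Npos by (simp add: sum.distrib sum_subtractf add_divide_distrib diff_divide_distrib power2_eq_square)
    also have "\<dots> < e" using hi lo e by linarith
    finally show ?thesis using mean_osc_nonneg by simp
  qed
  then show "\<exists>no. \<forall>n\<ge>no. norm (mean_osc f n - 0) < e" by blast
qed

end


section \<open>The quadratic form of a graphon\<close>

abbreviation unit_square :: "(real \<times> real) set" where
  "unit_square \<equiv> {0..1} \<times> {0..1}"

lemma unit_square_borel [measurable]: "unit_square \<in> sets borel"
  by (intro borel_closed closed_Times) auto

lemma emeasure_unit_square: "emeasure lborel unit_square = 1"
proof -
  have "unit_square = cbox (0, 0) (1, 1)" unfolding cbox_Pair_eq by (simp only: cbox_interval)
  moreover have "emeasure lborel (cbox (0, 0) (1 :: real, 1 :: real)) = 1"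
    by (subst emeasure_lborel_cbox_eq) (auto simp: Basis_prod_def)
  ultimately show ?thesis by simp
qed

text \<open>
  A graphon is only Lebesgue measurable, and its sections need not be measurable. Fubini's theorem is
  applied to a Borel function that agrees with it almost everywhere.
\<close>

lemma graphon_borel_version:
  assumes "graphon W"
  obtains g where "g \<in> borel_measurable borel" "\<And>z. 0 \<le> g z" "\<And>z. g z \<le> 1" "\<And>z. z \<notin> unit_square \<Longrightarrow> g z = 0"
    "AE z in lborel. z \<in> unit_square \<longrightarrow> W (fst z) (snd z) = g z"
proof -
  define W' where "W' z = indicator unit_square z * W (fst z) (snd z)" for z
  have "(\<lambda>z. W (fst z) (snd z)) \<in> borel_measurable (lebesgue_on unit_square)"
    using assms by (simp add: graphon_def case_prod_unfold)
  then have "W' \<in> borel_measurable lebesgue"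
    unfolding W'_def by (subst (asm) borel_measurable_restrict_space_iff) auto
  then obtain h where h: "h \<in> borel_measurable lborel" "AE z in lborel. W' z = h z"
    using completion_ex_borel_measurable_real by blast
  define g where "g z = indicator unit_square z * max 0 (min 1 (h z))" for z
  have [measurable]: "h \<in> borel_measurable borel" using h(1) by simp
  have W01: "W' z = W (fst z) (snd z) \<and> 0 \<le> W' z \<and> W' z \<le> 1" if "z \<in> unit_square" for z
    using assms that by (auto simp: graphon_def W'_def)
  show ?thesis
  proof (rule that)
    show "g \<in> borel_measurable borel" unfolding g_def by measurable
    show "0 \<le> g z" "g z \<le> 1" "z \<notin> unit_square \<Longrightarrow> g z = 0" for z
      by (auto simp: g_def indicator_def)
    show "AE z in lborel. z \<in> unit_square \<longrightarrow> W (fst z) (snd z) = g z"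
      using h(2)
    proof eventually_elim
      fix z assume "W' z = h z"
      then show "z \<in> unit_square \<longrightarrow> W (fst z) (snd z) = g z"
        using W01[of z] by (auto simp: g_def)
    qed
  qed
qed

text \<open>
  Transfers integrals over the completed measure, in which the graphon operator is written, to
  \<open>lborel\<close>, which is a product measure in the plane.
\<close>

lemma lebesgue_on_borel_eq_AE:
  fixes f g :: "'a::euclidean_space \<Rightarrow> real"
  assumes g: "g \<in> borel_measurable borel" and S: "S \<in> sets borel"
    and ae: "AE x in lborel. x \<in> S \<longrightarrow> f x = g x"
  shows "f \<in> borel_measurable (lebesgue_on S)"
    and "(\<integral>x. f x \<partial>lebesgue_on S) = (\<integral>x. indicator S x * g x \<partial>lborel)"
proof -
  have [measurable]: "S \<in> sets lebesgue" using S by (simp add: sets_completionI_sets)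
  have ig: "(\<lambda>x. indicator S x * g x) \<in> borel_measurable lborel" using g S by measurable
  have ae': "AE x in lebesgue. indicator S x * g x = indicator S x *\<^sub>R f x"
    by (rule AE_completion) (use ae in eventually_elim, auto simp: indicator_def)
  have m: "(\<lambda>x. indicator S x *\<^sub>R f x) \<in> borel_measurable lebesgue"
    by (rule borel_measurable_AE[OF measurable_completion[OF ig] ae'])
  then show "f \<in> borel_measurable (lebesgue_on S)"
    by (subst borel_measurable_restrict_space_iff) auto
  have "(\<integral>x. f x \<partial>lebesgue_on S) = (\<integral>x. indicator S x *\<^sub>R f x \<partial>lebesgue)"
    by (rule integral_restrict_space) auto
  also have "\<dots> = (\<integral>x. indicator S x * g x \<partial>lebesgue)"
    using ae' m measurable_completion[OF ig] by (intro integral_cong_AE) auto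
  also have "\<dots> = (\<integral>x. indicator S x * g x \<partial>lborel)"
    by (rule integral_completion[OF ig])
  finally show "(\<integral>x. f x \<partial>lebesgue_on S) = (\<integral>x. indicator S x * g x \<partial>lborel)" .
qed

lemma integrable_bounded_on_unit_square:
  fixes f :: "real \<times> real \<Rightarrow> real"
  assumes "f \<in> borel_measurable borel" "\<And>z. \<bar>f z\<bar> \<le> B" "\<And>z. z \<notin> unit_square \<Longrightarrow> f z = 0"
  shows "integrable lborel f"
  using assms emeasure_unit_square
  by (intro integrableI_bounded_set[where A = unit_square and B = B]) auto

lemma integrable_bounded_on_unit_interval:
  fixes f :: "real \<Rightarrow> real"
  assumes "f \<in> borel_measurable borel" "\<And>x. \<bar>f x\<bar> \<le> B" "\<And>x. x \<notin> {0..1} \<Longrightarrow> f x = 0"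
  shows "integrable lborel f"
  using assms
  by (intro integrableI_bounded_set[where A = "{0..1}" and B = B]) auto

text \<open>
  The form is the inner product of \<open>f\<close> and the image of \<open>f\<close> under the operator, so this is the
  Cauchy--Schwarz inequality. The work lies in the fact that this image is measurable and has the
  expected inner product although \<open>W\<close> is only Lebesgue measurable.
\<close>

lemma graphon_quadratic_form_le:
  assumes W: "graphon W" and pos: "0 < graphon_op_norm W"
    and [measurable]: "f \<in> borel_measurable borel" and fB: "\<And>x. \<bar>f x\<bar> \<le> B"
  shows "(\<integral>z. W (fst z) (snd z) * f (fst z) * f (snd z) \<partial>lebesgue_on unit_square)
    \<le> graphon_op_norm W * (\<integral>x. (f x)\<^sup>2 \<partial>lebesgue_on {0..1})"
proof -
  let ?U = "lebesgue_on {0..1::real}" and ?T = "graphon_operator W f"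
  define \<rho> where "\<rho> = graphon_op_norm W"
  have B0: "0 \<le> B" using fB[of 0] by linarith
  obtain g where g[measurable]: "g \<in> borel_measurable borel" and g01: "\<And>z. 0 \<le> g z" "\<And>z. g z \<le> 1"
    and g0: "\<And>z. z \<notin> unit_square \<Longrightarrow> g z = 0"
    and gW: "AE z in lborel. z \<in> unit_square \<longrightarrow> W (fst z) (snd z) = g z"
    using graphon_borel_version[OF W] by blast
  have [measurable]: "g \<in> borel_measurable (lborel \<Otimes>\<^sub>M lborel)" by (simp add: lborel_prod)
  have g0': "y \<notin> {0..1} \<Longrightarrow> g (x, y) = 0" "x \<notin> {0..1} \<Longrightarrow> g (x, y) = 0" for x y
    by (rule g0, blast)+
  have gabs: "\<bar>g z\<bar> \<le> 1" for z using g01[of z] by simp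
  have gff [measurable]: "(\<lambda>z. g z * f (fst z) * f (snd z)) \<in> borel_measurable borel"
  proof -
    have [measurable]: "fst \<in> borel_measurable (borel :: (real \<times> real) measure)"
        "snd \<in> borel_measurable (borel :: (real \<times> real) measure)"
      by (auto intro!: borel_measurable_continuous_onI continuous_intros)
    show ?thesis by measurable
  qed
  define h where "h x = (\<integral>y. g (x, y) * f y \<partial>lborel)" for x
  have h[measurable]: "h \<in> borel_measurable borel"
  proof -
    have "(\<lambda>x. \<integral>y. g (x, y) * f y \<partial>lborel) \<in> borel_measurable lborel" by measurable
    then show ?thesis by (simp add: h_def[abs_def])
  qed
  have hB: "\<bar>h x\<bar> \<le> B" for x
  proof -
    have "norm (h x) \<le> (\<integral>y. norm (g (x, y) * f y) \<partial>lborel)"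
      unfolding h_def by (rule integral_norm_bound)
    also have "\<dots> \<le> (\<integral>y. indicator {0..1::real} y * B \<partial>lborel)"
    proof (rule Bochner_Integration.integral_mono')
      show "integrable lborel (\<lambda>y. indicator {0..1::real} y * B :: real)" by simp
      fix y :: real
      show "norm (g (x, y) * f y) \<le> indicator {0..1} y * B"
        using mult_mono[OF gabs[of "(x, y)"] fB[of y]] g0'(1)[of y x]
        by (cases "y \<in> {0..1}") (simp_all add: abs_mult)
      show "0 \<le> indicator {0..1} y * B" using B0 by simp
    qed
    finally show ?thesis by simp
  qed
  have T_AE: "AE x in lborel. x \<in> {0..1} \<longrightarrow> ?T x = h x"
  proof -
    have "AE z in lborel \<Otimes>\<^sub>M lborel. z \<in> unit_square \<longrightarrow> W (fst z) (snd z) = g z"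
      unfolding lborel_prod by (rule gW)
    then have "AE x in lborel. AE y in lborel. (x, y) \<in> unit_square \<longrightarrow> W x y = g (x, y)"
      by (drule_tac lborel_pair.AE_pair) simp
    then show ?thesis
    proof eventually_elim
      case (elim x)
      show ?case
      proof
        assume x: "x \<in> {0..1}"
        have "?T x = (\<integral>y. indicator {0..1} y * (g (x, y) * f y) \<partial>lborel)"
          unfolding graphon_operator_def
          by (rule lebesgue_on_borel_eq_AE(2)) (use elim x in auto)
        also have "\<dots> = h x"
          unfolding h_def
        proof (intro Bochner_Integration.integral_cong refl)
          fix y show "indicator {0..1} y * (g (x, y) * f y) = g (x, y) * f y"
            using g0'(1)[of y x] by (cases "y \<in> {0..1}") simp_all
        qed
        finally show "?T x = h x" .
      qed
    qed
  qed
  have sq_borel: "(\<lambda>x. (f x)\<^sup>2) \<in> borel_measurable borel" "(\<lambda>x. (h x)\<^sup>2) \<in> borel_measurable borel" by measurable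
  have f2: "(\<integral>x. (f x)\<^sup>2 \<partial>?U) = (\<integral>x. indicator {0..1} x * (f x)\<^sup>2 \<partial>lborel)"
    by (rule lebesgue_on_borel_eq_AE(2)) auto
  have T2: "(\<integral>x. (?T x)\<^sup>2 \<partial>?U) = (\<integral>x. indicator {0..1} x * (h x)\<^sup>2 \<partial>lborel)"
    by (rule lebesgue_on_borel_eq_AE(2)) (use T_AE in auto)
  have if2: "integrable lborel (\<lambda>x. indicator {0..1} x * (f x)\<^sup>2)"
    by (rule integrable_bounded_on_unit_interval[where B = "B\<^sup>2"])
      (use fB power_mono[OF fB abs_ge_zero, of _ 2] in \<open>auto simp: indicator_def\<close>)
  have ih2: "integrable lborel (\<lambda>x. indicator {0..1} x * (h x)\<^sup>2)"
    by (rule integrable_bounded_on_unit_interval[where B = "B\<^sup>2"])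
      (use hB power_mono[OF hB abs_ge_zero, of _ 2] in \<open>auto simp: indicator_def\<close>)
  have form: "(\<integral>z. W (fst z) (snd z) * f (fst z) * f (snd z) \<partial>lebesgue_on unit_square)
      = (\<integral>x. indicator {0..1} x * (f x * h x) \<partial>lborel)"
  proof -
    have "(\<integral>z. W (fst z) (snd z) * f (fst z) * f (snd z) \<partial>lebesgue_on unit_square)
        = (\<integral>z. indicator unit_square z * (g z * f (fst z) * f (snd z)) \<partial>lborel)"
      by (rule lebesgue_on_borel_eq_AE(2)[OF gff]) (use gW in auto)
    also have "\<dots> = (\<integral>z. g z * f (fst z) * f (snd z) \<partial>(lborel \<Otimes>\<^sub>M lborel))"
      unfolding lborel_prod
    proof (intro Bochner_Integration.integral_cong refl)
      fix z show "indicator unit_square z * (g z * f (fst z) * f (snd z)) = g z * f (fst z) * f (snd z)"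
        using g0[of z] by (cases "z \<in> unit_square") simp_all
    qed
    also have "\<dots> = (\<integral>x. \<integral>y. g (x, y) * f x * f y \<partial>lborel \<partial>lborel)"
    proof (subst lborel_pair.integral_fst'[symmetric])
      have "\<bar>g z * f (fst z) * f (snd z)\<bar> \<le> 1 * B * B" for z
        unfolding abs_mult using gabs[of z] fB B0 by (intro mult_mono) auto
      then show "integrable (lborel \<Otimes>\<^sub>M lborel) (\<lambda>z. g z * f (fst z) * f (snd z))"
        unfolding lborel_prod
        by (intro integrable_bounded_on_unit_square[where B = "1 * B * B"]) (auto simp: g0)
    qed simp
    also have "\<dots> = (\<integral>x. f x * h x \<partial>lborel)"
    proof (intro Bochner_Integration.integral_cong refl)
      fix x :: real
      have "(\<integral>y. g (x, y) * f x * f y \<partial>lborel) = (\<integral>y. f x * (g (x, y) * f y) \<partial>lborel)"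
        by (simp only: ac_simps)
      then show "(\<integral>y. g (x, y) * f x * f y \<partial>lborel) = f x * h x"
        unfolding h_def by (simp only: integral_mult_right_zero)
    qed
    also have "\<dots> = (\<integral>x. indicator {0..1} x * (f x * h x) \<partial>lborel)"
    proof (intro Bochner_Integration.integral_cong refl)
      fix x :: real
      have "h x = 0" if "x \<notin> {0..1}" unfolding h_def using g0'(2)[OF that] by simp
      then show "f x * h x = indicator {0..1} x * (f x * h x)" by (auto simp: indicator_def)
    qed
    finally show ?thesis .
  qed
  define s where "s = (\<integral>x. (f x)\<^sup>2 \<partial>?U)"
  define T where "T = (\<integral>x. (?T x)\<^sup>2 \<partial>?U)"
  have s0: "0 \<le> s" and T0: "0 \<le> T" unfolding s_def T_def by auto
  have scale: "c\<^sup>2 * T \<le> \<rho>\<^sup>2" if c: "c\<^sup>2 * s \<le> 1" for c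
  proof -
    have mem: "(\<lambda>x. c * f x) \<in> {f \<in> square_integrable01. L2_norm01 f \<le> 1}"
    proof -
      have "(\<lambda>x. c * f x) \<in> borel_measurable ?U"
        by (rule lebesgue_on_borel_eq_AE(1)[where g = "\<lambda>x. c * f x"]) auto
      moreover have "integrable ?U (\<lambda>x. (c * f x)\<^sup>2)"
      proof -
        have "integrable lebesgue (\<lambda>x. indicator {0..1} x *\<^sub>R (c * f x)\<^sup>2)"
        proof (subst integrable_completion)
          have "integrable lborel (\<lambda>x. c\<^sup>2 * (indicator {0..1} x * (f x)\<^sup>2))"
            using if2 by (intro integrable_mult_right) simp
          also have "(\<lambda>x. c\<^sup>2 * (indicator {0..1} x * (f x)\<^sup>2)) = (\<lambda>x. indicator {0..1} x *\<^sub>R (c * f x)\<^sup>2)"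
            by (simp add: fun_eq_iff power_mult_distrib)
          finally show "integrable lborel (\<lambda>x. indicator {0..1} x *\<^sub>R (c * f x)\<^sup>2)" .
        qed auto
        then show ?thesis by (subst integrable_restrict_space) auto
      qed
      moreover have "(\<integral>x. (c * f x)\<^sup>2 \<partial>?U) = c\<^sup>2 * s"
        by (simp add: power_mult_distrib s_def)
      ultimately show ?thesis using c by (simp add: square_integrable01_def L2_norm01_def)
    qed
    have "L2_norm01 (graphon_operator W (\<lambda>x. c * f x)) \<le> \<rho>"
      unfolding \<rho>_def graphon_op_norm_def by (rule cSUP_upper[OF mem bdd_above_graphon_op_norm[OF W]])
    moreover have "graphon_operator W (\<lambda>x. c * f x) = (\<lambda>x. c * ?T x)"
    proof
      fix x
      have "(\<integral>y. W x y * (c * f y) \<partial>?U) = (\<integral>y. c * (W x y * f y) \<partial>?U)"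
        by (simp only: ac_simps)
      then show "graphon_operator W (\<lambda>x. c * f x) x = c * ?T x"
        unfolding graphon_operator_def by (simp only: integral_mult_right_zero)
    qed
    ultimately have "sqrt (c\<^sup>2 * T) \<le> \<rho>"
      by (simp add: L2_norm01_def power_mult_distrib T_def)
    then show ?thesis using real_le_rsqrt sqrt_le_D by blast
  qed
  have Ts: "T \<le> \<rho>\<^sup>2 * s"
  proof (cases "s = 0")
    case False
    then have "(1 / sqrt s)\<^sup>2 * T \<le> \<rho>\<^sup>2" using s0 by (intro scale) (simp add: power_divide)
    then show ?thesis using s0 False by (simp add: power_divide divide_le_eq)
  next
    case True
    show ?thesis
    proof (rule ccontr)
      \<comment> \<open>arbitrarily large multiples of \<open>f\<close> are admissible in the supremum\<close>
      assume "\<not> T \<le> \<rho>\<^sup>2 * s"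
      then have Tp: "0 < T" using True by simp
      have "(sqrt ((\<rho>\<^sup>2 + 1) / T))\<^sup>2 * T \<le> \<rho>\<^sup>2" using True by (intro scale) simp
      then show False using Tp by simp
    qed
  qed
  have \<rho>0: "0 < \<rho>" using pos by (simp add: \<rho>_def)
  \<comment> \<open>Young's inequality with weight \<open>\<rho>\<close> in place of Cauchy--Schwarz\<close>
  have "(\<integral>x. indicator {0..1} x * (f x * h x) \<partial>lborel)
      \<le> (\<integral>x. \<rho> / 2 * (indicator {0..1} x * (f x)\<^sup>2) + 1 / (2 * \<rho>) * (indicator {0..1} x * (h x)\<^sup>2) \<partial>lborel)"
  proof (rule Bochner_Integration.integral_mono)
    show "integrable lborel (\<lambda>x. indicator {0..1} x * (f x * h x))"
    proof (rule integrable_bounded_on_unit_interval[where B = "B * B"])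
      fix x show "\<bar>indicator {0..1} x * (f x * h x)\<bar> \<le> B * B"
        using mult_mono[OF fB[of x] hB[of x]] B0 by (auto simp: indicator_def abs_mult)
    qed auto
    show "integrable lborel (\<lambda>x. \<rho> / 2 * (indicator {0..1} x * (f x)\<^sup>2) + 1 / (2 * \<rho>) * (indicator {0..1} x * (h x)\<^sup>2))"
      using if2 ih2 by (intro Bochner_Integration.integrable_add integrable_mult_right) auto
    fix x :: real
    have "f x * h x \<le> \<rho> / 2 * (f x)\<^sup>2 + 1 / (2 * \<rho>) * (h x)\<^sup>2"
    proof -
      have "0 \<le> (\<rho> * f x - h x)\<^sup>2 / (2 * \<rho>)" using \<rho>0 by simp
      also have "\<dots> = \<rho> / 2 * (f x)\<^sup>2 + 1 / (2 * \<rho>) * (h x)\<^sup>2 - f x * h x"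
        using \<rho>0 by (simp add: power2_eq_square field_simps)
      finally show ?thesis by simp
    qed
    then show "indicator {0..1} x * (f x * h x)
        \<le> \<rho> / 2 * (indicator {0..1} x * (f x)\<^sup>2) + 1 / (2 * \<rho>) * (indicator {0..1} x * (h x)\<^sup>2)"
      by (auto simp: indicator_def)
  qed
  also have "\<dots> = \<rho> / 2 * s + 1 / (2 * \<rho>) * T"
    unfolding s_def T_def f2 T2 using if2 ih2
    by (subst Bochner_Integration.integral_add) (auto intro!: integrable_mult_right)
  also have "\<dots> \<le> \<rho> / 2 * s + 1 / (2 * \<rho>) * (\<rho>\<^sup>2 * s)"
    using Ts \<rho>0 by (intro add_left_mono mult_left_mono) auto
  also have "\<dots> = \<rho> * s" using \<rho>0 by (simp add: power2_eq_square field_simps)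
  finally show ?thesis unfolding form by (simp add: \<rho>_def s_def)
qed


section \<open>Sampling a graphon on a grid\<close>

text \<open>
  The cells are half open, so that they are disjoint and cover the unit interval up to the point 0.
\<close>

abbreviation grid_cell :: "nat \<Rightarrow> nat \<Rightarrow> real set" where
  "grid_cell N i \<equiv> {grid_point N (i - 1)<..grid_point N i}"

definition step_fun :: "nat \<Rightarrow> (nat \<Rightarrow> real) \<Rightarrow> real \<Rightarrow> real" where
  "step_fun N c x = (\<Sum>i=1..N. c i * indicator (grid_cell N i) x)"

lemma grid_cells_disjoint:
  assumes "N \<ge> 1" "x \<in> grid_cell N i" "x \<in> grid_cell N j" "1 \<le> i" "1 \<le> j"
  shows "i = j"
proof (rule ccontr)
  assume "i \<noteq> j"
  then have "i \<le> j - 1 \<or> j \<le> i - 1" using assms(4,5) by auto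
  then have "grid_point N i \<le> grid_point N (j - 1) \<or> grid_point N j \<le> grid_point N (i - 1)"
    using assms(1) by (simp add: grid_point_le_iff)
  then show False using assms(2,3) by auto
qed

lemma step_fun_eq:
  assumes "N \<ge> 1" "i \<in> {1..N}" "x \<in> grid_cell N i"
  shows "step_fun N c x = c i"
proof -
  have "step_fun N c x = (\<Sum>k=1..N. if k = i then c i else 0)"
    unfolding step_fun_def
  proof (intro sum.cong refl)
    fix k assume "k \<in> {1..N}"
    then show "c k * indicator (grid_cell N k) x = (if k = i then c i else 0)"
    proof (cases "k = i")
      case False
      then have "x \<notin> grid_cell N k"
        using grid_cells_disjoint[OF assms(1) _ assms(3), of k] assms(2) \<open>k \<in> {1..N}\<close>
        unfolding atLeastAtMost_iff by blast
      then show ?thesis using False unfolding indicator_def by simp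
    qed (use assms(3) in simp)
  qed
  then show ?thesis using assms(2) by simp
qed

lemma step_fun_eq_0: "(\<And>i. i \<in> {1..N} \<Longrightarrow> x \<notin> grid_cell N i) \<Longrightarrow> step_fun N c x = 0"
  unfolding step_fun_def by (intro sum.neutral) (simp add: indicator_def)

lemma step_fun_const:
  assumes "N \<ge> 1" "0 < x" "x \<le> 1"
  shows "step_fun N (\<lambda>_. a) x = a"
proof -
  obtain i where "i \<in> {1..N}" "x \<in> grid_cell N i" using grid_intervals_cover[OF assms] by auto
  then show ?thesis by (rule step_fun_eq[OF assms(1)])
qed

lemma step_fun_square: "N \<ge> 1 \<Longrightarrow> (step_fun N c x)\<^sup>2 = step_fun N (\<lambda>i. (c i)\<^sup>2) x"
proof (cases "\<exists>i\<in>{1..N}. x \<in> grid_cell N i")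
  case True
  assume N: "N \<ge> 1"
  obtain i where i: "i \<in> {1..N}" "x \<in> grid_cell N i" using True by blast
  show ?thesis unfolding step_fun_eq[OF N i] ..
next
  case False
  then have "step_fun N d x = 0" for d by (intro step_fun_eq_0) blast
  then show ?thesis by simp
qed

lemma step_fun_measurable [measurable]: "step_fun N c \<in> borel_measurable borel"
  unfolding step_fun_def[abs_def] by measurable

lemma step_fun_bounded: "\<bar>step_fun N c x\<bar> \<le> (\<Sum>i=1..N. \<bar>c i\<bar>)"
  unfolding step_fun_def
  by (rule order_trans[OF sum_abs], rule sum_mono) (simp add: abs_mult indicator_def)

lemma emeasure_grid_cell:
  assumes "N \<ge> 1" "i \<in> {1..N}"
  shows "emeasure lborel (grid_cell N i) = ennreal (1 / real N)"
  using assms grid_point_pred[of i N] by (subst emeasure_lborel_Ioc) auto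

lemma grid_cell_subset: "i \<in> {1..N} \<Longrightarrow> grid_cell N i \<subseteq> {0..1}"
  by (rule order_trans[OF _ grid_interval_subset[of i N]]) auto

lemma integral_step_fun:
  assumes "N \<ge> 1"
  shows "(\<integral>x. step_fun N c x \<partial>lebesgue_on {0..1}) = (\<Sum>i=1..N. c i) / real N"
proof -
  have "(\<integral>x. step_fun N c x \<partial>lebesgue_on {0..1}) = (\<integral>x. indicator {0..1} x * step_fun N c x \<partial>lborel)"
    by (rule lebesgue_on_borel_eq_AE(2)) auto
  also have "\<dots> = (\<integral>x. (\<Sum>i=1..N. c i * indicator (grid_cell N i) x) \<partial>lborel)"
  proof (intro Bochner_Integration.integral_cong refl)
    fix x :: real
    have "indicator {0..1} x * (c i * indicator (grid_cell N i) x) = c i * indicator (grid_cell N i) x"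
      if "i \<in> {1..N}" for i
      using grid_cell_subset[OF that] by (cases "x \<in> grid_cell N i") auto
    then show "indicator {0..1} x * step_fun N c x = (\<Sum>i=1..N. c i * indicator (grid_cell N i) x)"
      unfolding step_fun_def sum_distrib_left by (intro sum.cong refl)
  qed
  also have "\<dots> = (\<Sum>i=1..N. c i * measure lborel (grid_cell N i))"
  proof (subst Bochner_Integration.integral_sum)
    fix i assume "i \<in> {1..N}"
    from emeasure_grid_cell[OF assms this]
    show "integrable lborel (\<lambda>x. c i * indicator (grid_cell N i) x)"
      by (intro integrable_mult_right integrable_real_indicator) simp_all
  qed simp
  also have "\<dots> = (\<Sum>i=1..N. c i) / real N"
    using emeasure_grid_cell[OF assms] by (simp add: sum_divide_distrib measure_def)
  finally show ?thesis .
qed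

lemma measure_grid_square:
  assumes "N \<ge> 1" "i \<in> {1..N}" "j \<in> {1..N}"
  shows "emeasure lborel (grid_cell N i \<times> grid_cell N j) = 1 / (real N)\<^sup>2"
proof -
  have "emeasure lborel (grid_cell N i \<times> grid_cell N j)
      = emeasure lborel (grid_cell N i) * emeasure lborel (grid_cell N j)"
    unfolding lborel_prod[symmetric] by (rule lborel.emeasure_pair_measure_Times) auto
  also have "\<dots> = ennreal (1 / real N * (1 / real N))"
    unfolding emeasure_grid_cell[OF assms(1,2)] emeasure_grid_cell[OF assms(1,3)] by (rule ennreal_mult[symmetric]) auto
  finally show ?thesis by (simp add: power2_eq_square)
qed

text \<open>
  On each cell the graphon differs from its value at the corner by at most the oscillation.
\<close>

lemma graphon_grid_approx:
  assumes W: "graphon W" and N: "N \<ge> 1"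
  defines "F \<equiv> (\<lambda>z. W (fst z) (snd z))"
  shows "\<bar>(\<Sum>i=1..N. \<Sum>j=1..N. F (grid_point N i, grid_point N j) * c i * c j) / (real N)\<^sup>2
      - (\<integral>z. F z * step_fun N c (fst z) * step_fun N c (snd z) \<partial>lebesgue_on unit_square)\<bar>
    \<le> (\<Sum>i=1..N. \<Sum>j=1..N. grid_osc F N i j * \<bar>c i\<bar> * \<bar>c j\<bar>) / (real N)\<^sup>2"
proof -
  let ?L = "lebesgue_on unit_square"
  define C where "C i j = grid_cell N i \<times> grid_cell N j" for i j
  define P where "P i j = (grid_point N i, grid_point N j)" for i j
  have F01: "F z \<in> {0..1}" if "z \<in> unit_square" for z
    using W that unfolding graphon_def F_def by auto
  have Fm: "F \<in> borel_measurable ?L" using W by (simp add: graphon_def F_def case_prod_unfold)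
  have Cb: "C i j \<in> sets borel" for i j unfolding C_def by (auto simp: borel_prod[symmetric])
  have Csub: "C i j \<subseteq> unit_square" if "i \<in> {1..N}" "j \<in> {1..N}" for i j
    unfolding C_def by (intro Sigma_mono grid_cell_subset that)
  have Cm: "C i j \<in> sets ?L" if "i \<in> {1..N}" "j \<in> {1..N}" for i j
    using Csub[OF that] Cb by (auto simp: sets_restrict_space_iff)
  have meas: "emeasure ?L (C i j) = ennreal (1 / (real N)\<^sup>2)" if "i \<in> {1..N}" "j \<in> {1..N}" for i j
    using Csub[OF that] Cb measure_grid_square[OF N that]
    by (simp add: emeasure_restrict_space C_def)
  have ind: "integrable ?L (\<lambda>z. indicator (C i j) z :: real)" if "i \<in> {1..N}" "j \<in> {1..N}" for i j
    using Cm[OF that] meas[OF that] by (intro integrable_real_indicator) auto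
  have Find: "integrable ?L (\<lambda>z. F z * indicator (C i j) z)" if "i \<in> {1..N}" "j \<in> {1..N}" for i j
  proof (rule Bochner_Integration.integrable_bound[OF ind[OF that]])
    show "(\<lambda>z. F z * indicator (C i j) z) \<in> borel_measurable ?L" using Fm Cm[OF that] by measurable
    show "AE z in ?L. norm (F z * indicator (C i j) z) \<le> norm (indicator (C i j) z :: real)"
      using F01 by (intro AE_I2) (auto simp: indicator_def)
  qed
  have int_ind: "(\<integral>z. indicator (C i j) z \<partial>?L) = 1 / (real N)\<^sup>2" if "i \<in> {1..N}" "j \<in> {1..N}" for i j
    using Cm[OF that] meas[OF that] sets.sets_into_space[OF Cm[OF that]] by (simp add: measure_def Int_absorb1 Int_absorb2)
  have cell: "\<bar>F (P i j) / (real N)\<^sup>2 - (\<integral>z. F z * indicator (C i j) z \<partial>?L)\<bar> \<le> grid_osc F N i j / (real N)\<^sup>2"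
    if ij: "i \<in> {1..N}" "j \<in> {1..N}" for i j
  proof -
    have "(\<integral>z. F z * indicator (C i j) z \<partial>?L) - F (P i j) / (real N)\<^sup>2
        = (\<integral>z. F z * indicator (C i j) z - F (P i j) * indicator (C i j) z \<partial>?L)"
      using Find[OF ij] ind[OF ij] int_ind[OF ij]
      by (subst Bochner_Integration.integral_diff) (auto intro!: integrable_mult_right)
    moreover have "norm (\<integral>z. F z * indicator (C i j) z - F (P i j) * indicator (C i j) z \<partial>?L)
        \<le> (\<integral>z. grid_osc F N i j * indicator (C i j) z \<partial>?L)"
    proof (rule order_trans[OF integral_norm_bound], rule Bochner_Integration.integral_mono')
      show "integrable ?L (\<lambda>z. grid_osc F N i j * indicator (C i j) z)"
        using ind[OF ij] by (intro integrable_mult_right)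
      fix z
      show "norm (F z * indicator (C i j) z - F (P i j) * indicator (C i j) z) \<le> grid_osc F N i j * indicator (C i j) z"
      proof (cases "z \<in> C i j")
        case True
        then have "z \<in> grid_square N i j" unfolding C_def by auto
        then show ?thesis using True grid_osc_bounds(1)[of F N i j z, OF F01 N ij] by (simp add: P_def)
      qed simp
      show "0 \<le> grid_osc F N i j * indicator (C i j) z"
        using grid_osc_bounds(2)[of F N i j, OF F01 N ij] by simp
    qed
    ultimately show ?thesis using int_ind[OF ij] by (simp add: abs_minus_commute)
  qed
  have "(\<integral>z. F z * step_fun N c (fst z) * step_fun N c (snd z) \<partial>?L)
      = (\<integral>z. (\<Sum>i=1..N. \<Sum>j=1..N. c i * c j * (F z * indicator (C i j) z)) \<partial>?L)"
  proof (intro Bochner_Integration.integral_cong refl)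
    fix z :: "real \<times> real"
    have "F z * step_fun N c (fst z) * step_fun N c (snd z)
      = F z * (\<Sum>i=1..N. \<Sum>j=1..N. (c i * indicator (grid_cell N i) (fst z)) * (c j * indicator (grid_cell N j) (snd z)))"
      unfolding step_fun_def sum_product[symmetric] by (simp only: mult.assoc)
    also have "\<dots> = (\<Sum>i=1..N. \<Sum>j=1..N. c i * c j * (F z * indicator (C i j) z))"
      unfolding sum_distrib_left C_def
      by (intro sum.cong refl) (simp add: indicator_times)
    finally show "F z * step_fun N c (fst z) * step_fun N c (snd z)
      = (\<Sum>i=1..N. \<Sum>j=1..N. c i * c j * (F z * indicator (C i j) z))" .
  qed
  also have "\<dots> = (\<Sum>i=1..N. \<Sum>j=1..N. c i * c j * (\<integral>z. F z * indicator (C i j) z \<partial>?L))"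
  proof -
    have int: "integrable ?L (\<lambda>z. c i * c j * (F z * indicator (C i j) z))"
      if "i \<in> {1..N}" "j \<in> {1..N}" for i j
      by (intro integrable_mult_right Find that)
    have "(\<integral>z. (\<Sum>i=1..N. \<Sum>j=1..N. c i * c j * (F z * indicator (C i j) z)) \<partial>?L)
        = (\<Sum>i=1..N. \<integral>z. (\<Sum>j=1..N. c i * c j * (F z * indicator (C i j) z)) \<partial>?L)"
      by (intro Bochner_Integration.integral_sum Bochner_Integration.integrable_sum int)
    also have "\<dots> = (\<Sum>i=1..N. \<Sum>j=1..N. \<integral>z. c i * c j * (F z * indicator (C i j) z) \<partial>?L)"
      by (intro sum.cong refl Bochner_Integration.integral_sum int)
    finally show ?thesis by (simp only: integral_mult_right_zero)
  qed
  finally have int: "(\<integral>z. F z * step_fun N c (fst z) * step_fun N c (snd z) \<partial>?L)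
      = (\<Sum>i=1..N. \<Sum>j=1..N. c i * c j * (\<integral>z. F z * indicator (C i j) z \<partial>?L))" .
  have "(\<Sum>i=1..N. \<Sum>j=1..N. F (P i j) * c i * c j) / (real N)\<^sup>2
        - (\<integral>z. F z * step_fun N c (fst z) * step_fun N c (snd z) \<partial>?L)
      = (\<Sum>i=1..N. \<Sum>j=1..N. c i * c j * (F (P i j) / (real N)\<^sup>2 - (\<integral>z. F z * indicator (C i j) z \<partial>?L)))"
    unfolding int by (simp add: sum_subtractf right_diff_distrib sum_divide_distrib ac_simps)
  also have "\<bar>\<dots>\<bar> \<le> (\<Sum>i=1..N. \<Sum>j=1..N. grid_osc F N i j * \<bar>c i\<bar> * \<bar>c j\<bar> / (real N)\<^sup>2)"
  proof (rule order_trans[OF sum_abs], rule sum_mono, rule order_trans[OF sum_abs], rule sum_mono)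
    fix i j assume ij: "i \<in> {1..N}" "j \<in> {1..N}"
    have "\<bar>c i * c j\<bar> * \<bar>F (P i j) / (real N)\<^sup>2 - (\<integral>z. F z * indicator (C i j) z \<partial>?L)\<bar>
        \<le> \<bar>c i * c j\<bar> * (grid_osc F N i j / (real N)\<^sup>2)"
      by (intro mult_left_mono cell ij) simp
    then show "\<bar>c i * c j * (F (P i j) / (real N)\<^sup>2 - (\<integral>z. F z * indicator (C i j) z \<partial>?L))\<bar>
        \<le> grid_osc F N i j * \<bar>c i\<bar> * \<bar>c j\<bar> / (real N)\<^sup>2"
      by (simp add: abs_mult ac_simps)
  qed
  finally show ?thesis by (simp add: P_def sum_divide_distrib)
qed

definition graphon_osc :: "(real \<Rightarrow> real \<Rightarrow> real) \<Rightarrow> nat \<Rightarrow> real" where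
  "graphon_osc W N = mean_osc (\<lambda>z. W (fst z) (snd z)) N"

definition graphon_mass :: "(real \<Rightarrow> real \<Rightarrow> real) \<Rightarrow> real" where
  "graphon_mass W = (\<integral>(x, y). W x y \<partial>lebesgue_on unit_square)"

lemma graphon_osc_tendsto_0:
  assumes "graphon W" "(\<lambda>(x, y). W x y) riemann_integrable_on unit_square"
  shows "graphon_osc W \<longlonglongrightarrow> 0"
  unfolding graphon_osc_def[abs_def]
  using assms by (intro mean_osc_tendsto_0) (auto simp: graphon_def case_prod_unfold)

lemma graphon_mean_grid_approx:
  assumes W: "graphon W" and N: "N \<ge> 1"
  shows "\<bar>(\<Sum>i=1..N. \<Sum>j=1..N. W (real i / real N) (real j / real N)) / (real N)\<^sup>2 - graphon_mass W\<bar> \<le> graphon_osc W N"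
proof -
  have [measurable]: "unit_square \<in> sets lebesgue" by (simp add: sets_completionI_sets)
  have Fm: "(\<lambda>z. W (fst z) (snd z)) \<in> borel_measurable (lebesgue_on unit_square)"
    using W by (simp add: graphon_def case_prod_unfold)
  have sf: "(\<lambda>z. step_fun N (\<lambda>_. 1) (fst z)) \<in> borel_measurable (lebesgue_on unit_square)"
    "(\<lambda>z. step_fun N (\<lambda>_. 1) (snd z)) \<in> borel_measurable (lebesgue_on unit_square)"
  proof -
    have m: "fst \<in> borel_measurable (borel :: (real \<times> real) measure)"
        "snd \<in> borel_measurable (borel :: (real \<times> real) measure)"
      by (auto intro!: borel_measurable_continuous_onI continuous_intros)
    have "(\<lambda>z. step_fun N (\<lambda>_. 1) (fst z)) \<in> borel_measurable (borel :: (real \<times> real) measure)"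
      "(\<lambda>z. step_fun N (\<lambda>_. 1) (snd z)) \<in> borel_measurable (borel :: (real \<times> real) measure)"
      using m by measurable
    then show "(\<lambda>z. step_fun N (\<lambda>_. 1) (fst z)) \<in> borel_measurable (lebesgue_on unit_square)"
      "(\<lambda>z. step_fun N (\<lambda>_. 1) (snd z)) \<in> borel_measurable (lebesgue_on unit_square)"
      by (auto intro!: measurable_restrict_space1 measurable_completion)
  qed
  have "AE z in (lborel :: (real \<times> real) measure). fst z \<noteq> 0 \<and> snd z \<noteq> 0"
  proof -
    have "AE x in lborel. AE y in lborel. fst (x, y) \<noteq> (0::real) \<and> snd (x, y) \<noteq> (0::real)"
      using AE_lborel_singleton[of "0::real"] by (eventually_elim) (simp add: AE_lborel_singleton)
    then have "AE z in lborel \<Otimes>\<^sub>M lborel. fst z \<noteq> (0::real) \<and> snd z \<noteq> (0::real)"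
    proof (intro lborel_pair.AE_pair_measure)
      show "{z \<in> space (lborel \<Otimes>\<^sub>M lborel). fst z \<noteq> (0::real) \<and> snd z \<noteq> (0::real)}
          \<in> sets (lborel \<Otimes>\<^sub>M lborel)"
        by measurable
    qed
    then show ?thesis unfolding lborel_prod .
  qed
  then have "AE z in (lebesgue :: (real \<times> real) measure). fst z \<noteq> 0 \<and> snd z \<noteq> 0" by (rule AE_completion)
  then have "AE z in lebesgue_on unit_square. W (fst z) (snd z) * step_fun N (\<lambda>_. 1) (fst z) * step_fun N (\<lambda>_. 1) (snd z)
      = W (fst z) (snd z)"
    by (subst AE_restrict_space_iff, simp, elim eventually_mono) (auto simp: step_fun_const[OF N])
  then have "(\<integral>z. W (fst z) (snd z) * step_fun N (\<lambda>_. 1) (fst z) * step_fun N (\<lambda>_. 1) (snd z) \<partial>lebesgue_on unit_square)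
      = graphon_mass W"
    unfolding graphon_mass_def case_prod_unfold using Fm sf by (intro integral_cong_AE) auto
  then show ?thesis
    using graphon_grid_approx[OF W N, of "\<lambda>_. 1"]
    by (simp add: graphon_osc_def mean_osc_def grid_point_def)
qed

text \<open>
  The form on the grid is compared with the form of the graphon at a step function. The Cauchy--Schwarz
  inequality bounds the error by the Frobenius norm of the oscillations, and as these are at most 1,
  their squares are bounded by the oscillations themselves.
\<close>

lemma graphon_grid_quadratic_form_le:
  assumes W: "graphon W" and N: "N \<ge> 1" and pos: "0 < graphon_op_norm W"
  shows "(\<Sum>i=1..N. \<Sum>j=1..N. W (real i / real N) (real j / real N) * c i * c j)
    \<le> real N * (graphon_op_norm W + sqrt (graphon_osc W N)) * (\<Sum>i=1..N. (c i)\<^sup>2)"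
proof -
  define F where "F = (\<lambda>z. W (fst z) (snd z))"
  define s where "s = (\<Sum>i=1..N. (c i)\<^sup>2)"
  define Q where "Q = (\<Sum>i=1..N. \<Sum>j=1..N. F (grid_point N i, grid_point N j) * c i * c j)"
  define R where "R = (\<Sum>i=1..N. \<Sum>j=1..N. grid_osc F N i j * \<bar>c i\<bar> * \<bar>c j\<bar>)"
  have s0: "0 \<le> s" unfolding s_def by (intro sum_nonneg) simp
  have F01: "F z \<in> {0..1}" if "z \<in> unit_square" for z
    using W that unfolding graphon_def F_def by auto
  have N0: "0 < real N" using N by simp
  have osc: "0 \<le> grid_osc F N i j" "grid_osc F N i j \<le> 1" if "i \<in> {1..N}" "j \<in> {1..N}" for i j
    using grid_osc_bounds(2,3)[of F N i j, OF F01 N that] by auto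
  have "R \<le> real N * sqrt (graphon_osc W N) * s"
  proof -
    let ?I = "{1..N} \<times> {1..N}"
    have "R = (\<Sum>p\<in>?I. grid_osc F N (fst p) (snd p) * (\<bar>c (fst p)\<bar> * \<bar>c (snd p)\<bar>))"
      unfolding R_def by (simp add: sum.cartesian_product case_prod_unfold mult.assoc)
    also have "\<dots> \<le> sqrt ((\<Sum>p\<in>?I. (grid_osc F N (fst p) (snd p))\<^sup>2) * (\<Sum>p\<in>?I. (\<bar>c (fst p)\<bar> * \<bar>c (snd p)\<bar>)\<^sup>2))"
      by (intro real_le_rsqrt Cauchy_Schwarz_ineq_sum)
    also have "\<dots> \<le> sqrt ((graphon_osc W N * (real N)\<^sup>2) * s\<^sup>2)"
    proof (intro real_sqrt_le_mono mult_mono)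
      have "(\<Sum>p\<in>?I. (grid_osc F N (fst p) (snd p))\<^sup>2) \<le> (\<Sum>p\<in>?I. grid_osc F N (fst p) (snd p))"
      proof (intro sum_mono)
        fix p assume "p \<in> ?I"
        then have "0 \<le> grid_osc F N (fst p) (snd p)" "grid_osc F N (fst p) (snd p) \<le> 1"
          using osc unfolding mem_Times_iff by blast+
        then show "(grid_osc F N (fst p) (snd p))\<^sup>2 \<le> grid_osc F N (fst p) (snd p)"
          using mult_left_le[of "grid_osc F N (fst p) (snd p)" "grid_osc F N (fst p) (snd p)"]
          by (simp add: power2_eq_square)
      qed
      also have "\<dots> = graphon_osc W N * (real N)\<^sup>2"
        using N0 by (simp add: graphon_osc_def mean_osc_def F_def sum.cartesian_product case_prod_unfold)
      finally show "(\<Sum>p\<in>?I. (grid_osc F N (fst p) (snd p))\<^sup>2) \<le> graphon_osc W N * (real N)\<^sup>2" .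
      have "(\<Sum>p\<in>?I. (\<bar>c (fst p)\<bar> * \<bar>c (snd p)\<bar>)\<^sup>2) = s\<^sup>2"
        unfolding s_def power2_eq_square sum_product
        by (simp add: sum.cartesian_product case_prod_unfold ac_simps)
      then show "(\<Sum>p\<in>?I. (\<bar>c (fst p)\<bar> * \<bar>c (snd p)\<bar>)\<^sup>2) \<le> s\<^sup>2" by simp
      show "0 \<le> graphon_osc W N * (real N)\<^sup>2"
        unfolding graphon_osc_def using mean_osc_nonneg[of F, OF F01] by (simp add: F_def)
    qed (intro sum_nonneg zero_le_power2)
    also have "\<dots> = real N * sqrt (graphon_osc W N) * s"
      using s0 N0 by (simp add: real_sqrt_mult)
    finally show ?thesis .
  qed
  moreover have "(\<integral>z. F z * step_fun N c (fst z) * step_fun N c (snd z) \<partial>lebesgue_on unit_square)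
      \<le> graphon_op_norm W * (s / real N)"
    using graphon_quadratic_form_le[OF W pos step_fun_measurable step_fun_bounded, of N c]
    unfolding step_fun_square[OF N] integral_step_fun[OF N] by (simp add: F_def s_def)
  moreover have "\<bar>Q / (real N)\<^sup>2 - (\<integral>z. F z * step_fun N c (fst z) * step_fun N c (snd z) \<partial>lebesgue_on unit_square)\<bar>
      \<le> R / (real N)\<^sup>2"
    using graphon_grid_approx[OF W N, of c] by (simp add: F_def Q_def R_def)
  ultimately have "Q / (real N)\<^sup>2 \<le> graphon_op_norm W * (s / real N) + (real N * sqrt (graphon_osc W N) * s) / (real N)\<^sup>2"
    using divide_right_mono[of R "real N * sqrt (graphon_osc W N) * s" "(real N)\<^sup>2"] by simp
  then have "Q \<le> (graphon_op_norm W * (s / real N) + (real N * sqrt (graphon_osc W N) * s) / (real N)\<^sup>2) * (real N)\<^sup>2"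
    using N0 by (simp add: pos_divide_le_eq)
  also have "\<dots> = real N * (graphon_op_norm W + sqrt (graphon_osc W N)) * s"
    using N0 by (simp add: power2_eq_square field_simps)
  finally show ?thesis by (simp add: Q_def F_def s_def grid_point_def)
qed


section \<open>Expectations over the random graph\<close>

abbreviation coins :: "nat \<Rightarrow> (nat \<times> nat) set" where
  "coins N \<equiv> {(i, j). 1 \<le> i \<and> i \<le> j \<and> j \<le> N}"

abbreviation vertex_pairs :: "nat \<Rightarrow> (nat \<times> nat) set" where
  "vertex_pairs N \<equiv> {(i, j). 1 \<le> i \<and> i < j \<and> j \<le> N}"

lemma vertex_pairs_subset: "vertex_pairs N \<subseteq> {1..N} \<times> {1..N}" by auto

lemma finite_vertex_pairs: "finite (vertex_pairs N)"
  by (rule finite_subset[OF vertex_pairs_subset]) simp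

lemma coins_subset: "coins N \<subseteq> {1..N} \<times> {1..N}" by auto

lemma finite_coins: "finite (coins N)"
  by (rule finite_subset[OF coins_subset]) simp

lemma card_coins_le: "card (coins N) \<le> N\<^sup>2"
  using card_mono[OF _ coins_subset[of N]] by (simp add: power2_eq_square)

lemma sum_coins: "(\<Sum>e\<in>coins N. f e) = (\<Sum>i=1..N. f (i, i)) + (\<Sum>e\<in>vertex_pairs N. f e)"
  for f :: "_ \<Rightarrow> real"
proof -
  have "coins N = (\<lambda>i. (i, i)) ` {1..N} \<union> vertex_pairs N" by auto
  moreover have "(\<lambda>i. (i, i)) ` {1..N} \<inter> vertex_pairs N = {}" by auto
  ultimately have "(\<Sum>e\<in>coins N. f e) = (\<Sum>e\<in>(\<lambda>i. (i, i)) ` {1..N}. f e) + (\<Sum>e\<in>vertex_pairs N. f e)"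
    using finite_vertex_pairs by (simp add: sum.union_disjoint)
  then show ?thesis by (simp add: sum.reindex inj_on_def)
qed

lemma sum_symmetric_matrix:
  fixes h :: "nat \<Rightarrow> nat \<Rightarrow> real"
  assumes "\<And>i j. h i j = h j i"
  shows "(\<Sum>i=1..N. \<Sum>j=1..N. h i j) = (\<Sum>i=1..N. h i i) + 2 * (\<Sum>(i, j)\<in>vertex_pairs N. h i j)"
proof -
  let ?S = "(\<lambda>(i, j). (j, i)) ` vertex_pairs N"
  have "{1..N} \<times> {1..N} = coins N \<union> ?S" by force
  moreover have "coins N \<inter> ?S = {}" by auto
  ultimately have "(\<Sum>p\<in>{1..N} \<times> {1..N}. case p of (i, j) \<Rightarrow> h i j)
      = (\<Sum>p\<in>coins N. case p of (i, j) \<Rightarrow> h i j) + (\<Sum>p\<in>?S. case p of (i, j) \<Rightarrow> h i j)"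
    using finite_vertex_pairs finite_coins by (simp add: sum.union_disjoint)
  also have "(\<Sum>p\<in>?S. case p of (i, j) \<Rightarrow> h i j) = (\<Sum>(i, j)\<in>vertex_pairs N. h i j)"
    by (subst sum.reindex) (auto simp: inj_on_def assms intro!: sum.cong)
  finally show ?thesis
    unfolding sum_coins by (simp add: sum.cartesian_product)
qed

text \<open>
  Self-loops are not counted: they add a constant to the Hamiltonian.
\<close>

definition edges :: "nat \<Rightarrow> (nat \<Rightarrow> nat \<Rightarrow> real) \<Rightarrow> (nat \<times> nat) set" where
  "edges N A = {(i, j) \<in> vertex_pairs N. A i j \<noteq> 0}"

definition loop_sum :: "nat \<Rightarrow> (nat \<Rightarrow> nat \<Rightarrow> real) \<Rightarrow> real" where
  "loop_sum N A = (\<Sum>i=1..N. A i i)"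

lemma edges_subset: "edges N A \<subseteq> {1..N} \<times> {1..N}" unfolding edges_def by auto

lemma finite_edges: "finite (edges N A)"
  by (rule finite_subset[OF edges_subset]) simp

abbreviation graph_poly :: "nat \<Rightarrow> (nat \<Rightarrow> nat \<Rightarrow> real) \<Rightarrow> 'a \<Rightarrow> 'a::real_normed_field" where
  "graph_poly N A \<equiv> edge_poly {1..N} (edges N A)"

definition adjacency :: "(nat \<Rightarrow> nat \<Rightarrow> real) \<Rightarrow> bool" where
  "adjacency A \<longleftrightarrow> (\<forall>i j. A i j = A j i \<and> A i j \<in> {0, 1})"

lemma loop_sum_nonneg:
  assumes "adjacency A"
  shows "0 \<le> loop_sum N A"
proof -
  have "A i i \<in> {0, 1}" for i using assms unfolding adjacency_def by blast
  then have "0 \<le> A i i" for i by (metis empty_iff insert_iff order_refl zero_le_one)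
  then show ?thesis unfolding loop_sum_def by (intro sum_nonneg)
qed

lemma sum_edges:
  assumes "adjacency A"
  shows "(\<Sum>(i, j)\<in>edges N A. f i j) = (\<Sum>(i, j)\<in>vertex_pairs N. A i j * f i j :: real)"
proof (rule sum.mono_neutral_cong_left[OF finite_vertex_pairs])
  fix p assume "p \<in> edges N A"
  then show "(case p of (i, j) \<Rightarrow> f i j) = (case p of (i, j) \<Rightarrow> A i j * f i j)"
    using assms unfolding adjacency_def edges_def by (cases p) fastforce
qed (auto simp: edges_def)

lemma prod_edges:
  fixes f :: "nat \<Rightarrow> nat \<Rightarrow> real"
  assumes "adjacency A"
  shows "(\<Prod>(i, j)\<in>edges N A. 1 + f i j) = (\<Prod>(i, j)\<in>vertex_pairs N. 1 + A i j * f i j)"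
proof (rule prod.mono_neutral_cong_left[OF finite_vertex_pairs])
  fix p assume "p \<in> edges N A"
  then show "(case p of (i, j) \<Rightarrow> 1 + f i j) = (case p of (i, j) \<Rightarrow> 1 + A i j * f i j)"
    using assms unfolding adjacency_def edges_def by (cases p) fastforce
qed (auto simp: edges_def)

lemma edge_sum_eq:
  assumes "adjacency A"
  shows "edge_sum N A = loop_sum N A + 2 * real (card (edges N A))"
proof -
  have "real (card (edges N A)) = (\<Sum>(i, j)\<in>edges N A. 1)" by (simp add: case_prod_unfold)
  also have "\<dots> = (\<Sum>(i, j)\<in>vertex_pairs N. A i j)" using sum_edges[OF assms, of "\<lambda>_ _. 1"] by simp
  finally show ?thesis
    using assms unfolding edge_sum_def loop_sum_def adjacency_def by (subst sum_symmetric_matrix) auto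
qed

lemma random_graph_adjacency:
  assumes "A \<in> set_pmf (random_graph N t W)"
  shows "adjacency A"
  using assms unfolding random_graph_def adjacency_def by (auto simp: min.commute max.commute)

lemma finite_set_random_graph: "finite (set_pmf (random_graph N t W))"
proof -
  have "finite (set_pmf (Pi_pmf (coins N) False p))" for p :: "nat \<times> nat \<Rightarrow> bool pmf"
    by (intro finite_subset[OF set_Pi_pmf_subset'[OF finite_coins]] finite_PiE_dflt finite_coins finite)
  then show ?thesis unfolding random_graph_def by simp
qed

lemma integrable_random_graph:
  fixes f :: "_ \<Rightarrow> 'b::{banach, second_countable_topology}"
  shows "integrable (measure_pmf (random_graph N t W)) f"
  by (rule integrable_measure_pmf_finite[OF finite_set_random_graph])

locale sparse_graphon_sample =
  fixes W :: "real \<Rightarrow> real \<Rightarrow> real" and N :: nat and t :: real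
  assumes graphon: "graphon W" and N: "N \<ge> 1" and t: "0 < t" "t < 1"
begin

definition w :: "nat \<Rightarrow> nat \<Rightarrow> real" where "w i j = W (real i / real N) (real j / real N)"

lemma w_bounds:
  assumes "i \<in> {1..N}" "j \<in> {1..N}"
  shows "0 \<le> w i j" "w i j \<le> 1" "w i j = w j i"
proof -
  have "real i / real N \<in> {0..1}" "real j / real N \<in> {0..1}"
    using grid_point_in_unit[of i N] grid_point_in_unit[of j N] assms by (auto simp: grid_point_def)
  then show "0 \<le> w i j" "w i j \<le> 1" "w i j = w j i"
    using graphon unfolding graphon_def w_def by auto
qed

lemma coin_prob:
  assumes "(i, j) \<in> coins N"
  shows "0 \<le> t * w i j" "t * w i j \<le> t" "t * w i j \<le> 1"
proof -
  have "0 \<le> w i j" "w i j \<le> 1" using assms by (auto intro!: w_bounds)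
  then show "0 \<le> t * w i j" "t * w i j \<le> t" using t by (simp_all add: mult_left_le)
  then show "t * w i j \<le> 1" using t by linarith
qed

definition p_coin :: "nat \<times> nat \<Rightarrow> bool pmf" where
  "p_coin = (\<lambda>(i, j). bernoulli_pmf (t * w i j))"

lemma random_graph_eq:
  "random_graph N t W = map_pmf (\<lambda>g i j. of_bool (g (min i j, max i j))) (Pi_pmf (coins N) False p_coin)"
  unfolding random_graph_def p_coin_def w_def by simp

lemma expectation_coin:
  fixes f :: "bool \<Rightarrow> real"
  assumes "e \<in> coins N"
  shows "\<E> (p_coin e) f = f True * (t * w (fst e) (snd e)) + f False * (1 - t * w (fst e) (snd e))"
  using coin_prob[of "fst e" "snd e"] assms by (simp add: p_coin_def case_prod_unfold)

lemma expectation_graph: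
  "\<E> (random_graph N t W) f
    = \<E> (Pi_pmf (coins N) False p_coin) (\<lambda>g. f (\<lambda>i j. of_bool (g (min i j, max i j))))"
  for f :: "_ \<Rightarrow> real"
  unfolding random_graph_eq by simp

lemma expectation_entry:
  assumes "i \<in> {1..N}" "j \<in> {1..N}"
  shows "\<E> (random_graph N t W) (\<lambda>A. A i j) = t * w i j"
proof -
  let ?e = "(min i j, max i j)"
  have e: "?e \<in> coins N" using assms by auto
  have "\<E> (random_graph N t W) (\<lambda>A. A i j)
      = \<E> (map_pmf (\<lambda>g. g ?e) (Pi_pmf (coins N) False p_coin)) of_bool"
    unfolding expectation_graph by simp
  also have "\<dots> = \<E> (p_coin ?e) of_bool"
    using e by (subst Pi_pmf_component[OF finite_coins]) (simp only: if_True)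
  also have "\<dots> = t * w (min i j) (max i j)" unfolding expectation_coin[OF e] by simp
  also have "w (min i j) (max i j) = w i j" using w_bounds(3)[OF assms] by (auto simp: min_def max_def)
  finally show ?thesis .
qed

lemma expectation_edge_product:
  fixes f :: "nat \<Rightarrow> nat \<Rightarrow> real"
  assumes f: "\<And>i j. \<bar>f i j\<bar> \<le> 1"
  shows "\<E> (random_graph N t W) (\<lambda>A. \<Prod>(i, j)\<in>edges N A. 1 + f i j)
    = (\<Prod>(i, j)\<in>vertex_pairs N. 1 + t * w i j * f i j)"
proof -
  define F where "F = (\<lambda>e x. if fst e < snd e then 1 + of_bool x * f (fst e) (snd e) else 1)"
  have sub: "vertex_pairs N \<subseteq> coins N" by auto
  have "\<E> (random_graph N t W) (\<lambda>A. \<Prod>(i, j)\<in>edges N A. 1 + f i j)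
      = \<E> (random_graph N t W) (\<lambda>A. \<Prod>(i, j)\<in>vertex_pairs N. 1 + A i j * f i j)"
    by (intro integral_cong_AE AE_pmfI prod_edges random_graph_adjacency) auto
  also have "\<dots> = \<E> (Pi_pmf (coins N) False p_coin) (\<lambda>g. \<Prod>e\<in>coins N. F e (g e))"
    unfolding expectation_graph
  proof (intro Bochner_Integration.integral_cong refl prod.mono_neutral_cong_left finite_coins sub)
    fix g :: "nat \<times> nat \<Rightarrow> bool"
    show "\<forall>e\<in>coins N - vertex_pairs N. F e (g e) = 1" by (auto simp: F_def)
    fix e assume "e \<in> vertex_pairs N"
    then show "(case e of (i, j) \<Rightarrow> 1 + of_bool (g (min i j, max i j)) * f i j) = F e (g e)"
      by (auto simp: F_def)
  qed
  also have "\<dots> = (\<Prod>e\<in>coins N. \<E> (p_coin e) (F e))"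
  proof (rule expectation_prod_Pi_pmf[OF finite_coins])
    show "integrable (measure_pmf (p_coin e)) (F e)" for e
      by (rule integrable_measure_pmf_finite) (rule finite_subset[of _ UNIV], auto)
    show "0 \<le> F e x" for e x using f[of "fst e" "snd e"] by (auto simp: F_def)
  qed
  also have "\<dots> = (\<Prod>(i, j)\<in>vertex_pairs N. 1 + t * w i j * f i j)"
  proof (rule prod.mono_neutral_cong_right[OF finite_coins sub])
    show "\<forall>e\<in>coins N - vertex_pairs N. \<E> (p_coin e) (F e) = 1"
      using expectation_coin by (auto simp: F_def)
    fix e assume e: "e \<in> vertex_pairs N"
    then show "\<E> (p_coin e) (F e) = (case e of (i, j) \<Rightarrow> 1 + t * w i j * f i j)"
      using expectation_coin[of e "F e"] by (auto simp: F_def algebra_simps)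
  qed
  finally show ?thesis .
qed

text \<open>
  Averaging over the graph first, independence of the edges turns each factor into
  \<open>1 + r t w \<sigma>\<^sub>i \<sigma>\<^sub>j\<close>, which is at most \<open>exp (r t w \<sigma>\<^sub>i \<sigma>\<^sub>j)\<close>. What remains is the average of the
  exponential of a quadratic form in the signs. With \<open>r * t * N = \<beta>'\<close> the assumption \<open>gap\<close> says that
  \<open>\<beta>'\<close> is below the critical value, with a margin that absorbs the error of sampling \<open>W\<close> on the grid.
\<close>

lemma expectation_edge_poly_le:
  assumes pos: "0 < graphon_op_norm W" and r: "0 \<le> r" "r \<le> 1" and \<epsilon>: "0 < \<epsilon>"
    and gap: "r * t * real N * (graphon_op_norm W + sqrt (graphon_osc W N)) \<le> 1 - \<epsilon>"
  shows "\<E> (random_graph N t W) (\<lambda>A. graph_poly N A r)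
    \<le> exp ((r * t * real N)\<^sup>2 / (4 * \<epsilon>))"
proof -
  \<comment> \<open>deleting the diagonal makes the trace vanish and only lowers the form at vectors with
    nonnegative entries\<close>
  define M where "M i j = (if i = j then 0 else r * t * w i j)" for i j
  have rt: "0 \<le> r * t" using r t by simp
  have "\<E> (random_graph N t W) (\<lambda>A. graph_poly N A r)
      = spin_avg {1..N} (\<lambda>\<sigma>. \<E> (random_graph N t W)
          (\<lambda>A. \<Prod>(i, j)\<in>edges N A. 1 + r * (\<sigma> i * \<sigma> j)))"
    unfolding edge_poly_def spin_avg_def
    by (simp add: integrable_random_graph)
  also have "\<dots> = spin_avg {1..N} (\<lambda>\<sigma>. \<Prod>(i, j)\<in>vertex_pairs N. 1 + t * w i j * (r * (\<sigma> i * \<sigma> j)))"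
  proof (rule spin_avg_cong)
    fix \<sigma> :: "nat \<Rightarrow> real" assume \<sigma>: "\<sigma> \<in> {1..N} \<rightarrow>\<^sub>E {-1, 1}"
    have "\<bar>\<sigma> i\<bar> = 1" if "i \<in> {1..N}" for i using PiE_mem[OF \<sigma> that] by auto
    define f where "f i j = (if i \<in> {1..N} \<and> j \<in> {1..N} then r * (\<sigma> i * \<sigma> j) else 0)" for i j
    have "\<bar>f i j\<bar> \<le> 1" for i j
      using r \<open>\<And>i. i \<in> {1..N} \<Longrightarrow> \<bar>\<sigma> i\<bar> = 1\<close> by (simp add: f_def abs_mult)
    then have "\<E> (random_graph N t W) (\<lambda>A. \<Prod>(i, j)\<in>edges N A. 1 + f i j)
      = (\<Prod>(i, j)\<in>vertex_pairs N. 1 + t * w i j * f i j)"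
      by (rule expectation_edge_product)
    moreover have "(\<Prod>(i, j)\<in>edges N A. 1 + f i j) = (\<Prod>(i, j)\<in>edges N A. 1 + r * (\<sigma> i * \<sigma> j))" for A
      using edges_subset[of N A] by (intro prod.cong refl) (auto simp: f_def)
    moreover have "(\<Prod>(i, j)\<in>vertex_pairs N. 1 + t * w i j * f i j)
        = (\<Prod>(i, j)\<in>vertex_pairs N. 1 + t * w i j * (r * (\<sigma> i * \<sigma> j)))"
      by (intro prod.cong refl) (auto simp: f_def)
    ultimately show "\<E> (random_graph N t W) (\<lambda>A. \<Prod>(i, j)\<in>edges N A. 1 + r * (\<sigma> i * \<sigma> j))
      = (\<Prod>(i, j)\<in>vertex_pairs N. 1 + t * w i j * (r * (\<sigma> i * \<sigma> j)))" by simp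
  qed
  also have "\<dots> \<le> spin_avg {1..N} (\<lambda>\<sigma>. exp (quad_form {1..N} M \<sigma> / 2))"
  proof (rule spin_avg_mono)
    fix \<sigma> :: "nat \<Rightarrow> real" assume \<sigma>: "\<sigma> \<in> {1..N} \<rightarrow>\<^sub>E {-1, 1}"
    have s1: "\<bar>\<sigma> i\<bar> = 1" if "i \<in> {1..N}" for i using PiE_mem[OF \<sigma> that] by auto
    have "(\<Prod>(i, j)\<in>vertex_pairs N. 1 + t * w i j * (r * (\<sigma> i * \<sigma> j)))
        \<le> (\<Prod>(i, j)\<in>vertex_pairs N. exp (t * w i j * (r * (\<sigma> i * \<sigma> j))))"
    proof (rule prod_mono, clarify)
      fix i j assume ij: "1 \<le> i" "i < j" "j \<le> N"
      have c: "0 \<le> t * w i j" "t * w i j \<le> 1" using coin_prob[of i j] ij by auto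
      have "\<bar>t * w i j * (r * (\<sigma> i * \<sigma> j))\<bar> = t * w i j * r" using t w_bounds(1)[of i j] r ij s1[of i] s1[of j] by (simp add: abs_mult)
      moreover have "t * w i j * r \<le> 1" using mult_mono[OF c(2) r(2)] r by simp
      ultimately show "0 \<le> 1 + t * w i j * (r * (\<sigma> i * \<sigma> j))
          \<and> 1 + t * w i j * (r * (\<sigma> i * \<sigma> j)) \<le> exp (t * w i j * (r * (\<sigma> i * \<sigma> j)))"
        using exp_ge_add_one_self[of "t * w i j * (r * (\<sigma> i * \<sigma> j))"] by linarith
    qed
    also have "\<dots> = exp (\<Sum>(i, j)\<in>vertex_pairs N. t * w i j * (r * (\<sigma> i * \<sigma> j)))"
      by (subst exp_sum[OF finite_vertex_pairs], intro prod.cong refl) auto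
    also have "(\<Sum>(i, j)\<in>vertex_pairs N. t * w i j * (r * (\<sigma> i * \<sigma> j))) = quad_form {1..N} M \<sigma> / 2"
    proof -
      define h where "h i j = (if i \<in> {1..N} \<and> j \<in> {1..N} then M i j * \<sigma> i * \<sigma> j else 0)" for i j
      have "quad_form {1..N} M \<sigma> = (\<Sum>i=1..N. \<Sum>j=1..N. h i j)"
        by (intro sum.cong refl) (simp add: h_def)
      also have "\<dots> = (\<Sum>i=1..N. h i i) + 2 * (\<Sum>(i, j)\<in>vertex_pairs N. h i j)"
        by (rule sum_symmetric_matrix) (use w_bounds(3) in \<open>auto simp: h_def M_def\<close>)
      also have "(\<Sum>i=1..N. h i i) = 0" by (simp add: h_def M_def)
      also have "(\<Sum>(i, j)\<in>vertex_pairs N. h i j) = (\<Sum>(i, j)\<in>vertex_pairs N. t * w i j * (r * (\<sigma> i * \<sigma> j)))"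
        by (intro sum.cong refl) (auto simp: h_def M_def)
      finally show ?thesis by simp
    qed
    finally show "(\<Prod>(i, j)\<in>vertex_pairs N. 1 + t * w i j * (r * (\<sigma> i * \<sigma> j)))
        \<le> exp (quad_form {1..N} M \<sigma> / 2)" .
  qed
  also have "\<dots> \<le> exp ((\<Sum>i=1..N. M i i) / 2 + (\<Sum>i=1..N. \<Sum>j=1..N. (M i j)\<^sup>2) / (4 * \<epsilon>))"
  proof (rule spin_avg_exp_quadratic_le)
    show "M i j = M j i" if "i \<in> {1..N}" "j \<in> {1..N}" for i j using w_bounds(3)[OF that] by (simp add: M_def)
    show "0 \<le> M i i" for i by (simp add: M_def)
    fix x :: "nat \<Rightarrow> real"
    have "quad_form {1..N} M x \<le> (\<Sum>i=1..N. \<Sum>j=1..N. r * t * (w i j * \<bar>x i\<bar> * \<bar>x j\<bar>))"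
    proof (intro sum_mono)
      fix i j assume ij: "i \<in> {1..N}" "j \<in> {1..N}"
      have "M i j * (x i * x j) \<le> (r * t * w i j) * (\<bar>x i\<bar> * \<bar>x j\<bar>)"
      proof (cases "i = j")
        case False
        have "x i * x j \<le> \<bar>x i\<bar> * \<bar>x j\<bar>" by (metis abs_ge_self abs_mult)
        then show ?thesis using False rt w_bounds(1)[OF ij] by (simp add: M_def mult_left_mono)
      qed (use rt w_bounds(1)[OF ij] in \<open>simp add: M_def\<close>)
      then show "M i j * x i * x j \<le> r * t * (w i j * \<bar>x i\<bar> * \<bar>x j\<bar>)" by (simp add: mult.assoc)
    qed
    also have "\<dots> = r * t * (\<Sum>i=1..N. \<Sum>j=1..N. w i j * \<bar>x i\<bar> * \<bar>x j\<bar>)"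
      by (simp add: sum_distrib_left)
    also have "\<dots> \<le> r * t * (real N * (graphon_op_norm W + sqrt (graphon_osc W N)) * (\<Sum>i=1..N. \<bar>x i\<bar>\<^sup>2))"
      unfolding w_def by (intro mult_left_mono graphon_grid_quadratic_form_le graphon N pos rt)
    also have "\<dots> = (r * t * real N * (graphon_op_norm W + sqrt (graphon_osc W N))) * (\<Sum>i=1..N. (x i)\<^sup>2)"
      by simp
    also have "\<dots> \<le> (1 - \<epsilon>) * (\<Sum>i=1..N. (x i)\<^sup>2)"
      by (intro mult_right_mono gap sum_nonneg) simp
    finally show "quad_form {1..N} M x \<le> (1 - \<epsilon>) * (\<Sum>i=1..N. (x i)\<^sup>2)" .
  qed (use \<epsilon> in simp_all)
  also have "\<dots> \<le> exp ((r * t * real N)\<^sup>2 / (4 * \<epsilon>))"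
  proof -
    have "(\<Sum>i=1..N. \<Sum>j=1..N. (M i j)\<^sup>2) \<le> (\<Sum>i=1..N. \<Sum>j=1..N. (r * t)\<^sup>2)"
    proof (intro sum_mono power_mono)
      fix i j assume ij: "i \<in> {1..N}" "j \<in> {1..N}"
      show "0 \<le> M i j" "M i j \<le> r * t"
        using rt w_bounds[OF ij] by (auto simp: M_def intro: mult_left_le)
    qed
    also have "\<dots> = (r * t * real N)\<^sup>2" by (simp add: power2_eq_square)
    finally show ?thesis using \<epsilon> by (simp add: M_def divide_right_mono)
  qed
  finally show ?thesis .
qed

lemma coin_second_moment:
  fixes Y :: "nat \<times> nat \<Rightarrow> bool \<Rightarrow> real"
  assumes Y0: "\<And>e. e \<in> coins N \<Longrightarrow> \<E> (p_coin e) (Y e) = 0"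
  shows "\<E> (Pi_pmf (coins N) False p_coin) (\<lambda>g. (\<Sum>e\<in>coins N. Y e (g e))\<^sup>2)
    = (\<Sum>e\<in>coins N. \<E> (p_coin e) (\<lambda>x. (Y e x)\<^sup>2))"
proof -
  let ?P = "Pi_pmf (coins N) False p_coin"
  have fin: "finite (set_pmf ?P)"
    by (intro finite_subset[OF set_Pi_pmf_subset'[OF finite_coins]] finite_PiE_dflt finite_coins finite)
  have int: "integrable (measure_pmf ?P) f" for f :: "_ \<Rightarrow> real"
    by (rule integrable_measure_pmf_finite[OF fin])
  have ind: "prob_space.indep_vars (measure_pmf ?P) (\<lambda>_. borel) (\<lambda>e g. Y e (g e)) (coins N)"
    by (rule prob_space.indep_vars_compose2[OF prob_space_measure_pmf indep_vars_Pi_pmf[OF finite_coins]]) simp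
  have comp: "\<E> ?P (\<lambda>g. f (g e)) = \<E> (p_coin e) f"
    if "e \<in> coins N" for e and f :: "bool \<Rightarrow> real"
  proof -
    have "\<E> ?P (\<lambda>g. f (g e)) = \<E> (map_pmf (\<lambda>g. g e) ?P) f" by simp
    also have "map_pmf (\<lambda>g. g e) ?P = p_coin e" using that by (subst Pi_pmf_component[OF finite_coins]) simp
    finally show ?thesis .
  qed
  have cross: "\<E> ?P (\<lambda>g. Y e (g e) * Y e' (g e')) = 0"
    if "e \<in> coins N" "e' \<in> coins N" "e \<noteq> e'" for e e'
  proof -
    have "prob_space.indep_vars (measure_pmf ?P) (\<lambda>_. borel) (\<lambda>e g. Y e (g e)) {e, e'}"
      by (rule prob_space.indep_vars_subset[OF prob_space_measure_pmf ind]) (use that in auto)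
    then have "\<E> ?P (\<lambda>g. \<Prod>d\<in>{e, e'}. Y d (g d))
        = (\<Prod>d\<in>{e, e'}. \<E> ?P (\<lambda>g. Y d (g d)))"
      by (intro prob_space.indep_vars_lebesgue_integral[OF prob_space_measure_pmf] int) auto
    then show ?thesis using that comp[OF that(1), of "Y e"] Y0[OF that(1)] by simp
  qed
  have "\<E> ?P (\<lambda>g. (\<Sum>e\<in>coins N. Y e (g e))\<^sup>2)
      = (\<Sum>e\<in>coins N. \<Sum>e'\<in>coins N. \<E> ?P (\<lambda>g. Y e (g e) * Y e' (g e')))"
    unfolding power2_eq_square sum_product by (simp only: Bochner_Integration.integral_sum[OF int])
  also have "\<dots> = (\<Sum>e\<in>coins N. \<Sum>e'\<in>coins N. if e = e' then \<E> (p_coin e) (\<lambda>x. (Y e x)\<^sup>2) else 0)"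
  proof (intro sum.cong refl)
    fix e e' assume e: "e \<in> coins N" and e': "e' \<in> coins N"
    show "\<E> ?P (\<lambda>g. Y e (g e) * Y e' (g e'))
      = (if e = e' then \<E> (p_coin e) (\<lambda>x. (Y e x)\<^sup>2) else 0)"
    proof (cases "e = e'")
      case True
      then show ?thesis using comp[OF e, of "\<lambda>x. (Y e x)\<^sup>2"] by (simp add: power2_eq_square)
    next
      case False
      then show ?thesis using cross[OF e e'] by simp
    qed
  qed
  also have "\<dots> = (\<Sum>e\<in>coins N. \<E> (p_coin e) (\<lambda>x. (Y e x)\<^sup>2))"
    by (intro sum.cong refl) (simp only: sum.delta'[OF finite_coins] if_True)
  finally show ?thesis .
qed

text \<open>
  Each pair \<open>i \<noteq> j\<close> occurs twice in the edge sum, so that its coin has weight 2 and contributes at most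
  \<open>4 * t\<close> to the variance.
\<close>

lemma expectation_edge_sum_deviation_sq:
  "\<E> (random_graph N t W) (\<lambda>A. (edge_sum N A - t * (\<Sum>i=1..N. \<Sum>j=1..N. w i j))\<^sup>2)
    \<le> 4 * (real N)\<^sup>2 * t"
proof -
  define c where "c e = (if fst e = snd e then 1 else 2 :: real)" for e :: "nat \<times> nat"
  define Y where "Y e x = c e * (of_bool x - t * w (fst e) (snd e))" for e x
  have split: "(\<Sum>i=1..N. \<Sum>j=1..N. h i j) = (\<Sum>e\<in>coins N. c e * h (fst e) (snd e))"
    if "\<And>i j. i \<in> {1..N} \<Longrightarrow> j \<in> {1..N} \<Longrightarrow> h i j = h j i" for h :: "nat \<Rightarrow> nat \<Rightarrow> real"
  proof -
    define h' where "h' i j = (if i \<in> {1..N} \<and> j \<in> {1..N} then h i j else 0)" for i j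
    have "(\<Sum>i=1..N. \<Sum>j=1..N. h i j) = (\<Sum>i=1..N. \<Sum>j=1..N. h' i j)"
      by (intro sum.cong refl) (simp add: h'_def)
    also have "\<dots> = (\<Sum>i=1..N. h' i i) + 2 * (\<Sum>(i, j)\<in>vertex_pairs N. h' i j)"
      by (rule sum_symmetric_matrix) (use that in \<open>auto simp: h'_def\<close>)
    also have "\<dots> = (\<Sum>i=1..N. c (i, i) * h i i) + (\<Sum>e\<in>vertex_pairs N. c e * h (fst e) (snd e))"
    proof -
      have "(\<Sum>i=1..N. h' i i) = (\<Sum>i=1..N. c (i, i) * h i i)" by (simp add: h'_def c_def)
      moreover have "2 * (\<Sum>(i, j)\<in>vertex_pairs N. h' i j) = (\<Sum>e\<in>vertex_pairs N. c e * h (fst e) (snd e))"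
        unfolding sum_distrib_left by (intro sum.cong refl) (auto simp: h'_def c_def)
      ultimately show ?thesis by simp
    qed
    finally show ?thesis unfolding sum_coins by simp
  qed
  have S: "edge_sum N (\<lambda>i j. of_bool (g (min i j, max i j))) - t * (\<Sum>i=1..N. \<Sum>j=1..N. w i j) = (\<Sum>e\<in>coins N. Y e (g e))"
    for g :: "nat \<times> nat \<Rightarrow> bool"
  proof -
    have "edge_sum N (\<lambda>i j. of_bool (g (min i j, max i j))) - t * (\<Sum>i=1..N. \<Sum>j=1..N. w i j)
        = (\<Sum>i=1..N. \<Sum>j=1..N. of_bool (g (min i j, max i j)) - t * w i j)"
      by (simp add: edge_sum_def sum_subtractf sum_distrib_left)
    also have "\<dots> = (\<Sum>e\<in>coins N. c e * (of_bool (g (min (fst e) (snd e), max (fst e) (snd e))) - t * w (fst e) (snd e)))"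
      by (rule split) (auto simp: min.commute max.commute w_bounds(3))
    also have "\<dots> = (\<Sum>e\<in>coins N. Y e (g e))"
      by (intro sum.cong refl) (auto simp: Y_def)
    finally show ?thesis .
  qed
  have "\<E> (random_graph N t W) (\<lambda>A. (edge_sum N A - t * (\<Sum>i=1..N. \<Sum>j=1..N. w i j))\<^sup>2)
      = (\<Sum>e\<in>coins N. \<E> (p_coin e) (\<lambda>x. (Y e x)\<^sup>2))"
    unfolding expectation_graph S
    by (rule coin_second_moment) (simp add: expectation_coin Y_def algebra_simps)
  also have "\<dots> \<le> (\<Sum>e\<in>coins N. 4 * t)"
  proof (rule sum_mono)
    fix e assume e: "e \<in> coins N"
    define p where "p = t * w (fst e) (snd e)"
    have p: "0 \<le> p" "p \<le> t" "p \<le> 1" using coin_prob[of "fst e" "snd e"] e by (auto simp: p_def)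
    have "\<E> (p_coin e) (\<lambda>x. (Y e x)\<^sup>2) = (c e)\<^sup>2 * (p * (1 - p))"
      unfolding expectation_coin[OF e] Y_def p_def[symmetric]
      by (simp add: power_mult_distrib power2_eq_square algebra_simps)
    also have "\<dots> \<le> 4 * t"
      using p mult_mono[of p t "1 - p" 1] by (intro mult_mono) (auto simp: c_def)
    finally show "\<E> (p_coin e) (\<lambda>x. (Y e x)\<^sup>2) \<le> 4 * t" .
  qed
  also have "\<dots> \<le> 4 * (real N)\<^sup>2 * t"
  proof -
    have "real (card (coins N)) \<le> (real N)\<^sup>2" using card_coins_le[of N] by (simp flip: of_nat_power)
    then have "real (card (coins N)) * (4 * t) \<le> (real N)\<^sup>2 * (4 * t)" using t by (intro mult_right_mono) auto
    then show ?thesis by simp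
  qed
  finally show ?thesis .
qed

text \<open>
  The first term bounds the normalised standard deviation of the edge sum, the second one the error of replacing the
  integral of \<open>W\<close> by its mean over the grid.
\<close>

lemma expectation_edge_density_deviation:
  "\<E> (random_graph N t W) (\<lambda>A. \<bar>edge_sum N A / ((real N)\<^sup>2 * t) - graphon_mass W\<bar>)
    \<le> 2 / (real N * sqrt t) + graphon_osc W N"
proof -
  let ?E = "\<E> (random_graph N t W)"
  define m where "m = t * (\<Sum>i=1..N. \<Sum>j=1..N. w i j)"
  define \<delta> where "\<delta> = 2 * real N * sqrt t"
  have N0: "0 < real N" using N by simp
  have \<delta>: "0 < \<delta>" "\<delta>\<^sup>2 = 4 * (real N)\<^sup>2 * t" using N0 t by (auto simp: \<delta>_def power_mult_distrib)
  have "?E (\<lambda>A. \<bar>edge_sum N A - m\<bar>) \<le> ?E (\<lambda>A. \<delta> / 2 + (edge_sum N A - m)\<^sup>2 / (2 * \<delta>))"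
  proof (rule integral_mono[OF integrable_random_graph integrable_random_graph])
    fix A
    \<comment> \<open>the first absolute moment is bounded by the second one through \<open>2 \<bar>x\<bar> \<delta> \<le> \<delta>\<^sup>2 + x\<^sup>2\<close>\<close>
    have "0 \<le> (\<bar>edge_sum N A - m\<bar> - \<delta>)\<^sup>2 / (2 * \<delta>)" using \<delta> by simp
    also have "\<dots> = \<delta> / 2 + (edge_sum N A - m)\<^sup>2 / (2 * \<delta>) - \<bar>edge_sum N A - m\<bar>"
      using \<delta>(1) by (simp add: power2_diff field_simps power2_eq_square)
    finally show "\<bar>edge_sum N A - m\<bar> \<le> \<delta> / 2 + (edge_sum N A - m)\<^sup>2 / (2 * \<delta>)" by simp
  qed
  also have "\<dots> = \<delta> / 2 + ?E (\<lambda>A. (edge_sum N A - m)\<^sup>2) / (2 * \<delta>)"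
    by (simp add: integrable_random_graph)
  also have "\<dots> \<le> \<delta> / 2 + \<delta>\<^sup>2 / (2 * \<delta>)"
    using expectation_edge_sum_deviation_sq \<delta> by (intro add_left_mono divide_right_mono) (auto simp: m_def)
  also have "\<dots> = \<delta>" using \<delta>(1) by (simp add: power2_eq_square)
  finally have dev: "?E (\<lambda>A. \<bar>edge_sum N A - m\<bar>) \<le> \<delta>" .
  have d0: "0 < (real N)\<^sup>2 * t" using N0 t by simp
  have "?E (\<lambda>A. \<bar>edge_sum N A / ((real N)\<^sup>2 * t) - graphon_mass W\<bar>)
      \<le> ?E (\<lambda>A. \<bar>edge_sum N A - m\<bar> / ((real N)\<^sup>2 * t) + graphon_osc W N)"
  proof (rule integral_mono[OF integrable_random_graph integrable_random_graph])
    fix A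
    have "\<bar>edge_sum N A / ((real N)\<^sup>2 * t) - m / ((real N)\<^sup>2 * t)\<bar> = \<bar>edge_sum N A - m\<bar> / ((real N)\<^sup>2 * t)"
      using d0 by (simp add: abs_divide flip: diff_divide_distrib)
    moreover have "m / ((real N)\<^sup>2 * t) = (\<Sum>i=1..N. \<Sum>j=1..N. w i j) / (real N)\<^sup>2" using t by (simp add: m_def)
    moreover have "\<bar>(\<Sum>i=1..N. \<Sum>j=1..N. w i j) / (real N)\<^sup>2 - graphon_mass W\<bar> \<le> graphon_osc W N"
      using graphon_mean_grid_approx[OF graphon N] by (simp add: w_def)
    ultimately show "\<bar>edge_sum N A / ((real N)\<^sup>2 * t) - graphon_mass W\<bar>
        \<le> \<bar>edge_sum N A - m\<bar> / ((real N)\<^sup>2 * t) + graphon_osc W N"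
      by linarith
  qed
  also have "\<dots> = ?E (\<lambda>A. \<bar>edge_sum N A - m\<bar>) / ((real N)\<^sup>2 * t) + graphon_osc W N"
    by (simp add: integrable_random_graph)
  also have "\<dots> \<le> \<delta> / ((real N)\<^sup>2 * t) + graphon_osc W N"
    using dev d0 by (intro add_right_mono divide_right_mono) auto
  also have "\<delta> / ((real N)\<^sup>2 * t) = 2 / (real N * sqrt t)"
  proof -
    have "t = sqrt t * sqrt t" using t by simp
    then have "(real N)\<^sup>2 * t = real N * sqrt t * (real N * sqrt t)" by (simp add: power2_eq_square)
    then show ?thesis using N0 t by (simp add: \<delta>_def)
  qed
  finally show ?thesis .
qed

lemma expectation_loop_sum: "\<E> (random_graph N t W) (loop_sum N) \<le> real N * t"
proof -
  have "\<E> (random_graph N t W) (loop_sum N) = (\<Sum>i=1..N. t * w i i)"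
    unfolding loop_sum_def[abs_def] using expectation_entry by (simp add: integrable_random_graph)
  also have "\<dots> \<le> (\<Sum>i=1..N. t)"
    using w_bounds(2) t by (intro sum_mono) (simp add: mult_left_le)
  finally show ?thesis by simp
qed

lemma expectation_edge_sum: "\<E> (random_graph N t W) (edge_sum N) \<le> (real N)\<^sup>2 * t"
proof -
  have "\<E> (random_graph N t W) (edge_sum N) = (\<Sum>i=1..N. \<Sum>j=1..N. t * w i j)"
    unfolding edge_sum_def[abs_def] using expectation_entry by (simp add: integrable_random_graph)
  also have "\<dots> \<le> (\<Sum>i=1..N. \<Sum>j=1..N. t)"
    using w_bounds(2) t by (intro sum_mono) (simp add: mult_left_le)
  finally show ?thesis by (simp add: power2_eq_square)
qed

end


section \<open>The Ising measure of a fixed graph\<close>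

lemma spins_eq: "spins N = {1..N} \<rightarrow>\<^sub>E {-1, 1}"
  by (simp add: spins_def)

lemma set_pmf_ising_subset: "set_pmf (ising N t A \<beta>) \<subseteq> spins N"
  by (auto simp: set_pmf_iff pmf_ising ising_mass_def split: if_splits)

lemma finite_set_ising: "finite (set_pmf (ising N t A \<beta>))"
  using set_pmf_ising_subset finite_spins by (rule finite_subset)

lemma finite_set_ising_model: "finite (set_pmf (ising_model N t W \<beta>))"
  unfolding ising_model_def by (auto simp: finite_set_random_graph finite_set_ising)

lemma expectation_ising_model:
  fixes F :: "_ \<Rightarrow> 'b::{banach, second_countable_topology}"
  shows "\<E> (ising_model N t W \<beta>) F
    = \<E> (random_graph N t W) (\<lambda>A. \<E> (ising N t A \<beta>) (\<lambda>\<sigma>. F (A, \<sigma>)))"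
  unfolding ising_model_def
  by (subst pmf_expectation_bind[OF finite_set_random_graph])
    (auto simp: finite_set_ising integral_measure_pmf[OF finite_set_random_graph])

lemma expectation_ising_model_graph:
  fixes f :: "_ \<Rightarrow> real"
  shows "\<E> (ising_model N t W \<beta>) (\<lambda>(A, \<sigma>). f A) = \<E> (random_graph N t W) f"
  by (simp add: expectation_ising_model)

definition edge_energy :: "nat \<Rightarrow> (nat \<Rightarrow> nat \<Rightarrow> real) \<Rightarrow> (nat \<Rightarrow> real) \<Rightarrow> real" where
  "edge_energy N A \<sigma> = (\<Sum>(i, j)\<in>edges N A. \<sigma> i * \<sigma> j)"

lemma hamiltonian_eq:
  assumes A: "adjacency A" and \<sigma>: "\<sigma> \<in> spins N"
  shows "hamiltonian N t A \<sigma> = - (1 / (real N * t)) * (edge_energy N A \<sigma> + loop_sum N A / 2)"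
proof -
  have "(\<Sum>i=1..N. \<Sum>j=1..N. A i j * \<sigma> i * \<sigma> j)
      = (\<Sum>i=1..N. A i i * \<sigma> i * \<sigma> i) + 2 * (\<Sum>(i, j)\<in>vertex_pairs N. A i j * \<sigma> i * \<sigma> j)"
    using A unfolding adjacency_def by (intro sum_symmetric_matrix) auto
  also have "(\<Sum>i=1..N. A i i * \<sigma> i * \<sigma> i) = loop_sum N A"
    unfolding loop_sum_def
  proof (intro sum.cong refl)
    fix i assume "i \<in> {1..N}"
    then have "\<sigma> i \<in> {-1, 1}" using \<sigma> unfolding spins_eq by (rule PiE_mem[rotated])
    then show "A i i * \<sigma> i * \<sigma> i = A i i" by auto
  qed
  also have "(\<Sum>(i, j)\<in>vertex_pairs N. A i j * \<sigma> i * \<sigma> j) = edge_energy N A \<sigma>"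
    unfolding edge_energy_def sum_edges[OF A] by (intro sum.cong refl) (auto simp: mult.assoc)
  finally show ?thesis unfolding hamiltonian_def by (simp add: field_simps)
qed

text \<open>
  The self-loops multiply all weights by the same constant and cancel.
\<close>

lemma expectation_ising:
  fixes g :: "_ \<Rightarrow> complex"
  assumes A: "adjacency A"
  shows "\<E> (ising N t A \<beta>) g
    = spin_avg {1..N} (\<lambda>\<sigma>. exp (of_real (\<beta> / (real N * t) * edge_energy N A \<sigma>)) * g \<sigma>)
      / of_real (spin_avg {1..N} (\<lambda>\<sigma>. exp (\<beta> / (real N * t) * edge_energy N A \<sigma>)))"
proof -
  define b where "b = \<beta> / (real N * t)"
  define K where "K = exp (b * loop_sum N A / 2)"
  have e: "exp (- \<beta> * hamiltonian N t A \<sigma>) = K * exp (b * edge_energy N A \<sigma>)" if "\<sigma> \<in> spins N" for \<sigma>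
  proof -
    have "- \<beta> * (- (1 / (real N * t)) * (x + y / 2)) = b * y / 2 + b * x" for x y
      unfolding b_def by (simp add: algebra_simps add_divide_distrib)
    then show ?thesis unfolding hamiltonian_eq[OF A that] K_def by (simp only: exp_add)
  qed
  have K: "K > 0" by (simp add: K_def)
  define Z where "Z = (\<Sum>\<sigma>\<in>spins N. exp (b * edge_energy N A \<sigma>))"
  have pz: "2 ^ N * partition_function N t A \<beta> = K * Z"
  proof -
    have "(\<Sum>\<sigma>\<in>spins N. exp (- \<beta> * hamiltonian N t A \<sigma>)) = (\<Sum>\<sigma>\<in>spins N. K * exp (b * edge_energy N A \<sigma>))"
      by (intro sum.cong refl e)
    then show ?thesis unfolding partition_function_def Z_def sum_distrib_left by simp
  qed
  have "\<E> (ising N t A \<beta>) g = (\<Sum>\<sigma>\<in>spins N. pmf (ising N t A \<beta>) \<sigma> *\<^sub>R g \<sigma>)"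
    by (rule integral_measure_pmf[OF finite_spins]) (rule subsetD[OF set_pmf_ising_subset])
  also have "\<dots> = (\<Sum>\<sigma>\<in>spins N. exp (of_real (b * edge_energy N A \<sigma>)) * g \<sigma> / of_real Z)"
  proof (intro sum.cong refl)
    fix \<sigma> assume s: "\<sigma> \<in> spins N"
    have "pmf (ising N t A \<beta>) \<sigma> = exp (b * edge_energy N A \<sigma>) / Z"
      using K unfolding pmf_ising ising_mass_def pz e[OF s] if_P[OF s] by simp
    then show "pmf (ising N t A \<beta>) \<sigma> *\<^sub>R g \<sigma> = exp (of_real (b * edge_energy N A \<sigma>)) * g \<sigma> / of_real Z"
      unfolding exp_of_real by (simp add: scaleR_conv_of_real)
  qed
  finally show ?thesis
    unfolding spin_avg_def spins_eq[symmetric] b_def[symmetric] Z_def[symmetric]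
    by (simp flip: sum_divide_distrib)
qed

text \<open>
  This is the high-temperature expansion: \<open>exp (z x) = cosh z * (1 + x * tanh z)\<close> for a sign \<open>x\<close>.
\<close>

lemma spin_avg_exp_edge_energy:
  fixes z :: complex
  assumes "cosh z \<noteq> 0"
  shows "spin_avg {1..N} (\<lambda>\<sigma>. exp (z * of_real (edge_energy N A \<sigma>)))
    = cosh z ^ card (edges N A) * graph_poly N A (tanh z)"
  unfolding edge_poly_def spin_avg_mult_left[symmetric]
proof (rule spin_avg_cong)
  fix \<sigma> :: "nat \<Rightarrow> real" assume \<sigma>: "\<sigma> \<in> {1..N} \<rightarrow>\<^sub>E {-1, 1}"
  have sh: "sinh z = cosh z * tanh z" using assms by (simp add: tanh_def)
  have e: "exp (z * of_real (\<sigma> i * \<sigma> j)) = cosh z * (1 + tanh z * of_real (\<sigma> i * \<sigma> j))"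
    if "(i, j) \<in> edges N A" for i j
  proof -
    have "i \<in> {1..N}" "j \<in> {1..N}" using that edges_subset[of N A] by auto
    then have "\<sigma> i \<in> {-1, 1}" "\<sigma> j \<in> {-1, 1}" using PiE_mem[OF \<sigma>] by auto
    then have "\<sigma> i * \<sigma> j = 1 \<or> \<sigma> i * \<sigma> j = -1" by auto
    moreover have "exp (z * of_real x) = cosh z * (1 + tanh z * of_real x)" if "x = 1 \<or> x = -1" for x :: real
      using cosh_plus_sinh[of z] cosh_minus_sinh[of z] sh that by (auto simp: algebra_simps)
    ultimately show ?thesis by blast
  qed
  have "exp (z * of_real (edge_energy N A \<sigma>)) = (\<Prod>(i, j)\<in>edges N A. exp (z * of_real (\<sigma> i * \<sigma> j)))"
    unfolding edge_energy_def of_real_sum sum_distrib_left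
    by (subst exp_sum[OF finite_edges]) (simp add: case_prod_unfold)
  also have "\<dots> = (\<Prod>e\<in>edges N A. cosh z * (case e of (i, j) \<Rightarrow> 1 + tanh z * of_real (\<sigma> i * \<sigma> j)))"
    by (intro prod.cong refl) (use e in fastforce)
  also have "\<dots> = cosh z ^ card (edges N A) * (\<Prod>(i, j)\<in>edges N A. 1 + tanh z * of_real (\<sigma> i * \<sigma> j))"
    by (simp add: prod.distrib)
  finally show "exp (z * of_real (edge_energy N A \<sigma>))
      = cosh z ^ card (edges N A) * (\<Prod>(i, j)\<in>edges N A. 1 + tanh z * of_real (\<sigma> i * \<sigma> j))" .
qed

lemma conditional_char:
  assumes A: "adjacency A" and b: "b = \<beta> / (real N * t)" and u: "\<bar>u\<bar> \<le> 1"
  shows "\<E> (ising N t A \<beta>) (\<lambda>\<sigma>. exp (\<i> * of_real (u * (edge_energy N A \<sigma> - b * card (edges N A)))))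
    = edge_factor b u ^ card (edges N A)
      * (graph_poly N A (tanh (of_real b + \<i> * of_real u)) / of_real (graph_poly N A (tanh b)))"
proof -
  define m where "m = card (edges N A)"
  define z where "z = complex_of_real b + \<i> * of_real u"
  have cz: "cosh z \<noteq> 0" unfolding z_def by (rule norm_tanh_diff_le(1)[OF u])
  have cb: "cosh b \<noteq> 0" "cosh (complex_of_real b) = of_real (cosh b)" "tanh (complex_of_real b) = of_real (tanh b)"
  proof -
    show c: "cosh b \<noteq> 0" by simp
    show c': "cosh (complex_of_real b) = of_real (cosh b)"
      by (simp add: complex_eq_iff cosh_def Re_exp Im_exp)
    have "sinh (complex_of_real b) = of_real (sinh b)"
      by (simp add: complex_eq_iff sinh_def Re_exp Im_exp)
    then show "tanh (complex_of_real b) = of_real (tanh b)" using c' by (simp add: tanh_def)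
  qed
  have "spin_avg {1..N} (\<lambda>\<sigma>. exp (complex_of_real (b * edge_energy N A \<sigma>))
          * exp (\<i> * of_real (u * (edge_energy N A \<sigma> - b * m))))
      = spin_avg {1..N} (\<lambda>\<sigma>. exp (- (\<i> * of_real (u * b))) ^ m * exp (z * of_real (edge_energy N A \<sigma>)))"
    by (intro spin_avg_cong) (simp add: z_def algebra_simps flip: exp_add exp_of_nat_mult)
  also have "\<dots> = exp (- (\<i> * of_real (u * b))) ^ m * (cosh z ^ m * graph_poly N A (tanh z))"
    unfolding spin_avg_mult_left spin_avg_exp_edge_energy[OF cz] m_def ..
  also have "cosh z ^ m = of_real (cosh b) ^ m * (complex_of_real (cos u) + \<i> * of_real (tanh b * sin u)) ^ m"
    unfolding z_def cosh_Complex power_mult_distrib ..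
  finally have num: "spin_avg {1..N} (\<lambda>\<sigma>. exp (complex_of_real (b * edge_energy N A \<sigma>))
          * exp (\<i> * of_real (u * (edge_energy N A \<sigma> - b * m))))
      = of_real (cosh b) ^ m * (edge_factor b u ^ m * graph_poly N A (tanh z))"
    by (simp add: edge_factor_def power_mult_distrib)
  have "complex_of_real (spin_avg {1..N} (\<lambda>\<sigma>. exp (b * edge_energy N A \<sigma>)))
      = spin_avg {1..N} (\<lambda>\<sigma>. exp (complex_of_real b * of_real (edge_energy N A \<sigma>)))"
    unfolding spin_avg_of_real[symmetric] by (simp add: exp_of_real[symmetric])
  also have "\<dots> = of_real (cosh b) ^ m * of_real (graph_poly N A (tanh b))"
    using spin_avg_exp_edge_energy[of "complex_of_real b" N A] cb
    by (simp add: m_def edge_poly_of_real)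
  finally have den: "complex_of_real (spin_avg {1..N} (\<lambda>\<sigma>. exp (b * edge_energy N A \<sigma>)))
      = of_real (cosh b) ^ m * of_real (graph_poly N A (tanh b))" .
  show ?thesis
    unfolding expectation_ising[OF A] b[symmetric] m_def[symmetric] num den z_def[symmetric]
    using cb(1) by simp
qed

text \<open>
  The first error term comes from the high-temperature polynomial, whose two arguments both lie in the
  disc of radius \<open>b + 2 * \<bar>u\<bar>\<close>, the second one from replacing the factor of each edge by a Gaussian.
\<close>

lemma conditional_char_gauss:
  assumes A: "adjacency A" and b_def: "b = \<beta> / (real N * t)" and u: "\<bar>u\<bar> \<le> 1" "u = \<kappa> * b"
    and b: "0 \<le> b" "b \<le> 1" and \<kappa>: "\<bar>\<kappa>\<bar> \<le> 1" and r': "b + 2 * \<bar>u\<bar> < r'"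
  shows "norm (\<E> (ising N t A \<beta>)
        (\<lambda>\<sigma>. exp (\<i> * of_real (u * (edge_energy N A \<sigma> - b * card (edges N A)))))
      - of_real (exp (- (real (card (edges N A)) * u\<^sup>2 / 2))))
    \<le> 2 * \<bar>u\<bar> / (r' - (b + 2 * \<bar>u\<bar>)) * graph_poly N A r'
      + real (card (edges N A)) * (8 * \<bar>\<kappa>\<bar> * b ^ 4)"
proof -
  define m where "m = card (edges N A)"
  define z where "z = complex_of_real b + \<i> * of_real u"
  define p where "p = (\<lambda>x :: complex. graph_poly N A x)"
  define p0 where "p0 = graph_poly N A (tanh b)"
  define r where "r = b + 2 * \<bar>u\<bar>"
  define f where "f = edge_factor b u"
  define g where "g = complex_of_real (exp (- u\<^sup>2 / 2))"
  have p01: "1 \<le> p0" unfolding p0_def by (rule edge_poly_ge_1) (use b edges_subset in auto)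
  have pp0: "p (of_real (tanh b)) = of_real p0" unfolding p_def p0_def by (rule edge_poly_of_real)
  have dt: "norm (tanh z - of_real (tanh b)) \<le> 2 * \<bar>u\<bar>" unfolding z_def by (rule norm_tanh_diff_le(2)[OF u(1)])
  have tb: "0 \<le> tanh b" "tanh b \<le> b" using b tanh_le_self by auto
  have pd: "norm (p (tanh z) - of_real p0) \<le> 2 * \<bar>u\<bar> / (r' - r) * graph_poly N A r'"
  proof -
    have "norm (tanh z) \<le> norm (complex_of_real (tanh b)) + norm (tanh z - of_real (tanh b))"
      by (metis add.commute diff_add_cancel norm_triangle_ineq)
    then have nz: "norm (tanh z) \<le> r" using dt tb by (simp add: r_def)
    have "norm (p (tanh z) - p (of_real (tanh b)))
        \<le> norm (tanh z - of_real (tanh b)) / (r' - r) * graph_poly N A r'"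
      unfolding p_def using nz tb b r' edges_subset
      by (intro edge_poly_diff_le) (auto simp: r_def)
    also have "\<dots> \<le> 2 * \<bar>u\<bar> / (r' - r) * graph_poly N A r'"
    proof (intro mult_right_mono divide_right_mono dt)
      show "0 \<le> graph_poly N A r'"
      proof -
        have "0 \<le> r'" using r' b by linarith
        then have "1 \<le> graph_poly N A r'" by (intro edge_poly_ge_1 edges_subset) auto
        then show ?thesis by linarith
      qed
    qed (use r' in \<open>simp add: r_def\<close>)
    finally show ?thesis unfolding pp0 .
  qed
  have f1: "norm f \<le> 1" unfolding f_def by (rule norm_edge_factor_le_1)
  have g1: "norm g \<le> 1" unfolding g_def by simp
  have gm: "g ^ m = of_real (exp (- (real m * u\<^sup>2 / 2)))"
    unfolding g_def by (simp add: exp_of_nat_mult[symmetric] flip: of_real_power)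
  have q: "norm (p (tanh z) / of_real p0 - 1) \<le> norm (p (tanh z) - of_real p0)"
  proof -
    have "p (tanh z) / of_real p0 - 1 = (p (tanh z) - of_real p0) / of_real p0"
      using p01 by (simp add: diff_divide_distrib)
    then have "norm (p (tanh z) / of_real p0 - 1) = norm (p (tanh z) - of_real p0) / p0"
      using p01 by (simp add: norm_divide)
    also have "\<dots> \<le> norm (p (tanh z) - of_real p0) / 1"
      using p01 by (intro divide_left_mono) auto
    finally show ?thesis by simp
  qed
  have "f ^ m * (p (tanh z) / of_real p0) - g ^ m = f ^ m * (p (tanh z) / of_real p0 - 1) + (f ^ m - g ^ m)"
    by (simp add: algebra_simps)
  then have "norm (f ^ m * (p (tanh z) / of_real p0) - g ^ m)
      \<le> norm (f ^ m) * norm (p (tanh z) / of_real p0 - 1) + norm (f ^ m - g ^ m)"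
    by (metis norm_mult norm_triangle_ineq)
  also have "\<dots> \<le> 1 * norm (p (tanh z) - of_real p0) + real m * norm (f - g)"
    using f1 g1 q by (intro add_mono mult_mono norm_power_diff) (auto simp: norm_power power_le_one)
  also have "\<dots> \<le> 2 * \<bar>u\<bar> / (r' - r) * graph_poly N A r' + real m * (8 * \<bar>\<kappa>\<bar> * b ^ 4)"
  proof (intro add_mono mult_left_mono)
    show "norm (f - g) \<le> 8 * \<bar>\<kappa>\<bar> * b ^ 4"
      using norm_edge_factor_minus_gauss_le[OF b \<kappa>] unfolding f_def g_def u(2)
      by (simp add: exp_of_real[symmetric])
  qed (use pd in simp_all)
  finally show ?thesis
    unfolding conditional_char[OF A b_def u(1)] unfolding m_def[symmetric] gm[symmetric]
    by (simp add: f_def p_def p0_def z_def r_def)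
qed

text \<open>
  The scaling is the one of \<open>\<surd>t * H\<close>, and the centring is the leading order of the mean of the energy:
  each edge \<open>{i, j}\<close> gives \<open>\<sigma>\<^sub>i \<sigma>\<^sub>j\<close> the mean \<open>tanh b\<close>, about \<open>b = \<beta> / (N t)\<close>.
\<close>

definition centred_energy :: "nat \<Rightarrow> real \<Rightarrow> real \<Rightarrow> (nat \<Rightarrow> nat \<Rightarrow> real) \<Rightarrow> (nat \<Rightarrow> real) \<Rightarrow> real" where
  "centred_energy N t \<beta> A \<sigma>
    = sqrt t / (real N * t) * (edge_energy N A \<sigma> - \<beta> / (real N * t) * card (edges N A))"

context sparse_graphon_sample
begin

text \<open>
  The three error terms come from the high-temperature polynomial, from the Gaussian approximation of
  the edge factors, and from the fluctuation of the number of edges. The denominator of the second one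
  is where the lower bound on the sparsity enters.
\<close>

lemma char_centred_energy:
  assumes pos: "0 < graphon_op_norm W" and \<epsilon>: "0 < \<epsilon>" and \<beta>: "0 < \<beta>"
    and gap: "\<beta>' * (graphon_op_norm W + sqrt (graphon_osc W N)) \<le> 1 - \<epsilon>"
    and \<beta>': "\<beta> + 2 * \<bar>s\<bar> * sqrt t < \<beta>'" "\<beta>' \<le> real N * t" and s: "\<bar>s\<bar> * sqrt t \<le> \<beta>"
  shows "norm (\<E> (ising_model N t W \<beta>) (\<lambda>(A, \<sigma>). exp (\<i> * of_real (s * centred_energy N t \<beta> A \<sigma>)))
      - of_real (exp (- (s\<^sup>2 * graphon_mass W / 4))))
    \<le> 2 * \<bar>s\<bar> * sqrt t / (\<beta>' - (\<beta> + 2 * \<bar>s\<bar> * sqrt t)) * exp (\<beta>'\<^sup>2 / (4 * \<epsilon>))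
      + 4 * \<bar>s\<bar> * sqrt t * \<beta> ^ 3 / ((real N)\<^sup>2 * t ^ 3)
      + s\<^sup>2 / 4 * (2 / (real N * sqrt t) + graphon_osc W N + 1 / real N)"
proof -
  let ?E = "\<E> (random_graph N t W)"
  let ?err = "\<lambda>A. s\<^sup>2 / 4 * \<bar>edge_sum N A / ((real N)\<^sup>2 * t) - graphon_mass W\<bar> + s\<^sup>2 / 4 * (loop_sum N A / ((real N)\<^sup>2 * t))"
  define n where "n = real N * t"
  define b where "b = \<beta> / n"
  define u where "u = s * sqrt t / n"
  define \<kappa> where "\<kappa> = s * sqrt t / \<beta>"
  define r' where "r' = \<beta>' / n"
  define K where "K = 2 * \<bar>s\<bar> * sqrt t / (\<beta>' - (\<beta> + 2 * \<bar>s\<bar> * sqrt t))"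
  define L where "L = 8 * \<bar>\<kappa>\<bar> * b ^ 4"
  have N0: "0 < real N" using N by simp
  have n0: "0 < n" unfolding n_def using N0 t by simp
  have st: "0 \<le> \<bar>s\<bar> * sqrt t" using t by simp
  have bn: "\<beta> \<le> n" using \<beta>' st unfolding n_def by linarith
  have au: "\<bar>u\<bar> = \<bar>s\<bar> * sqrt t / n" using n0 t by (simp add: u_def abs_mult)
  have u1: "\<bar>u\<bar> \<le> 1" unfolding au using s bn n0 by (simp add: divide_le_eq)
  have b0: "0 \<le> b" "b \<le> 1" using \<beta> n0 bn by (auto simp: b_def)
  have uk: "u = \<kappa> * b" using \<beta> by (simp add: u_def \<kappa>_def b_def)
  have ak: "\<bar>\<kappa>\<bar> = \<bar>s\<bar> * sqrt t / \<beta>" using \<beta> t by (simp add: \<kappa>_def abs_mult)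
  have k1: "\<bar>\<kappa>\<bar> \<le> 1" unfolding ak using s \<beta> by (simp add: divide_le_eq)
  have rr: "r' - (b + 2 * \<bar>u\<bar>) = (\<beta>' - (\<beta> + 2 * \<bar>s\<bar> * sqrt t)) / n"
    by (simp add: r'_def b_def au diff_divide_distrib add_divide_distrib)
  have r'1: "b + 2 * \<bar>u\<bar> < r'"
  proof -
    have "0 < r' - (b + 2 * \<bar>u\<bar>)" unfolding rr using \<beta>' n0 by simp
    then show ?thesis by simp
  qed
  have Kr: "2 * \<bar>u\<bar> / (r' - (b + 2 * \<bar>u\<bar>)) = K"
  proof -
    have "2 * \<bar>u\<bar> / (r' - (b + 2 * \<bar>u\<bar>)) = 2 * \<bar>u\<bar> / ((\<beta>' - (\<beta> + 2 * \<bar>s\<bar> * sqrt t)) / n)"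
      by (simp only: rr)
    also have "\<dots> = K" unfolding K_def au using n0 by simp
    finally show ?thesis .
  qed
  have K0: "0 \<le> K" unfolding K_def using \<beta>' st by simp
  have r'2: "0 \<le> r'" "r' \<le> 1"
  proof -
    show "0 \<le> r'" using r'1 b0 by linarith
    show "r' \<le> 1" using \<beta>'(2) n0 by (simp add: r'_def n_def)
  qed
  have L0: "0 \<le> L" unfolding L_def using b0 by simp
  define \<phi> where "\<phi> A = \<E> (ising N t A \<beta>) (\<lambda>\<sigma>. exp (\<i> * of_real (s * centred_energy N t \<beta> A \<sigma>)))" for A
  define c where "c = complex_of_real (exp (- (s\<^sup>2 * graphon_mass W / 4)))"
  have "norm (\<phi> A - c) \<le> K * graph_poly N A r' + L * edge_sum N A / 2
      + ?err A"
    if A: "adjacency A" for A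
  proof -
    define m where "m = real (card (edges N A))"
    have l0: "0 \<le> loop_sum N A" by (rule loop_sum_nonneg[OF A])
    have S: "edge_sum N A = loop_sum N A + 2 * m" unfolding m_def by (rule edge_sum_eq[OF A])
    have arg: "s * centred_energy N t \<beta> A \<sigma> = u * (edge_energy N A \<sigma> - b * card (edges N A))" for \<sigma>
      by (simp add: centred_energy_def u_def b_def n_def)
    have 1: "norm (\<phi> A - of_real (exp (- (m * u\<^sup>2 / 2)))) \<le> K * graph_poly N A r' + m * L"
      unfolding \<phi>_def arg m_def Kr[symmetric] L_def
      by (rule conditional_char_gauss[OF A _ u1 uk b0 k1 r'1]) (simp add: b_def n_def)
    have uu: "u\<^sup>2 = s\<^sup>2 / ((real N)\<^sup>2 * t)"
    proof -
      have "u\<^sup>2 = s\<^sup>2 * t / ((real N)\<^sup>2 * t\<^sup>2)"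
        using t by (simp add: u_def n_def power_divide power_mult_distrib)
      then show ?thesis using t by (simp add: power2_eq_square)
    qed
    have "norm (complex_of_real (exp (- (m * u\<^sup>2 / 2))) - c) = \<bar>exp (- (m * u\<^sup>2 / 2)) - exp (- (s\<^sup>2 * graphon_mass W / 4))\<bar>"
      unfolding c_def of_real_diff[symmetric] norm_of_real ..
    also have "\<dots> \<le> \<bar>m * u\<^sup>2 / 2 - s\<^sup>2 * graphon_mass W / 4\<bar>"
    proof -
      have ee: "exp (- x) - exp (- y) \<le> y - x" if "0 \<le> x" "x \<le> y" for x y :: real
      proof -
        have "exp (- x) - exp (- y) = exp (- x) * (1 - exp (- (y - x)))"
          by (simp add: algebra_simps flip: exp_add)
        also have "\<dots> \<le> 1 * (y - x)"
        proof (rule mult_mono)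
          show "1 - exp (- (y - x)) \<le> y - x" using exp_ge_add_one_self[of "- (y - x)"] by linarith
        qed (use that in auto)
        finally show ?thesis by simp
      qed
      have x0: "0 \<le> m * u\<^sup>2 / 2" by (simp add: m_def)
      have y0: "0 \<le> s\<^sup>2 * graphon_mass W / 4"
      proof -
        have "0 \<le> graphon_mass W" unfolding graphon_mass_def
          using graphon by (intro Bochner_Integration.integral_nonneg) (auto simp: graphon_def)
        then show ?thesis by simp
      qed
      have "\<bar>exp (- x) - exp (- y)\<bar> \<le> \<bar>x - y\<bar>" if "0 \<le> x" "0 \<le> y" for x y :: real
        using that ee[of x y] ee[of y x] by (cases "x \<le> y") auto
      then show ?thesis using x0 y0 .
    qed
    also have "m * u\<^sup>2 / 2 - s\<^sup>2 * graphon_mass W / 4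
        = s\<^sup>2 / 4 * (edge_sum N A / ((real N)\<^sup>2 * t) - graphon_mass W) - s\<^sup>2 / 4 * (loop_sum N A / ((real N)\<^sup>2 * t))"
      unfolding S uu by (simp add: add_divide_distrib algebra_simps)
    also have "\<bar>\<dots>\<bar> \<le> ?err A"
    proof -
      have "\<bar>x - y\<bar> \<le> \<bar>x\<bar> + y" if "0 \<le> y" for x y :: real using that by linarith
      moreover have "0 \<le> s\<^sup>2 / 4 * (loop_sum N A / ((real N)\<^sup>2 * t))" using l0 t by simp
      moreover have "\<bar>s\<^sup>2 / 4 * x\<bar> = s\<^sup>2 / 4 * \<bar>x\<bar>" for x by (simp add: abs_mult)
      ultimately show ?thesis by metis
    qed
    finally have 2: "norm (complex_of_real (exp (- (m * u\<^sup>2 / 2))) - c)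
      \<le> ?err A" .
    have 3: "m * L \<le> L * edge_sum N A / 2"
    proof -
      have "m \<le> edge_sum N A / 2" using l0 unfolding S by simp
      then have "m * L \<le> edge_sum N A / 2 * L" using L0 by (rule mult_right_mono)
      then show ?thesis by (simp add: mult.commute)
    qed
    show ?thesis
      using norm_triangle_ineq[of "\<phi> A - of_real (exp (- (m * u\<^sup>2 / 2)))" "of_real (exp (- (m * u\<^sup>2 / 2))) - c"] 1 2 3
      by simp
  qed
  then have ptw: "norm (\<phi> A - c) \<le> K * graph_poly N A r' + L * edge_sum N A / 2
      + ?err A"
    if "A \<in> set_pmf (random_graph N t W)" for A
    using random_graph_adjacency[OF that] by blast
  have "\<E> (ising_model N t W \<beta>) (\<lambda>(A, \<sigma>). exp (\<i> * of_real (s * centred_energy N t \<beta> A \<sigma>))) - c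
      = ?E (\<lambda>A. \<phi> A - c)"
    unfolding expectation_ising_model by (simp add: \<phi>_def integrable_random_graph)
  also have "norm \<dots> \<le> ?E (\<lambda>A. norm (\<phi> A - c))"
    by (rule integral_norm_bound)
  also have "\<dots> \<le> ?E (\<lambda>A. K * graph_poly N A r' + L * edge_sum N A / 2
      + ?err A)"
    by (intro integral_mono_AE integrable_random_graph AE_pmfI ptw)
  also have "\<dots> = K * ?E (\<lambda>A. graph_poly N A r') + L * ?E (edge_sum N) / 2
      + s\<^sup>2 / 4 * ?E (\<lambda>A. \<bar>edge_sum N A / ((real N)\<^sup>2 * t) - graphon_mass W\<bar>)
      + s\<^sup>2 / 4 * (?E (loop_sum N) / ((real N)\<^sup>2 * t))"
    by (simp add: integrable_random_graph)
  also have "\<dots> \<le> K * exp (\<beta>'\<^sup>2 / (4 * \<epsilon>)) + L * ((real N)\<^sup>2 * t) / 2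
      + s\<^sup>2 / 4 * (2 / (real N * sqrt t) + graphon_osc W N) + s\<^sup>2 / 4 * (real N * t / ((real N)\<^sup>2 * t))"
  proof (intro add_mono mult_left_mono divide_right_mono K0 L0 expectation_edge_sum
      expectation_edge_density_deviation expectation_loop_sum)
    have "r' * t * real N = \<beta>'" using n0 N0 t by (simp add: r'_def n_def)
    then show "?E (\<lambda>A. graph_poly N A r') \<le> exp (\<beta>'\<^sup>2 / (4 * \<epsilon>))"
      using expectation_edge_poly_le[OF pos r'2 \<epsilon>] gap by simp
  qed (use t in simp_all)
  also have "\<dots> = K * exp (\<beta>'\<^sup>2 / (4 * \<epsilon>)) + 4 * \<bar>s\<bar> * sqrt t * \<beta> ^ 3 / ((real N)\<^sup>2 * t ^ 3)
      + s\<^sup>2 / 4 * (2 / (real N * sqrt t) + graphon_osc W N + 1 / real N)"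
  proof -
    have "L * ((real N)\<^sup>2 * t) / 2 = 4 * \<bar>s\<bar> * sqrt t * \<beta> ^ 3 / ((real N)\<^sup>2 * t ^ 3)"
    proof -
      have "b ^ 4 * ((real N)\<^sup>2 * t) = \<beta> ^ 4 / ((real N)\<^sup>2 * t ^ 3)"
        unfolding b_def n_def using N0 t
        by (simp add: power_divide power_mult_distrib divide_simps) (simp add: power_numeral_reduce)
      then have "L * ((real N)\<^sup>2 * t) / 2 = 8 * (\<bar>s\<bar> * sqrt t / \<beta>) * (\<beta> ^ 4 / ((real N)\<^sup>2 * t ^ 3)) / 2"
        unfolding L_def ak by (simp only: mult.assoc)
      also have "\<beta> ^ 4 = \<beta> * \<beta> ^ 3" by (simp add: power_numeral_reduce)
      finally show ?thesis using \<beta> by (simp add: ac_simps)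
    qed
    moreover have "real N * t / ((real N)\<^sup>2 * t) = 1 / real N" using t N0 by (simp add: power2_eq_square)
    ultimately show ?thesis by (simp add: algebra_simps)
  qed
  finally show ?thesis unfolding c_def K_def .
qed

end


section \<open>Normal limits of variables on finitely supported distributions\<close>

abbreviation std_normal_cdf :: "real \<Rightarrow> real" where
  "std_normal_cdf \<equiv> cdf std_normal_distribution"

lemma isCont_std_normal_cdf: "isCont std_normal_cdf x"
proof -
  interpret real_distribution std_normal_distribution by (rule real_dist_normal_dist)
  have "emeasure std_normal_distribution {x} = 0"
    by (subst emeasure_density) (auto simp: nn_integral_0_iff_AE intro!: AE_mp[OF AE_lborel_singleton[of x]])
  then show ?thesis unfolding isCont_cdf by (simp add: measure_def)
qed

text \<open>
  The infimum is attained since the distribution function is continuous, and by the intermediate value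
  theorem the value at the infimum is exactly \<open>1 - a\<close>.
\<close>

lemma std_normal_cdf_normal_z:
  assumes "0 < a" "a < 1"
  shows "std_normal_cdf (normal_z a) = 1 - a"
proof -
  interpret real_distribution std_normal_distribution by (rule real_dist_normal_dist)
  define S where "S = {x. 1 - a \<le> std_normal_cdf x}"
  have cont: "continuous_on UNIV std_normal_cdf"
    using isCont_std_normal_cdf continuous_at_imp_continuous_on by blast
  obtain hi where hi: "1 - a < std_normal_cdf hi"
    using order_tendstoD(1)[OF cdf_lim_at_top_prob, of "1 - a"] assms by (auto simp: eventually_at_top_linorder)
  obtain lo where lo: "std_normal_cdf lo < 1 - a"
    using order_tendstoD(2)[OF cdf_lim_at_bot, of "1 - a"] assms by (auto simp: eventually_at_bot_linorder)
  have lohi: "lo \<le> hi" using hi lo cdf_nondecreasing[of hi lo] by linarith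
  obtain y where y: "std_normal_cdf y = 1 - a"
    using IVT'[of std_normal_cdf lo "1 - a" hi] hi lo lohi continuous_on_subset[OF cont] by auto
  have bdd: "bdd_below S"
  proof (rule bdd_belowI)
    fix x assume "x \<in> S"
    then show "lo \<le> x" using lo cdf_nondecreasing[of x lo] unfolding S_def by (cases "lo \<le> x") auto
  qed
  have "closed S" unfolding S_def by (intro closed_Collect_le continuous_on_const cont)
  have yS: "y \<in> S" unfolding S_def using y by simp
  then have "S \<noteq> {}" by blast
  then have "Inf S \<in> S" using bdd \<open>closed S\<close> by (rule closed_contains_Inf)
  moreover have "Inf S \<le> y" using yS bdd by (rule cInf_lower)
  ultimately have "1 - a \<le> std_normal_cdf (Inf S)" "std_normal_cdf (Inf S) \<le> 1 - a"
    using cdf_nondecreasing y unfolding S_def by force+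
  then show ?thesis by (simp add: normal_z_def S_def)
qed

lemma norm_iexp_diff_le: "norm (iexp x - iexp y) \<le> \<bar>x - y\<bar>"
proof -
  have "iexp x - iexp y = iexp y * (iexp (x - y) - 1)"
    by (simp add: algebra_simps flip: exp_add)
  then have "norm (iexp x - iexp y) = norm (iexp (x - y) - 1)" by (simp add: norm_mult)
  also have "\<dots> \<le> \<bar>x - y\<bar>" using iexp_approx1[of "x - y" 0] by simp
  finally show ?thesis .
qed

locale pmf_sequence =
  fixes P :: "nat \<Rightarrow> 'a pmf"
  assumes finite_support: "finite (set_pmf (P n))"
begin

lemma integrable_at: "integrable (measure_pmf (P n)) f"
  for f :: "'a \<Rightarrow> 'b::{banach, second_countable_topology}"
  by (rule integrable_measure_pmf_finite[OF finite_support])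

definition char_to_normal :: "(nat \<Rightarrow> 'a \<Rightarrow> real) \<Rightarrow> bool" where
  "char_to_normal X \<longleftrightarrow> (\<forall>s. (\<lambda>n. \<E> (P n) (\<lambda>\<omega>. iexp (s * X n \<omega>)))
     \<longlonglongrightarrow> of_real (exp (- s\<^sup>2 / 2)))"

lemma prob_le_tendsto:
  assumes "char_to_normal X"
  shows "(\<lambda>n. \<P> (P n) {\<omega>. X n \<omega> \<le> x}) \<longlonglongrightarrow> std_normal_cdf x"
proof -
  define M where "M n = distr (measure_pmf (P n)) borel (X n)" for n
  have "weak_conv_m M std_normal_distribution"
  proof (rule levy_continuity)
    show "real_distribution (M n)" for n unfolding M_def
      by (rule prob_space.real_distribution_distr[OF prob_space_measure_pmf]) simp
    show "real_distribution std_normal_distribution" by (rule real_dist_normal_dist)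
    fix s
    have "char (M n) s = \<E> (P n) (\<lambda>\<omega>. iexp (s * X n \<omega>))" for n
      unfolding char_def M_def by (subst integral_distr) auto
    then show "(\<lambda>n. char (M n) s) \<longlonglongrightarrow> char std_normal_distribution s"
      using assms unfolding char_to_normal_def char_std_normal_distribution by simp
  qed
  then have "(\<lambda>n. cdf (M n) x) \<longlonglongrightarrow> std_normal_cdf x"
    using isCont_std_normal_cdf unfolding weak_conv_m_def weak_conv_def by blast
  moreover have "cdf (M n) x = \<P> (P n) {\<omega>. X n \<omega> \<le> x}" for n
    unfolding cdf_def2 M_def by (subst measure_distr) (auto simp: vimage_def)
  ultimately show ?thesis by simp
qed

text \<open>
  Serves in place of Slutsky's theorem, both for the self-loops and for the random normalisation.
\<close>

lemma char_to_normal_L1_perturbation: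
  assumes X: "char_to_normal X"
    and Y: "(\<lambda>n. \<E> (P n) (\<lambda>\<omega>. \<bar>Y n \<omega> - X n \<omega>\<bar>)) \<longlonglongrightarrow> 0"
  shows "char_to_normal Y"
  unfolding char_to_normal_def
proof
  fix s
  let ?E = "\<lambda>n. \<E> (P n)"
  have "norm (?E n (\<lambda>\<omega>. iexp (s * Y n \<omega>)) - ?E n (\<lambda>\<omega>. iexp (s * X n \<omega>))) \<le> \<bar>s\<bar> * ?E n (\<lambda>\<omega>. \<bar>Y n \<omega> - X n \<omega>\<bar>)" for n
  proof -
    have "norm (?E n (\<lambda>\<omega>. iexp (s * Y n \<omega>)) - ?E n (\<lambda>\<omega>. iexp (s * X n \<omega>)))
        = norm (?E n (\<lambda>\<omega>. iexp (s * Y n \<omega>) - iexp (s * X n \<omega>)))"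
      by (rule arg_cong[where f = norm], rule Bochner_Integration.integral_diff[symmetric]) (rule integrable_at)+
    also have "\<dots> \<le> ?E n (\<lambda>\<omega>. norm (iexp (s * Y n \<omega>) - iexp (s * X n \<omega>)))"
      by (rule integral_norm_bound)
    also have "\<dots> \<le> ?E n (\<lambda>\<omega>. \<bar>s\<bar> * \<bar>Y n \<omega> - X n \<omega>\<bar>)"
    proof (rule integral_mono[OF integrable_at integrable_at])
      fix \<omega>
      have "norm (iexp (s * Y n \<omega>) - iexp (s * X n \<omega>)) \<le> \<bar>s * Y n \<omega> - s * X n \<omega>\<bar>"
        by (rule norm_iexp_diff_le)
      then show "norm (iexp (s * Y n \<omega>) - iexp (s * X n \<omega>)) \<le> \<bar>s\<bar> * \<bar>Y n \<omega> - X n \<omega>\<bar>"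
        by (simp only: right_diff_distrib[symmetric] abs_mult)
    qed
    also have "\<dots> = \<bar>s\<bar> * ?E n (\<lambda>\<omega>. \<bar>Y n \<omega> - X n \<omega>\<bar>)" by (rule integral_mult_right_zero)
    finally show ?thesis .
  qed
  then have "\<forall>\<^sub>F n in sequentially. norm (?E n (\<lambda>\<omega>. iexp (s * Y n \<omega>)) - ?E n (\<lambda>\<omega>. iexp (s * X n \<omega>)))
      \<le> \<bar>s\<bar> * ?E n (\<lambda>\<omega>. \<bar>Y n \<omega> - X n \<omega>\<bar>)"
    by (rule always_eventually[OF allI])
  then have "(\<lambda>n. ?E n (\<lambda>\<omega>. iexp (s * Y n \<omega>)) - ?E n (\<lambda>\<omega>. iexp (s * X n \<omega>))) \<longlonglongrightarrow> 0"
    by (rule Lim_null_comparison[OF _ tendsto_mult_right_zero[OF Y]])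
  from tendsto_add[OF this X[unfolded char_to_normal_def, rule_format, of s]]
  show "(\<lambda>n. ?E n (\<lambda>\<omega>. iexp (s * Y n \<omega>))) \<longlonglongrightarrow> of_real (exp (- s\<^sup>2 / 2))"
    by (simp only: diff_add_cancel add_0_left)
qed

lemma char_to_normal_uminus:
  assumes "char_to_normal X"
  shows "char_to_normal (\<lambda>n \<omega>. - X n \<omega>)"
  unfolding char_to_normal_def
proof
  fix s
  show "(\<lambda>n. \<E> (P n) (\<lambda>\<omega>. iexp (s * - X n \<omega>))) \<longlonglongrightarrow> of_real (exp (- s\<^sup>2 / 2))"
    using assms[unfolded char_to_normal_def, rule_format, of "- s"]
    by (simp only: minus_mult_left[symmetric] minus_mult_right power2_minus)
qed

text \<open>
  A sequence with a normal limit is tight, so that thresholds tending to infinity in probability are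
  not reached, except with vanishing probability.
\<close>

lemma prob_le_diverging_threshold:
  assumes X: "char_to_normal X"
    and R: "\<And>K. (\<lambda>n. \<P> (P n) {\<omega>. R n \<omega> < K}) \<longlonglongrightarrow> 0"
  shows "(\<lambda>n. \<P> (P n) {\<omega>. X n \<omega> \<le> R n \<omega>}) \<longlonglongrightarrow> 1"
proof (rule order_tendstoI)
  fix a :: real assume a: "a < 1"
  interpret real_distribution std_normal_distribution by (rule real_dist_normal_dist)
  define b where "b = (1 + a) / 2"
  have b: "a = 2 * b - 1" "b < 1" using a by (simp_all add: b_def add_divide_distrib)
  obtain K where K: "b < std_normal_cdf K"
    using order_tendstoD(1)[OF cdf_lim_at_top_prob b(2)] by (auto simp: eventually_at_top_linorder)
  have "\<forall>\<^sub>F n in sequentially. b < \<P> (P n) {\<omega>. X n \<omega> \<le> K}"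
    by (rule order_tendstoD(1)[OF prob_le_tendsto[OF X] K])
  moreover have "\<forall>\<^sub>F n in sequentially. \<P> (P n) {\<omega>. R n \<omega> < K} < 1 - b"
    using b(2) by (intro order_tendstoD(2)[OF R]) simp
  ultimately show "\<forall>\<^sub>F n in sequentially. a < \<P> (P n) {\<omega>. X n \<omega> \<le> R n \<omega>}"
  proof eventually_elim
    case (elim n)
    have "\<P> (P n) {\<omega>. X n \<omega> \<le> K}
        \<le> \<P> (P n) ({\<omega>. X n \<omega> \<le> R n \<omega>} \<union> {\<omega>. R n \<omega> < K})"
      by (intro measure_pmf.finite_measure_mono) auto
    also have "\<dots> \<le> \<P> (P n) {\<omega>. X n \<omega> \<le> R n \<omega>} + \<P> (P n) {\<omega>. R n \<omega> < K}"
      by (intro measure_Un_le) auto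
    finally show ?case using elim b(1) by linarith
  qed
next
  fix a :: real assume "1 < a"
  then show "\<forall>\<^sub>F n in sequentially. \<P> (P n) {\<omega>. X n \<omega> \<le> R n \<omega>} < a"
    by (intro always_eventually allI) (rule le_less_trans[OF measure_pmf.prob_le_1])
qed

lemma prob_le_diverging_threshold_neg:
  assumes X: "char_to_normal X"
    and R: "\<And>K. (\<lambda>n. \<P> (P n) {\<omega>. - R n \<omega> < K}) \<longlonglongrightarrow> 0"
  shows "(\<lambda>n. \<P> (P n) {\<omega>. X n \<omega> \<le> R n \<omega>}) \<longlonglongrightarrow> 0"
proof -
  have "(\<lambda>n. \<P> (P n) {\<omega>. - X n \<omega> \<le> - R n \<omega> - 1}) \<longlonglongrightarrow> 1"
  proof (rule prob_le_diverging_threshold[OF char_to_normal_uminus[OF X]])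
    show "(\<lambda>n. \<P> (P n) {\<omega>. - R n \<omega> - 1 < K}) \<longlonglongrightarrow> 0" for K
      using R[of "K + 1"] by (simp only: diff_less_eq)
  qed
  then have "(\<lambda>n. 1 - \<P> (P n) {\<omega>. - X n \<omega> \<le> - R n \<omega> - 1}) \<longlonglongrightarrow> 1 - 1"
    by (intro tendsto_diff tendsto_const)
  then have lim: "(\<lambda>n. 1 - \<P> (P n) {\<omega>. - X n \<omega> \<le> - R n \<omega> - 1}) \<longlonglongrightarrow> 0" by simp
  show ?thesis
  proof (rule tendsto_sandwich[OF _ _ tendsto_const lim])
    have "\<P> (P n) {\<omega>. X n \<omega> \<le> R n \<omega>} + \<P> (P n) {\<omega>. - X n \<omega> \<le> - R n \<omega> - 1} \<le> 1" for n
    proof -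
      have "\<P> (P n) {\<omega>. X n \<omega> \<le> R n \<omega>} + \<P> (P n) {\<omega>. - X n \<omega> \<le> - R n \<omega> - 1}
          = \<P> (P n) ({\<omega>. X n \<omega> \<le> R n \<omega>} \<union> {\<omega>. - X n \<omega> \<le> - R n \<omega> - 1})"
        by (intro measure_pmf.finite_measure_Union[symmetric]) auto
      then show ?thesis by simp
    qed
    then show "\<forall>\<^sub>F n in sequentially. \<P> (P n) {\<omega>. X n \<omega> \<le> R n \<omega>}
        \<le> 1 - \<P> (P n) {\<omega>. - X n \<omega> \<le> - R n \<omega> - 1}"
      by (intro always_eventually allI) (simp only: le_diff_eq)
  qed simp
qed

end


section \<open>The sparse regime at high temperature\<close>

locale ising_sequence =
  fixes W :: "real \<Rightarrow> real \<Rightarrow> real" and \<theta> :: "nat \<Rightarrow> real" and \<beta> :: real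
  assumes graphon: "graphon W"
    and riemann: "(\<lambda>(x, y). W x y) riemann_integrable_on unit_square"
    and mass_pos: "0 < graphon_mass W"
    and \<theta>: "\<And>N. N \<ge> 1 \<Longrightarrow> \<theta> N \<in> {0<..<1}"
    and dense: "\<exists>C>0. \<forall>\<^sub>F N in sequentially. real N powr (2 / 3) * \<theta> N \<ge> C"
    and sparse: "\<theta> \<longlonglongrightarrow> 0"
    and \<beta>: "\<beta> \<in> {0<..<1 / graphon_op_norm W}"
begin

abbreviation model :: "nat \<Rightarrow> ((nat \<Rightarrow> nat \<Rightarrow> real) \<times> (nat \<Rightarrow> real)) pmf" where
  "model N \<equiv> ising_model N (\<theta> N) W \<beta>"

sublocale pmf_sequence model
  by standard (rule finite_set_ising_model)

lemma sample: "N \<ge> 1 \<Longrightarrow> sparse_graphon_sample W N (\<theta> N)"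
  using graphon \<theta> by unfold_locales auto

lemma op_norm_pos: "0 < graphon_op_norm W"
proof -
  have "0 < \<beta>" "\<beta> < 1 / graphon_op_norm W" using \<beta> by auto
  then have "0 < 1 / graphon_op_norm W" by (rule less_trans)
  then show ?thesis by simp
qed

text \<open>
  This is the cube of the assumption, in the form in which it bounds \<open>1 / (N\<^sup>2 \<theta>\<^sup>3)\<close>.
\<close>

lemma edge_regime: "\<exists>K>0. \<forall>\<^sub>F N in sequentially. N \<ge> 1 \<and> K \<le> (real N)\<^sup>2 * \<theta> N ^ 3"
proof -
  obtain C where C: "C > 0" "\<forall>\<^sub>F N in sequentially. real N powr (2 / 3) * \<theta> N \<ge> C"
    using dense by blast
  have "\<forall>\<^sub>F N in sequentially. N \<ge> 1 \<and> C ^ 3 \<le> (real N)\<^sup>2 * \<theta> N ^ 3"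
    using C(2) eventually_ge_at_top[of 1]
  proof eventually_elim
    case (elim N)
    have "C ^ 3 \<le> (real N powr (2 / 3) * \<theta> N) ^ 3" using C(1) elim by (intro power_mono) auto
    also have "\<dots> = (real N powr (2 / 3)) ^ 3 * \<theta> N ^ 3" by (rule power_mult_distrib)
    also have "(real N powr (2 / 3)) ^ 3 = (real N)\<^sup>2"
      using elim by (simp add: powr_powr flip: powr_realpow powr_numeral)
    finally show ?case using elim by simp
  qed
  then show ?thesis using C(1) by (intro exI[of _ "C ^ 3"]) auto
qed

lemma sqrt_sparse: "(\<lambda>N. sqrt (\<theta> N)) \<longlonglongrightarrow> 0"
  using tendsto_real_sqrt[OF sparse] by simp

text \<open>
  Dividing \<open>K \<le> N\<^sup>2 \<theta>\<^sup>3\<close> by \<open>\<theta>\<close>, which tends to 0, shows that the square of \<open>N \<theta>\<close> tends to infinity.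
\<close>

lemma degree_at_top: "filterlim (\<lambda>N. real N * \<theta> N) at_top sequentially"
proof -
  obtain K where K: "K > 0" "\<forall>\<^sub>F N in sequentially. N \<ge> 1 \<and> K \<le> (real N)\<^sup>2 * \<theta> N ^ 3"
    using edge_regime by blast
  have "filterlim (\<lambda>N. sqrt (K / \<theta> N)) at_top sequentially"
  proof (rule filterlim_compose[OF sqrt_at_top])
    have "\<forall>\<^sub>F N in sequentially. \<theta> N \<in> {0<..} \<and> \<theta> N \<noteq> 0"
      using eventually_ge_at_top[of 1] by eventually_elim (use \<theta> in force)
    then have "filterlim \<theta> (at_right 0) sequentially"
      unfolding filterlim_at using sparse by blast
    then show "filterlim (\<lambda>N. K / \<theta> N) at_top sequentially"
      using filterlim_tendsto_pos_mult_at_top[OF tendsto_const K(1)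
          filterlim_compose[OF filterlim_inverse_at_top_right]]
      by (simp add: divide_inverse)
  qed
  then show ?thesis
  proof (rule filterlim_at_top_mono)
    show "\<forall>\<^sub>F N in sequentially. sqrt (K / \<theta> N) \<le> real N * \<theta> N"
      using K(2)
    proof eventually_elim
      case (elim N)
      then have t: "0 < \<theta> N" using \<theta> by auto
      have "K / \<theta> N \<le> (real N * \<theta> N)\<^sup>2"
        using elim t by (simp add: divide_le_eq power2_eq_square power3_eq_cube mult_ac)
      then show ?case using t by (intro real_le_lsqrt) auto
    qed
  qed
qed

lemma inverse_degree: "(\<lambda>N. 1 / (real N * \<theta> N)) \<longlonglongrightarrow> 0"
  using tendsto_inverse_0_at_top[OF degree_at_top] by (simp add: inverse_eq_divide)

lemma inverse_sqrt_edges: "(\<lambda>N. 1 / (real N * sqrt (\<theta> N))) \<longlonglongrightarrow> 0"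
proof (rule tendsto_sandwich[OF _ _ tendsto_const inverse_degree])
  show "\<forall>\<^sub>F N in sequentially. 0 \<le> 1 / (real N * sqrt (\<theta> N))"
    using eventually_ge_at_top[of 1] by eventually_elim (use \<theta> in \<open>auto simp: less_imp_le\<close>)
  show "\<forall>\<^sub>F N in sequentially. 1 / (real N * sqrt (\<theta> N)) \<le> 1 / (real N * \<theta> N)"
    using eventually_ge_at_top[of 1]
  proof eventually_elim
    case (elim N)
    then have t: "0 < \<theta> N" "\<theta> N < 1" using \<theta> by auto
    have "(\<theta> N)\<^sup>2 \<le> \<theta> N" using t by (simp add: power2_eq_square mult_left_le)
    then have "\<theta> N \<le> sqrt (\<theta> N)" by (rule real_le_rsqrt)
    then show ?case using t elim by (intro divide_left_mono mult_left_mono) auto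
  qed
qed

lemma osc_limit: "graphon_osc W \<longlonglongrightarrow> 0"
  by (rule graphon_osc_tendsto_0[OF graphon riemann])

lemma char_centred_energy_limit:
  "(\<lambda>N. \<E> (model N) (\<lambda>(A, \<sigma>). iexp (s * centred_energy N (\<theta> N) \<beta> A \<sigma>)))
    \<longlonglongrightarrow> of_real (exp (- (s\<^sup>2 * graphon_mass W / 4)))"
proof -
  \<comment> \<open>any value strictly between \<open>\<beta>\<close> and the critical one would do\<close>
  define \<beta>' where "\<beta>' = (\<beta> + 1 / graphon_op_norm W) / 2"
  have \<beta>': "\<beta> < \<beta>'" "\<beta>' < 1 / graphon_op_norm W" "0 < \<beta>" "0 < \<beta>'" using \<beta> by (auto simp: \<beta>'_def)
  define \<epsilon> where "\<epsilon> = (1 - \<beta>' * graphon_op_norm W) / 2"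
  have \<epsilon>: "0 < \<epsilon>" "\<beta>' * graphon_op_norm W < 1 - \<epsilon>"
    using \<beta>'(2) op_norm_pos by (auto simp: \<epsilon>_def field_simps)
  obtain K where K: "K > 0" "\<forall>\<^sub>F N in sequentially. N \<ge> 1 \<and> K \<le> (real N)\<^sup>2 * \<theta> N ^ 3"
    using edge_regime by blast
  have "(\<lambda>N. \<beta>' * (graphon_op_norm W + sqrt (graphon_osc W N))) \<longlonglongrightarrow> \<beta>' * (graphon_op_norm W + sqrt 0)"
    by (intro tendsto_intros osc_limit)
  then have ev1: "\<forall>\<^sub>F N in sequentially. \<beta>' * (graphon_op_norm W + sqrt (graphon_osc W N)) < 1 - \<epsilon>"
    by (rule order_tendstoD(2)) (use \<epsilon> in simp)
  have "(\<lambda>N. \<beta> + 2 * \<bar>s\<bar> * sqrt (\<theta> N)) \<longlonglongrightarrow> \<beta> + 2 * \<bar>s\<bar> * 0"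
    by (intro tendsto_intros sqrt_sparse)
  then have ev2: "\<forall>\<^sub>F N in sequentially. \<beta> + 2 * \<bar>s\<bar> * sqrt (\<theta> N) < \<beta>'"
    by (rule order_tendstoD(2)) (use \<beta>' in simp)
  have "(\<lambda>N. \<bar>s\<bar> * sqrt (\<theta> N)) \<longlonglongrightarrow> \<bar>s\<bar> * 0"
    by (intro tendsto_intros sqrt_sparse)
  then have ev3: "\<forall>\<^sub>F N in sequentially. \<bar>s\<bar> * sqrt (\<theta> N) < \<beta>"
    by (rule order_tendstoD(2)) (use \<beta>' in simp)
  have ev4: "\<forall>\<^sub>F N in sequentially. \<beta>' \<le> real N * \<theta> N"
    using degree_at_top unfolding filterlim_at_top by blast
  define B where "B N = 2 * \<bar>s\<bar> * sqrt (\<theta> N) / (\<beta>' - (\<beta> + 2 * \<bar>s\<bar> * sqrt (\<theta> N))) * exp (\<beta>'\<^sup>2 / (4 * \<epsilon>))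
      + 4 * \<bar>s\<bar> * sqrt (\<theta> N) * \<beta> ^ 3 * (1 / K)
      + s\<^sup>2 / 4 * (2 * (1 / (real N * sqrt (\<theta> N))) + graphon_osc W N + 1 / real N)" for N
  have B: "B \<longlonglongrightarrow> 2 * \<bar>s\<bar> * 0 / (\<beta>' - (\<beta> + 2 * \<bar>s\<bar> * 0)) * exp (\<beta>'\<^sup>2 / (4 * \<epsilon>))
      + 4 * \<bar>s\<bar> * 0 * \<beta> ^ 3 * (1 / K) + s\<^sup>2 / 4 * (2 * 0 + 0 + 0)"
    unfolding B_def
    by (intro tendsto_intros sqrt_sparse inverse_sqrt_edges osc_limit lim_1_over_n) (use \<beta>' in simp)
  have "\<forall>\<^sub>F N in sequentially. norm (\<E> (model N) (\<lambda>(A, \<sigma>). iexp (s * centred_energy N (\<theta> N) \<beta> A \<sigma>))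
      - of_real (exp (- (s\<^sup>2 * graphon_mass W / 4)))) \<le> B N"
    using ev1 ev2 ev3 ev4 K(2)
  proof eventually_elim
    case (elim N)
    interpret sparse_graphon_sample W N "\<theta> N" using elim by (intro sample) auto
    have "norm (\<E> (model N) (\<lambda>(A, \<sigma>). iexp (s * centred_energy N (\<theta> N) \<beta> A \<sigma>))
      - of_real (exp (- (s\<^sup>2 * graphon_mass W / 4))))
      \<le> 2 * \<bar>s\<bar> * sqrt (\<theta> N) / (\<beta>' - (\<beta> + 2 * \<bar>s\<bar> * sqrt (\<theta> N))) * exp (\<beta>'\<^sup>2 / (4 * \<epsilon>))
      + 4 * \<bar>s\<bar> * sqrt (\<theta> N) * \<beta> ^ 3 / ((real N)\<^sup>2 * \<theta> N ^ 3)
      + s\<^sup>2 / 4 * (2 / (real N * sqrt (\<theta> N)) + graphon_osc W N + 1 / real N)"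
      by (rule char_centred_energy[OF op_norm_pos \<epsilon>(1) \<beta>'(3)]) (use elim in auto)
    also have "\<dots> \<le> B N"
    proof -
      have "4 * \<bar>s\<bar> * sqrt (\<theta> N) * \<beta> ^ 3 / ((real N)\<^sup>2 * \<theta> N ^ 3) \<le> 4 * \<bar>s\<bar> * sqrt (\<theta> N) * \<beta> ^ 3 / K"
        using elim K(1) \<beta>'(3) t by (intro divide_left_mono) auto
      then show ?thesis unfolding B_def by simp
    qed
    finally show ?case .
  qed
  then have "(\<lambda>N. \<E> (model N) (\<lambda>(A, \<sigma>). iexp (s * centred_energy N (\<theta> N) \<beta> A \<sigma>))
      - of_real (exp (- (s\<^sup>2 * graphon_mass W / 4)))) \<longlonglongrightarrow> 0"
    by (rule Lim_null_comparison) (use B in simp)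
  then show ?thesis by (rule LIM_zero_cancel)
qed


section \<open>The test\<close>

text \<open>
  Normalised such that the limit is 1.
\<close>

definition edge_density :: "nat \<Rightarrow> (nat \<Rightarrow> nat \<Rightarrow> real) \<Rightarrow> real" where
  "edge_density N A = edge_sum N A / ((real N)\<^sup>2 * \<theta> N * graphon_mass W)"

text \<open>
  The Hamiltonian, centred as if \<open>b\<close> were the inverse temperature, and scaled such that for \<open>b = \<beta>\<close> the
  limit is standard normal.
\<close>

definition statistic :: "real \<Rightarrow> nat \<Rightarrow> (nat \<Rightarrow> nat \<Rightarrow> real) \<times> (nat \<Rightarrow> real) \<Rightarrow> real" where
  "statistic b N = (\<lambda>(A, \<sigma>). sqrt (\<theta> N)
     * (hamiltonian N (\<theta> N) A \<sigma> + b / (2 * (real N)\<^sup>2 * (\<theta> N)\<^sup>2) * edge_sum N A) / sqrt (graphon_mass W / 2))"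

abbreviation density_error :: "nat \<Rightarrow> real" where
  "density_error N \<equiv> \<E> (random_graph N (\<theta> N) W) (\<lambda>A. \<bar>edge_density N A - 1\<bar>)"

lemma edge_density_limit:
  "density_error \<longlonglongrightarrow> 0"
proof (rule tendsto_sandwich[OF _ _ tendsto_const])
  show "\<forall>\<^sub>F N in sequentially. 0 \<le> density_error N"
    by (intro always_eventually allI Bochner_Integration.integral_nonneg) simp
  show "\<forall>\<^sub>F N in sequentially. density_error N
      \<le> (2 * (1 / (real N * sqrt (\<theta> N))) + graphon_osc W N) / graphon_mass W"
    using eventually_ge_at_top[of 1]
  proof eventually_elim
    case (elim N)
    interpret sparse_graphon_sample W N "\<theta> N" using elim by (intro sample) auto
    have "\<bar>edge_density N A - 1\<bar> = \<bar>edge_sum N A / ((real N)\<^sup>2 * \<theta> N) - graphon_mass W\<bar> / graphon_mass W" for A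
    proof -
      have "edge_density N A - 1 = (edge_sum N A / ((real N)\<^sup>2 * \<theta> N) - graphon_mass W) / graphon_mass W"
        using mass_pos by (simp add: edge_density_def diff_divide_distrib)
      then show ?thesis using mass_pos by (simp add: abs_divide)
    qed
    then have "density_error N
        = \<E> (random_graph N (\<theta> N) W) (\<lambda>A. \<bar>edge_sum N A / ((real N)\<^sup>2 * \<theta> N) - graphon_mass W\<bar>) / graphon_mass W"
      by simp
    also have "\<dots> \<le> (2 / (real N * sqrt (\<theta> N)) + graphon_osc W N) / graphon_mass W"
      using mass_pos by (intro divide_right_mono expectation_edge_density_deviation) auto
    finally show ?case by simp
  qed
  have "(\<lambda>N. (2 * (1 / (real N * sqrt (\<theta> N))) + graphon_osc W N) / graphon_mass W) \<longlonglongrightarrow> (2 * 0 + 0) / graphon_mass W"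
    using mass_pos by (intro tendsto_intros inverse_sqrt_edges osc_limit) auto
  then show "(\<lambda>N. (2 * (1 / (real N * sqrt (\<theta> N))) + graphon_osc W N) / graphon_mass W) \<longlonglongrightarrow> 0" by simp
qed

lemma statistic_eq:
  assumes "N \<ge> 1" and A: "adjacency A" and \<sigma>: "\<sigma> \<in> spins N"
  shows "statistic \<beta> N (A, \<sigma>) = - centred_energy N (\<theta> N) \<beta> A \<sigma> / sqrt (graphon_mass W / 2)
    + sqrt (\<theta> N) / sqrt (graphon_mass W / 2) * (\<beta> / (real N * \<theta> N) - 1) * (loop_sum N A / (2 * (real N * \<theta> N)))"
proof -
  define n where "n = real N * \<theta> N"
  have n: "n \<noteq> 0" using assms(1) \<theta>[OF assms(1)] by (auto simp: n_def)
  have n2: "2 * (real N)\<^sup>2 * (\<theta> N)\<^sup>2 = 2 * n * n" by (simp add: n_def power2_eq_square)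
  have "hamiltonian N (\<theta> N) A \<sigma> + \<beta> / (2 * n * n) * edge_sum N A
      = - ((edge_energy N A \<sigma> - \<beta> / n * card (edges N A)) / n) + (\<beta> / n - 1) * (loop_sum N A / (2 * n))"
    unfolding hamiltonian_eq[OF A \<sigma>] edge_sum_eq[OF A] n_def[symmetric] using n
    by (simp add: field_simps)
  then have "statistic \<beta> N (A, \<sigma>) = sqrt (\<theta> N) * (- ((edge_energy N A \<sigma> - \<beta> / n * card (edges N A)) / n)
      + (\<beta> / n - 1) * (loop_sum N A / (2 * n))) / sqrt (graphon_mass W / 2)"
    unfolding statistic_def split n2 by simp
  also have "\<dots> = - centred_energy N (\<theta> N) \<beta> A \<sigma> / sqrt (graphon_mass W / 2)
    + sqrt (\<theta> N) / sqrt (graphon_mass W / 2) * (\<beta> / n - 1) * (loop_sum N A / (2 * n))"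
  proof -
    have "r * (- (x / n) + c * y) / v = - (r / n * x) / v + r / v * c * y" for r x c y v :: real
      by (simp add: right_diff_distrib diff_divide_distrib)
    then show ?thesis unfolding centred_energy_def n_def[symmetric] by (simp only:)
  qed
  finally show ?thesis by (simp add: n_def)
qed

text \<open>
  The statistic is the negative of the normalised centred energy, up to the contribution of the
  self-loops. Their expected number is at most \<open>N \<theta>\<close>, so that this contribution is of order \<open>\<surd>\<theta>\<close> in
  mean.
\<close>

lemma char_statistic: "char_to_normal (statistic \<beta>)"
proof -
  define v where "v = sqrt (graphon_mass W / 2)"
  have v: "0 < v" "v\<^sup>2 = graphon_mass W / 2" using mass_pos by (auto simp: v_def)
  define X where "X N = (\<lambda>(A, \<sigma>). - centred_energy N (\<theta> N) \<beta> A \<sigma> / v)" for N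
  have "char_to_normal X"
    unfolding char_to_normal_def
  proof
    fix s
    have lim: "(\<lambda>N. \<E> (model N) (\<lambda>(A, \<sigma>). iexp ((- s / v) * centred_energy N (\<theta> N) \<beta> A \<sigma>)))
      \<longlonglongrightarrow> of_real (exp (- ((- s / v)\<^sup>2 * graphon_mass W / 4)))"
      by (rule char_centred_energy_limit)
    have var: "(- s / v)\<^sup>2 * graphon_mass W / 4 = s\<^sup>2 / 2"
      unfolding power_divide v(2) using mass_pos by simp
    have "(\<lambda>(A, \<sigma>). iexp ((- s / v) * centred_energy N (\<theta> N) \<beta> A \<sigma>)) = (\<lambda>\<omega>. iexp (s * X N \<omega>))" for N
      by (simp add: X_def case_prod_unfold)
    from lim[unfolded this var]
    show "(\<lambda>n. \<E> (model n) (\<lambda>\<omega>. iexp (s * X n \<omega>))) \<longlonglongrightarrow> of_real (exp (- s\<^sup>2 / 2))"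
      by (simp only: minus_divide_left)
  qed
  moreover have "(\<lambda>N. \<E> (model N) (\<lambda>\<omega>. \<bar>statistic \<beta> N \<omega> - X N \<omega>\<bar>)) \<longlonglongrightarrow> 0"
  proof (rule tendsto_sandwich[OF _ _ tendsto_const])
    show "\<forall>\<^sub>F N in sequentially. 0 \<le> \<E> (model N) (\<lambda>\<omega>. \<bar>statistic \<beta> N \<omega> - X N \<omega>\<bar>)"
      by (intro always_eventually allI Bochner_Integration.integral_nonneg) simp
    show "\<forall>\<^sub>F N in sequentially. \<E> (model N) (\<lambda>\<omega>. \<bar>statistic \<beta> N \<omega> - X N \<omega>\<bar>)
        \<le> sqrt (\<theta> N) / v * \<bar>\<beta> * (1 / (real N * \<theta> N)) - 1\<bar> * (1 / 2)"
      using eventually_ge_at_top[of 1]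
    proof eventually_elim
      case (elim N)
      interpret sparse_graphon_sample W N "\<theta> N" using elim by (intro sample) auto
      define n where "n = real N * \<theta> N"
      have n: "0 < n" using t N by (simp add: n_def)
      define c where "c = sqrt (\<theta> N) / v * \<bar>\<beta> / n - 1\<bar>"
      have c: "0 \<le> c" unfolding c_def using t v by simp
      have "\<E> (model N) (\<lambda>\<omega>. \<bar>statistic \<beta> N \<omega> - X N \<omega>\<bar>)
          \<le> \<E> (model N) (\<lambda>(A, \<sigma>). c * (loop_sum N A / (2 * n)))"
      proof (intro integral_mono_AE integrable_at AE_pmfI)
        fix \<omega> assume "\<omega> \<in> set_pmf (model N)"
        then obtain A \<sigma> where \<omega>: "\<omega> = (A, \<sigma>)" "A \<in> set_pmf (random_graph N (\<theta> N) W)" "\<sigma> \<in> set_pmf (ising N (\<theta> N) A \<beta>)"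
          by (auto simp: ising_model_def)
        have A: "adjacency A" by (rule random_graph_adjacency[OF \<omega>(2)])
        have \<sigma>: "\<sigma> \<in> spins N" using \<omega>(3) set_pmf_ising_subset by blast
        have l0: "0 \<le> loop_sum N A / (2 * n)" using loop_sum_nonneg[OF A] n by simp
        have "statistic \<beta> N \<omega> - X N \<omega> = sqrt (\<theta> N) / v * (\<beta> / n - 1) * (loop_sum N A / (2 * n))"
          unfolding \<omega>(1) statistic_eq[OF elim A \<sigma>] X_def v_def n_def by simp
        also have "\<bar>\<dots>\<bar> = c * (loop_sum N A / (2 * n))"
          unfolding c_def using loop_sum_nonneg[OF A, of N] n t v by (simp add: abs_mult)
        finally show "\<bar>statistic \<beta> N \<omega> - X N \<omega>\<bar> \<le> (case \<omega> of (A, \<sigma>) \<Rightarrow> c * (loop_sum N A / (2 * n)))"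
          by (simp add: \<omega>(1))
      qed
      also have "\<dots> = c * (\<E> (random_graph N (\<theta> N) W) (loop_sum N) / (2 * n))"
        unfolding expectation_ising_model_graph by simp
      also have "\<dots> \<le> c * (n / (2 * n))"
        unfolding n_def using expectation_loop_sum n by (intro mult_left_mono divide_right_mono c) (auto simp: n_def)
      also have "c * (n / (2 * n)) = c * (1 / 2)" using n by simp
      finally show ?case by (simp add: c_def n_def)
    qed
    have "(\<lambda>N. sqrt (\<theta> N) / v * \<bar>\<beta> * (1 / (real N * \<theta> N)) - 1\<bar> * (1 / 2)) \<longlonglongrightarrow> 0 / v * \<bar>\<beta> * 0 - 1\<bar> * (1 / 2)"
      using v by (intro tendsto_intros sqrt_sparse inverse_degree) auto
    then show "(\<lambda>N. sqrt (\<theta> N) / v * \<bar>\<beta> * (1 / (real N * \<theta> N)) - 1\<bar> * (1 / 2)) \<longlonglongrightarrow> 0" by simp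
  qed
  ultimately show ?thesis by (rule char_to_normal_L1_perturbation)
qed

lemma edge_density_nonneg:
  assumes "N \<ge> 1" "adjacency A"
  shows "0 \<le> edge_density N A"
  using assms loop_sum_nonneg[OF assms(2)] \<theta>[OF assms(1)] mass_pos
  by (auto simp: edge_density_def edge_sum_eq intro!: divide_nonneg_nonneg)

text \<open>
  The fluctuation of the random threshold is moved to the other side, where it is a perturbation that
  vanishes in mean.
\<close>

lemma prob_statistic_le_threshold:
  assumes X: "char_to_normal X"
  shows "(\<lambda>N. \<P> (model N) {\<omega>. X N \<omega> \<le> z * sqrt (edge_density N (fst \<omega>))}) \<longlonglongrightarrow> std_normal_cdf z"
proof -
  define Y where "Y N \<omega> = X N \<omega> - z * (sqrt (edge_density N (fst \<omega>)) - 1)" for N \<omega>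
  have "(\<lambda>N. \<E> (model N) (\<lambda>\<omega>. \<bar>Y N \<omega> - X N \<omega>\<bar>)) \<longlonglongrightarrow> 0"
  proof (rule tendsto_sandwich[OF _ _ tendsto_const tendsto_mult_right_zero[OF edge_density_limit, of "\<bar>z\<bar>"]])
    show "\<forall>\<^sub>F N in sequentially. 0 \<le> \<E> (model N) (\<lambda>\<omega>. \<bar>Y N \<omega> - X N \<omega>\<bar>)"
      by (intro always_eventually allI Bochner_Integration.integral_nonneg) simp
    show "\<forall>\<^sub>F N in sequentially. \<E> (model N) (\<lambda>\<omega>. \<bar>Y N \<omega> - X N \<omega>\<bar>)
        \<le> \<bar>z\<bar> * density_error N"
      using eventually_ge_at_top[of 1]
    proof eventually_elim
      case (elim N)
      have "\<E> (model N) (\<lambda>\<omega>. \<bar>Y N \<omega> - X N \<omega>\<bar>)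
          \<le> \<E> (model N) (\<lambda>(A, \<sigma>). \<bar>z\<bar> * \<bar>edge_density N A - 1\<bar>)"
      proof (intro integral_mono_AE integrable_at AE_pmfI)
        fix \<omega> assume "\<omega> \<in> set_pmf (model N)"
        then obtain A \<sigma> where \<omega>: "\<omega> = (A, \<sigma>)" "A \<in> set_pmf (random_graph N (\<theta> N) W)"
          by (auto simp: ising_model_def)
        define q where "q = edge_density N A"
        have q: "0 \<le> q" unfolding q_def by (rule edge_density_nonneg[OF elim random_graph_adjacency[OF \<omega>(2)]])
        have "q - 1 = (sqrt q - 1) * (sqrt q + 1)" using q by (simp add: algebra_simps)
        then have "\<bar>q - 1\<bar> = \<bar>sqrt q - 1\<bar> * (sqrt q + 1)" using q by (simp add: abs_mult)
        moreover have "\<bar>sqrt q - 1\<bar> * 1 \<le> \<bar>sqrt q - 1\<bar> * (sqrt q + 1)" using q by (intro mult_left_mono) auto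
        ultimately have "\<bar>z\<bar> * \<bar>sqrt q - 1\<bar> \<le> \<bar>z\<bar> * \<bar>q - 1\<bar>" by (intro mult_left_mono) auto
        then show "\<bar>Y N \<omega> - X N \<omega>\<bar> \<le> (case \<omega> of (A, \<sigma>) \<Rightarrow> \<bar>z\<bar> * \<bar>edge_density N A - 1\<bar>)"
          by (simp add: Y_def \<omega>(1) q_def abs_mult)
      qed
      then show ?case unfolding expectation_ising_model_graph by simp
    qed
  qed
  then have "(\<lambda>N. \<P> (model N) {\<omega>. Y N \<omega> \<le> z}) \<longlonglongrightarrow> std_normal_cdf z"
    by (intro prob_le_tendsto char_to_normal_L1_perturbation[OF X])
  then show ?thesis by (simp add: Y_def algebra_simps)
qed

text \<open>
  With high probability the edge density is at least \<open>1 / 2\<close> and at most 4; then the second term exceeds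
  \<open>c / (2 \<surd>\<theta>)\<close>, while the first one is bounded by \<open>2 \<bar>z\<bar>\<close>.
\<close>

lemma diverging_threshold:
  assumes c: "0 < c"
  shows "(\<lambda>N. \<P> (model N)
      {\<omega>. z * sqrt (edge_density N (fst \<omega>)) + c / sqrt (\<theta> N) * edge_density N (fst \<omega>) < K}) \<longlonglongrightarrow> 0"
proof (rule tendsto_sandwich[OF _ _ tendsto_const tendsto_mult_right_zero[OF edge_density_limit, of 2]])
  let ?q = "\<lambda>N \<omega>. edge_density N (fst \<omega>)"
  show "\<forall>\<^sub>F N in sequentially. 0 \<le> \<P> (model N) {\<omega>. z * sqrt (?q N \<omega>) + c / sqrt (\<theta> N) * ?q N \<omega> < K}"
    by simp
  have "(\<lambda>N. 2 * \<bar>K\<bar> * sqrt (\<theta> N) + 4 * \<bar>z\<bar> * sqrt (\<theta> N)) \<longlonglongrightarrow> 2 * \<bar>K\<bar> * 0 + 4 * \<bar>z\<bar> * 0"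
    by (intro tendsto_intros sqrt_sparse)
  then have "\<forall>\<^sub>F N in sequentially. 2 * \<bar>K\<bar> * sqrt (\<theta> N) + 4 * \<bar>z\<bar> * sqrt (\<theta> N) < c"
    by (rule order_tendstoD(2)) (use c in simp)
  then show "\<forall>\<^sub>F N in sequentially. \<P> (model N) {\<omega>. z * sqrt (?q N \<omega>) + c / sqrt (\<theta> N) * ?q N \<omega> < K}
      \<le> 2 * density_error N"
    using eventually_ge_at_top[of 1]
  proof eventually_elim
    case (elim N)
    have t: "0 < \<theta> N" using \<theta>[OF elim(2)] by simp
    define m where "m = c / sqrt (\<theta> N)"
    have m: "0 \<le> m" unfolding m_def using c t by simp
    have big: "2 * \<bar>K\<bar> + 4 * \<bar>z\<bar> < m"
    proof -
      have "(2 * \<bar>K\<bar> + 4 * \<bar>z\<bar>) * sqrt (\<theta> N) < c" using elim(1) by (simp only: distrib_right)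
      then show ?thesis unfolding m_def using t by (simp add: pos_less_divide_eq)
    qed
    have "\<P> (model N) {\<omega>. z * sqrt (?q N \<omega>) + c / sqrt (\<theta> N) * ?q N \<omega> < K}
        \<le> \<P> (model N) {\<omega> \<in> space (measure_pmf (model N)). 1 / 2 \<le> \<bar>?q N \<omega> - 1\<bar>}"
    proof (intro measure_pmf.finite_measure_mono)
      show "{\<omega>. z * sqrt (?q N \<omega>) + c / sqrt (\<theta> N) * ?q N \<omega> < K}
          \<subseteq> {\<omega> \<in> space (measure_pmf (model N)). 1 / 2 \<le> \<bar>?q N \<omega> - 1\<bar>}"
      proof (intro subsetI CollectI conjI, simp, rule ccontr)
        fix \<omega>
        define q where "q = ?q N \<omega>"
        assume "\<omega> \<in> {\<omega>. z * sqrt (?q N \<omega>) + c / sqrt (\<theta> N) * ?q N \<omega> < K}"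
        then have *: "z * sqrt q + m * q < K" by (simp only: q_def m_def mem_Collect_eq)
        assume "\<not> 1 / 2 \<le> \<bar>?q N \<omega> - 1\<bar>"
        then have "\<bar>q - 1\<bar> < 1 / 2" unfolding q_def by (simp only: not_le)
        then have q: "1 \<le> 2 * q" "q \<le> 4" unfolding abs_less_iff by simp_all
        have "sqrt q \<le> 2" using real_sqrt_le_mono[OF q(2)] by simp
        then have "\<bar>z * sqrt q\<bar> \<le> \<bar>z\<bar> * 2" unfolding abs_mult using q by (intro mult_left_mono) auto
        moreover have "m * 1 \<le> m * (2 * q)" using m q(1) by (rule mult_left_mono[rotated])
        moreover have "m * (2 * q) = 2 * (m * q)" by simp
        ultimately show False using * big by linarith
      qed
    qed simp
    also have "\<dots> \<le> \<E> (model N) (\<lambda>\<omega>. \<bar>?q N \<omega> - 1\<bar>) / (1 / 2)"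
      by (rule integral_Markov_inequality_measure[where A = "{}"]) (auto intro: integrable_at)
    also have "\<E> (model N) (\<lambda>\<omega>. \<bar>?q N \<omega> - 1\<bar>)
        = density_error N"
      using expectation_ising_model_graph[of N "\<theta> N" W \<beta> "\<lambda>A. \<bar>edge_density N A - 1\<bar>"] by (simp add: case_prod_unfold)
    finally show ?case by simp
  qed
qed

text \<open>
  Scaling by \<open>\<surd>\<theta>\<close> turns the two cutoffs into symmetric thresholds for the statistic centred at \<open>\<beta>\<^sub>0\<close>.
  Passing to complements turns the strict inequalities into the form that distribution functions have.
\<close>

lemma power_function_eq:
  assumes N: "N \<ge> 1"
  shows "power_function N (\<theta> N) W \<beta>\<^sub>0 \<alpha> \<beta>
    = (1 - \<P> (model N) {\<omega>. - statistic \<beta>\<^sub>0 N \<omega> \<le> normal_z (\<alpha> / 2) * sqrt (edge_density N (fst \<omega>))})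
    + (1 - \<P> (model N) {\<omega>. statistic \<beta>\<^sub>0 N \<omega> \<le> normal_z (\<alpha> / 2) * sqrt (edge_density N (fst \<omega>))})"
proof -
  define z where "z = normal_z (\<alpha> / 2)"
  define v where "v = sqrt (graphon_mass W / 2)"
  define k where "k = sqrt (\<theta> N) / v"
  have t: "0 < \<theta> N" using \<theta>[OF N] by simp
  have v: "0 < v" using mass_pos by (simp add: v_def)
  have k: "0 < k" using t v by (simp add: k_def)
  have thr: "k * sqrt (1 / (2 * (real N)\<^sup>2 * (\<theta> N)\<^sup>2) * edge_sum N A) = sqrt (edge_density N A)" for A
  proof -
    have "k * sqrt (1 / (2 * (real N)\<^sup>2 * (\<theta> N)\<^sup>2) * edge_sum N A)
        = sqrt (\<theta> N / (graphon_mass W / 2) * (1 / (2 * (real N)\<^sup>2 * (\<theta> N)\<^sup>2) * edge_sum N A))"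
      unfolding k_def v_def real_sqrt_mult real_sqrt_divide by simp
    also have "\<theta> N / (graphon_mass W / 2) * (1 / (2 * (real N)\<^sup>2 * (\<theta> N)\<^sup>2) * edge_sum N A) = edge_density N A"
      unfolding edge_density_def using t mass_pos by (simp add: power2_eq_square)
    finally show ?thesis .
  qed
  have st: "statistic \<beta>\<^sub>0 N (A, \<sigma>) = k * (hamiltonian N (\<theta> N) A \<sigma> + \<beta>\<^sub>0 / (2 * (real N)\<^sup>2 * (\<theta> N)\<^sup>2) * edge_sum N A)" for A \<sigma>
    by (simp add: statistic_def k_def v_def)
  have lower: "hamiltonian N (\<theta> N) A \<sigma> < c_hat N (\<theta> N) \<beta>\<^sub>0 \<alpha> A \<longleftrightarrow> \<not> - statistic \<beta>\<^sub>0 N (A, \<sigma>) \<le> z * sqrt (edge_density N A)" for A \<sigma>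
  proof -
    define H where "H = hamiltonian N (\<theta> N) A \<sigma>"
    define e where "e = \<beta>\<^sub>0 / (2 * (real N)\<^sup>2 * (\<theta> N)\<^sup>2) * edge_sum N A"
    define y where "y = sqrt (1 / (2 * (real N)\<^sup>2 * (\<theta> N)\<^sup>2) * edge_sum N A)"
    have "\<not> - (k * (H + e)) \<le> z * (k * y) \<longleftrightarrow> k * (z * y) < k * - (H + e)" by (simp add: algebra_simps not_le)
    also have "\<dots> \<longleftrightarrow> H < - z * y - e" using k by (simp only: mult_less_cancel_left_pos) linarith
    finally show ?thesis unfolding c_hat_def st thr[symmetric] z_def H_def e_def y_def by blast
  qed
  have upper: "hamiltonian N (\<theta> N) A \<sigma> > d_hat N (\<theta> N) \<beta>\<^sub>0 \<alpha> A \<longleftrightarrow> \<not> statistic \<beta>\<^sub>0 N (A, \<sigma>) \<le> z * sqrt (edge_density N A)" for A \<sigma>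
  proof -
    define H where "H = hamiltonian N (\<theta> N) A \<sigma>"
    define e where "e = \<beta>\<^sub>0 / (2 * (real N)\<^sup>2 * (\<theta> N)\<^sup>2) * edge_sum N A"
    define y where "y = sqrt (1 / (2 * (real N)\<^sup>2 * (\<theta> N)\<^sup>2) * edge_sum N A)"
    have "\<not> k * (H + e) \<le> z * (k * y) \<longleftrightarrow> k * (z * y) < k * (H + e)" by (simp add: algebra_simps not_le)
    also have "\<dots> \<longleftrightarrow> H > z * y - e" using k by (simp only: mult_less_cancel_left_pos) linarith
    finally show ?thesis unfolding d_hat_def st thr[symmetric] z_def H_def e_def y_def by blast
  qed
  have compl: "\<P> (model N) {\<omega>. \<not> Q \<omega>} = 1 - \<P> (model N) {\<omega>. Q \<omega>}" for Q
    using measure_pmf.prob_compl[of "{\<omega>. Q \<omega>}" "model N"] by (simp add: Compl_eq_Diff_UNIV[symmetric] Collect_neg_eq)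
  show ?thesis
    unfolding power_function_def lower upper compl[symmetric] z_def[symmetric]
    by (simp add: case_prod_unfold)
qed

text \<open>
  The drift that is responsible for the power of the test.
\<close>

lemma statistic_shift:
  assumes N: "N \<ge> 1"
  shows "statistic \<beta>\<^sub>0 N \<omega> = statistic \<beta> N \<omega>
    - (\<beta> - \<beta>\<^sub>0) * sqrt (graphon_mass W / 2) / sqrt (\<theta> N) * edge_density N (fst \<omega>)"
proof -
  have t: "0 < \<theta> N" using \<theta>[OF N] by simp
  define v where "v = sqrt (graphon_mass W / 2)"
  have v: "0 < v" "graphon_mass W = 2 * (v * v)" using mass_pos by (auto simp: v_def)
  define r where "r = sqrt (\<theta> N)"
  have r: "0 < r" "\<theta> N = r * r" using t by (auto simp: r_def)
  define y where "y = 1 / (2 * (real N)\<^sup>2 * (\<theta> N)\<^sup>2) * edge_sum N (fst \<omega>)"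
  have "r * y / v
      = v / r * edge_density N (fst \<omega>)"
  proof -
    have "r * (1 / (2 * n * (r * r)\<^sup>2) * S) / v = v / r * (S / (n * (r * r) * (2 * (v * v))))" if "0 < n" for n S
      using v(1) r(1) that by (simp add: power2_eq_square)
    then show ?thesis unfolding y_def edge_density_def v(2) r(2) by this (use N in simp)
  qed
  moreover have "r * (H + \<beta> * y) / v - r * (H + \<beta>\<^sub>0 * y) / v = (\<beta> - \<beta>\<^sub>0) * (r * y / v)" for H
  proof -
    have "r * (H + \<beta> * y) - r * (H + \<beta>\<^sub>0 * y) = (\<beta> - \<beta>\<^sub>0) * (r * y)" by (simp add: algebra_simps)
    then show ?thesis by (simp only: diff_divide_distrib[symmetric] times_divide_eq_right)
  qed
  moreover have "b / (2 * (real N)\<^sup>2 * (\<theta> N)\<^sup>2) * edge_sum N (fst \<omega>) = b * y" for b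
    by (simp add: y_def)
  ultimately have "statistic \<beta> N \<omega> - statistic \<beta>\<^sub>0 N \<omega> = (\<beta> - \<beta>\<^sub>0) * (v / r * edge_density N (fst \<omega>))"
    unfolding statistic_def case_prod_unfold r_def[symmetric] v_def[symmetric] by (simp only:)
  then show ?thesis by (simp add: v_def r_def)
qed

lemma power_function_null:
  assumes \<alpha>: "\<alpha> \<in> {0<..<1}"
  shows "(\<lambda>N. power_function N (\<theta> N) W \<beta> \<alpha> \<beta>) \<longlonglongrightarrow> \<alpha>"
proof -
  have z: "std_normal_cdf (normal_z (\<alpha> / 2)) = 1 - \<alpha> / 2"
    using \<alpha> by (intro std_normal_cdf_normal_z) auto
  have "(\<lambda>N. (1 - \<P> (model N) {\<omega>. - statistic \<beta> N \<omega> \<le> normal_z (\<alpha> / 2) * sqrt (edge_density N (fst \<omega>))})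
    + (1 - \<P> (model N) {\<omega>. statistic \<beta> N \<omega> \<le> normal_z (\<alpha> / 2) * sqrt (edge_density N (fst \<omega>))}))
    \<longlonglongrightarrow> (1 - (1 - \<alpha> / 2)) + (1 - (1 - \<alpha> / 2))"
    unfolding z[symmetric]
    by (intro tendsto_intros prob_statistic_le_threshold char_statistic char_to_normal_uminus)
  then have "(\<lambda>N. (1 - \<P> (model N) {\<omega>. - statistic \<beta> N \<omega> \<le> normal_z (\<alpha> / 2) * sqrt (edge_density N (fst \<omega>))})
    + (1 - \<P> (model N) {\<omega>. statistic \<beta> N \<omega> \<le> normal_z (\<alpha> / 2) * sqrt (edge_density N (fst \<omega>))}))
    \<longlonglongrightarrow> \<alpha>" by simp
  then show ?thesis
    by (rule Lim_transform_eventually)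
      (use eventually_ge_at_top[of 1] in eventually_elim, simp add: power_function_eq)
qed

lemma power_function_alternative:
  assumes "\<beta> \<noteq> \<beta>\<^sub>0"
  shows "(\<lambda>N. power_function N (\<theta> N) W \<beta>\<^sub>0 \<alpha> \<beta>) \<longlonglongrightarrow> 1"
proof -
  define z where "z = normal_z (\<alpha> / 2)"
  define d where "d = (\<beta> - \<beta>\<^sub>0) * sqrt (graphon_mass W / 2)"
  have d: "d \<noteq> 0" using assms mass_pos by (simp add: d_def)
  let ?q = "\<lambda>N \<omega>. edge_density N (fst \<omega>)"
  let ?P = "\<lambda>X c N. \<P> (model N) {\<omega>. X \<omega> \<le> z * sqrt (?q N \<omega>) + c / sqrt (\<theta> N) * ?q N \<omega>}"
  have drift: "(\<lambda>N. ?P (X N) c N)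
      \<longlonglongrightarrow> (if 0 < c then 1 else 0)" if X: "char_to_normal X" and c: "c \<noteq> 0" for X c
  proof (cases "0 < c")
    case True
    then show ?thesis using prob_le_diverging_threshold[OF X diverging_threshold[OF True]] by simp
  next
    case False
    then have "0 < - c" using c by simp
    from diverging_threshold[OF this, of "- z"]
    have "(\<lambda>N. \<P> (model N) {\<omega>. - (z * sqrt (?q N \<omega>) + c / sqrt (\<theta> N) * ?q N \<omega>) < K}) \<longlonglongrightarrow> 0" for K
      by simp
    from prob_le_diverging_threshold_neg[OF X this] False show ?thesis by simp
  qed
  have "(\<lambda>N. (1 - ?P (\<lambda>\<omega>. - statistic \<beta> N \<omega>) (- d) N)
      + (1 - ?P (\<lambda>\<omega>. statistic \<beta> N \<omega>) d N))
      \<longlonglongrightarrow> (1 - (if 0 < - d then 1 else 0)) + (1 - (if 0 < d then 1 else 0))"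
    using d by (intro tendsto_intros drift char_statistic char_to_normal_uminus) auto
  moreover have "(1 - (if 0 < - d then 1 else 0)) + (1 - (if 0 < d then 1 else 0)) = (1::real)" using d by auto
  ultimately have "(\<lambda>N. (1 - ?P (\<lambda>\<omega>. - statistic \<beta> N \<omega>) (- d) N)
      + (1 - ?P (\<lambda>\<omega>. statistic \<beta> N \<omega>) d N)) \<longlonglongrightarrow> 1"
    by (simp only:)
  then show ?thesis
  proof (rule Lim_transform_eventually)
    show "\<forall>\<^sub>F N in sequentially. (1 - ?P (\<lambda>\<omega>. - statistic \<beta> N \<omega>) (- d) N)
      + (1 - ?P (\<lambda>\<omega>. statistic \<beta> N \<omega>) d N)
      = power_function N (\<theta> N) W \<beta>\<^sub>0 \<alpha> \<beta>"
      using eventually_ge_at_top[of 1]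
    proof eventually_elim
      case (elim N)
      have "statistic \<beta>\<^sub>0 N \<omega> = statistic \<beta> N \<omega> - d / sqrt (\<theta> N) * ?q N \<omega>" for \<omega>
        unfolding d_def by (rule statistic_shift[OF elim])
      moreover have "- d / sqrt (\<theta> N) * q = - (d / sqrt (\<theta> N) * q)" for q by simp
      ultimately have "- statistic \<beta>\<^sub>0 N \<omega> \<le> z * sqrt (?q N \<omega>)
            \<longleftrightarrow> - statistic \<beta> N \<omega> \<le> z * sqrt (?q N \<omega>) + - d / sqrt (\<theta> N) * ?q N \<omega>"
          "statistic \<beta>\<^sub>0 N \<omega> \<le> z * sqrt (?q N \<omega>)
            \<longleftrightarrow> statistic \<beta> N \<omega> \<le> z * sqrt (?q N \<omega>) + d / sqrt (\<theta> N) * ?q N \<omega>" for \<omega>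
        by (simp_all only:) linarith+
      then show ?case unfolding power_function_eq[OF elim] z_def[symmetric] by (simp only:)
    qed
  qed
qed

end

theorem corollary3p1:
  fixes W :: "real \<Rightarrow> real \<Rightarrow> real" and \<theta> :: "nat \<Rightarrow> real" and \<beta>\<^sub>0 \<alpha> :: real
  assumes "graphon W"
    and "(\<lambda>(x, y). W x y) riemann_integrable_on ({0..1} \<times> {0..1})"
    and "(\<lambda>x. W x x) riemann_integrable_on {0..1}"
    and "(\<integral>(x, y). W x y \<partial>lebesgue_on ({0..1} \<times> {0..1})) > 0"
    and "\<And>N. N \<ge> 1 \<Longrightarrow> \<theta> N \<in> {0<..<1}"
    and "\<exists>C>0. \<forall>\<^sub>F N in sequentially. real N powr (2 / 3) * \<theta> N \<ge> C"
    and "\<theta> \<longlonglongrightarrow> 0"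
    and "\<beta>\<^sub>0 \<in> {0<..<1 / graphon_op_norm W}"
    and "\<alpha> \<in> {0<..<1}"
  shows "((\<lambda>N. power_function N (\<theta> N) W \<beta>\<^sub>0 \<alpha> \<beta>\<^sub>0) \<longlonglongrightarrow> \<alpha>) \<and>
    (\<forall>\<beta>\<in>{0<..<1 / graphon_op_norm W}. \<beta> \<noteq> \<beta>\<^sub>0 \<longrightarrow>
      (\<lambda>N. power_function N (\<theta> N) W \<beta>\<^sub>0 \<alpha> \<beta>) \<longlonglongrightarrow> 1)"
proof -
  have seq: "ising_sequence W \<theta> \<beta>" if "\<beta> \<in> {0<..<1 / graphon_op_norm W}" for \<beta>
    using assms(4) by (intro ising_sequence.intro assms(1,2,5-7) that) (simp only: graphon_mass_def)
  show ?thesis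
    using ising_sequence.power_function_null[OF seq[OF assms(8)] assms(9)]
      ising_sequence.power_function_alternative[OF seq]
    by blast
qed

end
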